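(* Let $n\ge 1$. The Poincaré determinant $\operatorname{Det}_{\mathcal D_2}$ on the Poincaré algebra $\mathcal D_2\subset\mathcal L(\ell^2(\mathbb Z^n))$ induces a determinant on the algebra $\Gamma(\mathcal D_2)\subset\mathcal L(L^2(\mathbb T^n))$, equipped with the norm $\|\cdot\|_\Gamma$, through the formula $$\operatorname{Det}_{\Gamma}(I+T)=\operatorname{Det}_{\mathcal D_2}(I+A),\qquad T=\Gamma(A)=\mathcal F_{\mathbb T^n}^{-1}A\,\mathcal F_{\mathbb T^n},\quad A\in\mathcal D_2 .$$ That is, $(\Gamma(\mathcal D_2),\|\cdot\|_\Gamma)$ is an approximable embedded subalgebra of $\mathcal L(L^2(\mathbb T^n))$, the function $F\mapsto\operatorname{Det}(I+F)$ on the finite rank operators belonging to $\Gamma(\mathcal D_2)$ extends continuously in the norm $\|\cdot\|_\Gamma$ to $\Gamma(\mathcal D_2)$, and this extension is given by the formula above.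
   Context: Determinants in embedded algebras. Let $\mathcal B$ be a Banach space, $\mathcal L(\mathcal B)$ the bounded linear operators on $\mathcal B$, and $\mathcal F(\mathcal B)$ the bounded finite rank operators. For $F\in\mathcal F(\mathcal B)$ one can write $\mathcal B=M_F\oplus N_F$ with $M_F$ finite dimensional, $F(M_F)\subset M_F$ and $N_F\subset\ker F$; then $\operatorname{Tr}(F):=\operatorname{Tr}(F|_{M_F})$ and $\operatorname{Det}(I+F):=\det(I+F|_{M_F})$, independently of the decomposition. A subalgebra $\mathcal D\subset\mathcal L(\mathcal B)$ with a norm $\|\cdot\|_{\mathcal D}$ is an embedded subalgebra if there is $C>0$ with $\|A\|_{\mathcal L(\mathcal B)}\le C\|A\|_{\mathcal D}$ and $\|AB\|_{\mathcal D}\le\|A\|_{\mathcal D}\|B\|_{\mathcal D}$ for all $A,B\in\mathcal D$. It is approximable if $\mathcal F_{\mathcal D}:=\mathcal F(\mathcal B)\cap\mathcal D$ is dense in $\mathcal D$ for $\|\cdot\|_{\mathcal D}$. If $\mathcal D$ is approximable and $F\mapsto\operatorname{Det}(I+F)$ extends continuously in the $\mathcal D$-norm from $\mathcal F_{\mathcal D}$ to $\mathcal D$ (equivalently, $\operatorname{Tr}$ is $\mathcal D$-norm bounded on $\mathcal F_{\mathcal D}$), the value of the extension at $A$ is denoted $\operatorname{Det}_{\mathcal D}(I+A)$. Poincaré algebra. $\mathcal D_2$ is the algebra of bounded operators $A$ on $\ell^2(\mathbb Z^n)$ whose matrix $(a_{jk})_{j,k\in\mathbb Z^n}$ in the standard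 basis, $(A\varphi)(j)=\sum_k a_{jk}\varphi(k)$, satisfies $\|A\|_{\mathcal D_2}:=\sum_{j,k\in\mathbb Z^n}|a_{jk}|<\infty$. It is an approximable embedded subalgebra of $\mathcal L(\ell^2(\mathbb Z^n))$ on which $\operatorname{Tr}$ is bounded; the resulting determinant $\operatorname{Det}_{\mathcal D_2}$ is the Poincaré determinant. Torus. $\mathbb T^n=\mathbb R^n/\mathbb Z^n$, and $\mathcal F_{\mathbb T^n}:L^2(\mathbb T^n)\to\ell^2(\mathbb Z^n)$ is the unitary Fourier transform $(\mathcal F_{\mathbb T^n}\varphi)(k)=\int_{\mathbb T^n}e^{-2\pi i x\cdot k}\varphi(x)\,dx$. For $A\in\mathcal D_2$, $\Gamma(A):=\mathcal F_{\mathbb T^n}^{-1}A\mathcal F_{\mathbb T^n}\in\mathcal L(L^2(\mathbb T^n))$. On $\Gamma(\mathcal D_2)$ the norm is $\|\Gamma(A)\|_\Gamma:=\|A\|_{\mathcal D_2}$. *)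

theory Defs
  imports "HOL-Analysis.Analysis" "Jordan_Normal_Form.Determinant"
begin

(* These clash with vec_nth and inner. *)
no_notation vec_index (infixl \<open>$\<close> 100)
no_notation scalar_prod (infix \<open>\<bullet>\<close> 70)

section \<open>Complex Banach spaces\<close>

class complex_banach = banach +
  fixes scaleC :: "complex \<Rightarrow> 'a \<Rightarrow> 'a" (infixr \<open>*\<^sub>C\<close> 75)
  assumes scaleC_add_right: "c *\<^sub>C (x + y) = c *\<^sub>C x + c *\<^sub>C y"
    and scaleC_add_left: "(b + c) *\<^sub>C x = b *\<^sub>C x + c *\<^sub>C x"
    and scaleC_scaleC: "b *\<^sub>C (c *\<^sub>C x) = (b * c) *\<^sub>C x"
    and scaleC_of_real: "complex_of_real r *\<^sub>C x = r *\<^sub>R x"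
    and norm_scaleC: "norm (c *\<^sub>C x) = cmod c * norm x"

interpretation complex_vector: vector_space "scaleC :: complex \<Rightarrow> 'a \<Rightarrow> 'a::complex_banach"
proof
  fix x :: 'a
  show "1 *\<^sub>C x = x" using scaleC_of_real[of 1 x] by simp
qed (simp_all add: scaleC_add_right scaleC_add_left scaleC_scaleC)

definition bounded_clinear :: "('a::complex_banach \<Rightarrow> 'a) \<Rightarrow> bool" where
  "bounded_clinear A \<longleftrightarrow> bounded_linear A \<and> (\<forall>c x. A (c *\<^sub>C x) = c *\<^sub>C A x)"

definition finite_rank :: "('a::complex_banach \<Rightarrow> 'a) \<Rightarrow> bool" where
  "finite_rank F \<longleftrightarrow> bounded_clinear F \<and> (\<exists>S. finite S \<and> range F \<subseteq> complex_vector.span S)"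


section \<open>Determinants of finite rank perturbations of the identity\<close>

definition is_basis_of :: "'a::complex_banach list \<Rightarrow> 'a set \<Rightarrow> bool" where
  "is_basis_of bs M \<longleftrightarrow>
     distinct bs \<and> complex_vector.independent (set bs) \<and> complex_vector.span (set bs) = M"

definition matrix_in_basis :: "'a::complex_banach list \<Rightarrow> ('a \<Rightarrow> 'a) \<Rightarrow> complex Matrix.mat" where
  "matrix_in_basis bs f = Matrix.mat (length bs) (length bs)
     (\<lambda>(i, j). complex_vector.representation (set bs) (f (bs ! j)) (bs ! i))"

(* det (f restricted to M), for M finite dimensional and f linear with f ` M contained in M *)
definition det_on :: "'a::complex_banach set \<Rightarrow> ('a \<Rightarrow> 'a) \<Rightarrow> complex" where
  "det_on M f = (THE d. \<exists>bs. is_basis_of bs M \<and> d = Determinant.det (matrix_in_basis bs f))"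

definition splitting :: "('a::complex_banach \<Rightarrow> 'a) \<Rightarrow> 'a set \<Rightarrow> 'a set \<Rightarrow> bool" where
  "splitting F M N \<longleftrightarrow>
     complex_vector.subspace M \<and> complex_vector.subspace N \<and>
     M \<inter> N = {0} \<and> (\<forall>x. \<exists>m\<in>M. \<exists>n\<in>N. x = m + n) \<and>
     (\<exists>S. finite S \<and> M = complex_vector.span S) \<and>
     F ` M \<subseteq> M \<and> (\<forall>x\<in>N. F x = 0)"

(* Det (I + F); the description expresses that the value does not depend on the splitting. *)
definition det_one_plus :: "('a::complex_banach \<Rightarrow> 'a) \<Rightarrow> complex" where
  "det_one_plus F = (THE d. \<exists>M N. splitting F M N \<and> d = det_on M (\<lambda>x. x + F x))"


section \<open>Embedded algebras and extended determinants\<close>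

definition subalgebra :: "('a::complex_banach \<Rightarrow> 'a) set \<Rightarrow> bool" where
  "subalgebra D \<longleftrightarrow>
     (\<forall>A\<in>D. bounded_clinear A) \<and> (\<lambda>x. 0) \<in> D \<and>
     (\<forall>A\<in>D. \<forall>B\<in>D. (\<lambda>x. A x + B x) \<in> D) \<and>
     (\<forall>c. \<forall>A\<in>D. (\<lambda>x. c *\<^sub>C A x) \<in> D) \<and>
     (\<forall>A\<in>D. \<forall>B\<in>D. A \<circ> B \<in> D)"

definition norm_on :: "('a::complex_banach \<Rightarrow> 'a) set \<Rightarrow> (('a \<Rightarrow> 'a) \<Rightarrow> real) \<Rightarrow> bool" where
  "norm_on D nrm \<longleftrightarrow>
     (\<forall>A\<in>D. 0 \<le> nrm A) \<and> (\<forall>A\<in>D. nrm A = 0 \<longleftrightarrow> A = (\<lambda>x. 0)) \<and>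
     (\<forall>A\<in>D. \<forall>B\<in>D. nrm (\<lambda>x. A x + B x) \<le> nrm A + nrm B) \<and>
     (\<forall>c. \<forall>A\<in>D. nrm (\<lambda>x. c *\<^sub>C A x) = cmod c * nrm A)"

definition embedded_subalgebra ::
    "('a::complex_banach \<Rightarrow> 'a) set \<Rightarrow> (('a \<Rightarrow> 'a) \<Rightarrow> real) \<Rightarrow> bool" where
  "embedded_subalgebra D nrm \<longleftrightarrow>
     subalgebra D \<and> norm_on D nrm \<and>
     (\<exists>C>0. \<forall>A\<in>D. onorm A \<le> C * nrm A) \<and>
     (\<forall>A\<in>D. \<forall>B\<in>D. nrm (A \<circ> B) \<le> nrm A * nrm B)"

definition approximable ::
    "('a::complex_banach \<Rightarrow> 'a) set \<Rightarrow> (('a \<Rightarrow> 'a) \<Rightarrow> real) \<Rightarrow> bool" where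
  "approximable D nrm \<longleftrightarrow>
     (\<forall>A\<in>D. \<forall>e>0. \<exists>F\<in>D. finite_rank F \<and> nrm (\<lambda>x. A x - F x) < e)"

(* g A plays the role of Det_D (I + A). *)
definition is_det_extension ::
    "('a::complex_banach \<Rightarrow> 'a) set \<Rightarrow> (('a \<Rightarrow> 'a) \<Rightarrow> real) \<Rightarrow> (('a \<Rightarrow> 'a) \<Rightarrow> complex) \<Rightarrow> bool" where
  "is_det_extension D nrm g \<longleftrightarrow>
     (\<forall>F\<in>D. finite_rank F \<longrightarrow> g F = det_one_plus F) \<and>
     (\<forall>A\<in>D. \<forall>e>0. \<exists>d>0. \<forall>B\<in>D. nrm (\<lambda>x. B x - A x) < d \<longrightarrow> cmod (g B - g A) < e)"

(* Det_D (I + A); for approximable D the continuous extension is unique on D if it exists. *)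
definition extended_det ::
    "('a::complex_banach \<Rightarrow> 'a) set \<Rightarrow> (('a \<Rightarrow> 'a) \<Rightarrow> real) \<Rightarrow> ('a \<Rightarrow> 'a) \<Rightarrow> complex" where
  "extended_det D nrm A = (THE z. \<exists>g. is_det_extension D nrm g \<and> z = g A)"


section \<open>Square-integrable functions\<close>

definition square_integrable :: "'a measure \<Rightarrow> ('a \<Rightarrow> complex) \<Rightarrow> bool" where
  "square_integrable M f \<longleftrightarrow> f \<in> borel_measurable M \<and> integrable M (\<lambda>x. (cmod (f x))\<^sup>2)"

lemma square_integrable_measurable [measurable_dest]:
  "square_integrable M f \<Longrightarrow> f \<in> borel_measurable M"
  by (simp add: square_integrable_def)

lemma square_integrable_zero [simp]: "square_integrable M (\<lambda>x. 0)"
  by (simp add: square_integrable_def)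

lemma square_integrable_cmult:
  assumes "square_integrable M f" shows "square_integrable M (\<lambda>x. c * f x)"
  using assms by (auto simp: square_integrable_def norm_mult power_mult_distrib)

lemma cmod_add_square_le: "(cmod (a + b))\<^sup>2 \<le> 2 * (cmod a)\<^sup>2 + 2 * (cmod b)\<^sup>2"
proof -
  have "(cmod (a + b))\<^sup>2 \<le> (cmod a + cmod b)\<^sup>2"
    by (simp add: norm_triangle_ineq power_mono)
  also have "\<dots> \<le> 2 * (cmod a)\<^sup>2 + 2 * (cmod b)\<^sup>2"
    using sum_squares_bound[of "cmod a" "cmod b"] by (simp add: power2_sum)
  finally show ?thesis .
qed

lemma square_integrable_add:
  assumes f: "square_integrable M f" and g: "square_integrable M g"
  shows "square_integrable M (\<lambda>x. f x + g x)"
proof -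
  have [measurable]: "f \<in> borel_measurable M" "g \<in> borel_measurable M"
    using f g by (auto simp: square_integrable_def)
  have "integrable M (\<lambda>x. 2 * (cmod (f x))\<^sup>2 + 2 * (cmod (g x))\<^sup>2)"
    using f g by (auto simp: square_integrable_def)
  then have "integrable M (\<lambda>x. (cmod (f x + g x))\<^sup>2)"
    by (rule Bochner_Integration.integrable_bound) (auto intro!: AE_I2 cmod_add_square_le)
  then show ?thesis by (simp add: square_integrable_def)
qed

lemma square_integrable_diff:
  assumes f: "square_integrable M f" and g: "square_integrable M g"
  shows "square_integrable M (\<lambda>x. f x - g x)"
  using square_integrable_add[OF f square_integrable_cmult[OF g, of "-1"]] by simp

lemma square_integrable_uminus:
  assumes f: "square_integrable M f" shows "square_integrable M (\<lambda>x. - f x)"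
  using square_integrable_cmult[OF f, of "-1"] by simp

lemma integrable_inner_square:
  assumes f: "square_integrable M f" and g: "square_integrable M g"
  shows "integrable M (\<lambda>x. f x \<bullet> g x)"
proof -
  have [measurable]: "f \<in> borel_measurable M" "g \<in> borel_measurable M"
    using f g by (auto simp: square_integrable_def)
  have "integrable M (\<lambda>x. (cmod (f x))\<^sup>2 + (cmod (g x))\<^sup>2)"
    using f g by (auto simp: square_integrable_def)
  then show ?thesis
  proof (rule Bochner_Integration.integrable_bound)
    show "AE x in M. norm (f x \<bullet> g x) \<le> norm ((cmod (f x))\<^sup>2 + (cmod (g x))\<^sup>2)"
    proof (rule AE_I2)
      fix x
      have "\<bar>f x \<bullet> g x\<bar> \<le> cmod (f x) * cmod (g x)" by (rule Cauchy_Schwarz_ineq2)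
      also have "\<dots> \<le> (cmod (f x))\<^sup>2 + (cmod (g x))\<^sup>2"
      proof -
        have "0 \<le> cmod (f x) * cmod (g x)" by simp
        then show ?thesis using sum_squares_bound[of "cmod (f x)" "cmod (g x)"] by linarith
      qed
      finally show "norm (f x \<bullet> g x) \<le> norm ((cmod (f x))\<^sup>2 + (cmod (g x))\<^sup>2)" by simp
    qed
  qed measurable
qed

lemma square_integrable_complete:
  fixes f :: "nat \<Rightarrow> 'a \<Rightarrow> complex"
  assumes f: "\<And>n. square_integrable M (f n)"
    and Cauchy: "\<And>e. e > 0 \<Longrightarrow> \<exists>N. \<forall>m\<ge>N. \<forall>n\<ge>N. (\<integral>x. (cmod (f m x - f n x))\<^sup>2 \<partial>M) < e"
  shows "\<exists>g. square_integrable M g \<and> (\<lambda>n. \<integral>x. (cmod (f n x - g x))\<^sup>2 \<partial>M) \<longlonglongrightarrow> 0"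
proof -
  have [measurable]: "f n \<in> borel_measurable M" for n
    using f by (auto simp: square_integrable_def)
  have int: "integrable M (\<lambda>x. (cmod (f m x - f n x))\<^sup>2)" for m n
    using square_integrable_diff[OF f f] by (auto simp: square_integrable_def)
  have nn: "(\<integral>\<^sup>+x. ennreal ((cmod (f m x - f n x))\<^sup>2) \<partial>M) = ennreal (\<integral>x. (cmod (f m x - f n x))\<^sup>2 \<partial>M)" for m n
    by (rule nn_integral_eq_integral[OF int]) simp
  have "\<forall>k. \<exists>N. \<forall>m\<ge>N. \<forall>n\<ge>N. (\<integral>x. (cmod (f m x - f n x))\<^sup>2 \<partial>M) < (1/4)^k"
    by (intro allI Cauchy) simp
  then obtain N where N: "\<And>k m n. m \<ge> N k \<Longrightarrow> n \<ge> N k \<Longrightarrow> (\<integral>x. (cmod (f m x - f n x))\<^sup>2 \<partial>M) < (1/4)^k"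
    by metis
  define r where "r k = (\<Sum>j\<le>k. N j + 1)" for k :: nat
  have rN: "N k \<le> r k" for k
  proof -
    have "N k + 1 \<le> r k" unfolding r_def by (rule member_le_sum) auto
    then show ?thesis by simp
  qed
  have rSuc: "r k \<le> r (Suc k)" for k unfolding r_def by simp
  have rk: "k \<le> r k" for k
    by (induction k) (auto simp: r_def)
  define h where "h k x = f (r (Suc k)) x - f (r k) x" for k x
  have [measurable]: "h k \<in> borel_measurable M" for k unfolding h_def by measurable
  have hint: "(\<integral>\<^sup>+x. ennreal ((cmod (h k x))\<^sup>2) \<partial>M) \<le> ennreal ((1/4)^k)" for k
    unfolding h_def nn using N[of k "r (Suc k)" "r k"] rN[of k] rSuc[of k]
    by (intro ennreal_leI) auto
  have "(\<integral>\<^sup>+x. (\<Sum>k. ennreal (2^k * (cmod (h k x))\<^sup>2)) \<partial>M)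
        = (\<Sum>k. (\<integral>\<^sup>+x. ennreal (2^k * (cmod (h k x))\<^sup>2) \<partial>M))"
    by (rule nn_integral_suminf) measurable
  also have "\<dots> \<le> (\<Sum>k. ennreal ((1/2)^k))"
  proof (rule suminf_le)
    fix k
    have "(\<integral>\<^sup>+x. ennreal (2^k * (cmod (h k x))\<^sup>2) \<partial>M) = ennreal (2^k) * (\<integral>\<^sup>+x. ennreal ((cmod (h k x))\<^sup>2) \<partial>M)"
      by (simp add: ennreal_mult nn_integral_cmult)
    also have "\<dots> \<le> ennreal (2^k) * ennreal ((1/4)^k)"
      by (intro mult_left_mono hint) simp
    also have "\<dots> = ennreal (2^k * (1/4)^k)"
      by (rule ennreal_mult[symmetric]) auto
    also have "2^k * (1/4)^k = ((1/2)^k :: real)"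
      by (simp add: power_mult_distrib[symmetric])
    finally show "(\<integral>\<^sup>+x. ennreal (2^k * (cmod (h k x))\<^sup>2) \<partial>M) \<le> ennreal ((1/2)^k)" .
  qed auto
  also have "\<dots> = ennreal (\<Sum>k. (1/2)^k)"
    by (rule suminf_ennreal2) auto
  also have "\<dots> < \<infinity>" by simp
  finally have fin: "(\<integral>\<^sup>+x. (\<Sum>k. ennreal (2^k * (cmod (h k x))\<^sup>2)) \<partial>M) \<noteq> \<infinity>" by simp
  have conv: "AE x in M. convergent (\<lambda>k. f (r k) x)"
  proof -
    have "AE x in M. (\<Sum>k. ennreal (2^k * (cmod (h k x))\<^sup>2)) \<noteq> \<infinity>"
      by (rule nn_integral_PInf_AE[OF _ fin]) measurable
    then show ?thesis
    proof (rule AE_mp, intro AE_I2 impI)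
      fix x assume "(\<Sum>k. ennreal (2^k * (cmod (h k x))\<^sup>2)) \<noteq> \<infinity>"
      then have "summable (\<lambda>k. 2^k * (cmod (h k x))\<^sup>2)"
        by (intro summable_suminf_not_top) auto
      then have "(\<lambda>k. 2^k * (cmod (h k x))\<^sup>2) \<longlonglongrightarrow> 0" by (rule summable_LIMSEQ_zero)
      then have ev: "eventually (\<lambda>k. 2^k * (cmod (h k x))\<^sup>2 < 1) sequentially"
        by (rule order_tendstoD) simp
      have "summable (\<lambda>k. h k x)"
      proof (rule summable_comparison_test_ev)
        show "summable (\<lambda>k. (1 / sqrt 2)^k)"
          by (rule summable_geometric) (simp add: real_less_rsqrt)
        show "eventually (\<lambda>k. norm (h k x) \<le> (1 / sqrt 2)^k) sequentially"
          using ev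
        proof (rule eventually_mono)
          fix k assume *: "2^k * (cmod (h k x))\<^sup>2 < 1"
          have "((1 / sqrt 2)^k)\<^sup>2 = (((1 / sqrt 2)\<^sup>2)^k :: real)"
            by (simp only: power_mult[symmetric] mult.commute)
          also have "\<dots> = (1/2)^k" by (simp add: power_divide)
          finally have "(cmod (h k x))\<^sup>2 \<le> ((1 / sqrt 2)^k)\<^sup>2"
            using * by (simp add: power_divide field_simps)
          then show "norm (h k x) \<le> (1 / sqrt 2)^k"
            by (rule power2_le_imp_le) simp
        qed
      qed
      then have "convergent (\<lambda>n. \<Sum>k<n. h k x)" by (simp add: summable_iff_convergent)
      moreover have "(\<Sum>k<n. h k x) = f (r n) x - f (r 0) x" for n
        unfolding h_def by (rule sum_lessThan_telescope)
      ultimately have "convergent (\<lambda>n. (f (r n) x - f (r 0) x) + f (r 0) x)"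
        by (intro convergent_add) (auto simp: convergent_const)
      then show "convergent (\<lambda>k. f (r k) x)" by simp
    qed
  qed
  define g where "g x = lim (\<lambda>k. f (r k) x)" for x
  have [measurable]: "g \<in> borel_measurable M" unfolding g_def by measurable
  have lim: "AE x in M. (\<lambda>k. f (r k) x) \<longlonglongrightarrow> g x"
    using conv by (rule AE_mp) (auto simp: g_def convergent_LIMSEQ_iff)
  have bound: "\<exists>K. \<forall>n\<ge>K. (\<integral>\<^sup>+x. ennreal ((cmod (f n x - g x))\<^sup>2) \<partial>M) \<le> ennreal e" if e: "e > 0" for e :: real
  proof -
    obtain K where K: "\<And>m n. m \<ge> K \<Longrightarrow> n \<ge> K \<Longrightarrow> (\<integral>x. (cmod (f m x - f n x))\<^sup>2 \<partial>M) < e"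
      using Cauchy[OF e] by blast
    have "(\<integral>\<^sup>+x. ennreal ((cmod (f n x - g x))\<^sup>2) \<partial>M) \<le> ennreal e" if n: "n \<ge> K" for n
    proof -
      have "(\<integral>\<^sup>+x. ennreal ((cmod (f n x - g x))\<^sup>2) \<partial>M)
          = (\<integral>\<^sup>+x. liminf (\<lambda>k. ennreal ((cmod (f n x - f (r k) x))\<^sup>2)) \<partial>M)"
      proof (rule nn_integral_cong_AE)
        show "AE x in M. ennreal ((cmod (f n x - g x))\<^sup>2) = liminf (\<lambda>k. ennreal ((cmod (f n x - f (r k) x))\<^sup>2))"
          using lim
        proof (rule AE_mp, intro AE_I2 impI)
          fix x assume "(\<lambda>k. f (r k) x) \<longlonglongrightarrow> g x"
          then have "(\<lambda>k. ennreal ((cmod (f n x - f (r k) x))\<^sup>2)) \<longlonglongrightarrow> ennreal ((cmod (f n x - g x))\<^sup>2)"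
            by (intro tendsto_intros)
          then show "ennreal ((cmod (f n x - g x))\<^sup>2) = liminf (\<lambda>k. ennreal ((cmod (f n x - f (r k) x))\<^sup>2))"
            by (intro lim_imp_Liminf[symmetric]) simp_all
        qed
      qed
      also have "\<dots> \<le> liminf (\<lambda>k. (\<integral>\<^sup>+x. ennreal ((cmod (f n x - f (r k) x))\<^sup>2) \<partial>M))"
        by (rule nn_integral_liminf) measurable
      also have "\<dots> \<le> limsup (\<lambda>k. (\<integral>\<^sup>+x. ennreal ((cmod (f n x - f (r k) x))\<^sup>2) \<partial>M))"
        by (rule Liminf_le_Limsup) simp
      also have "\<dots> \<le> ennreal e"
      proof (rule Limsup_bounded)
        show "eventually (\<lambda>k. (\<integral>\<^sup>+x. ennreal ((cmod (f n x - f (r k) x))\<^sup>2) \<partial>M) \<le> ennreal e) sequentially"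
          using eventually_ge_at_top[of K]
        proof (rule eventually_mono)
          fix k assume "K \<le> k"
          then have "r k \<ge> K" using rk[of k] by linarith
          then show "(\<integral>\<^sup>+x. ennreal ((cmod (f n x - f (r k) x))\<^sup>2) \<partial>M) \<le> ennreal e"
            unfolding nn using K[OF n] by (intro ennreal_leI) (auto intro: less_imp_le)
        qed
      qed
      finally show ?thesis .
    qed
    then show ?thesis by blast
  qed
  obtain K where K: "(\<integral>\<^sup>+x. ennreal ((cmod (f K x - g x))\<^sup>2) \<partial>M) \<le> ennreal 1"
    using bound[of 1] by auto
  have "square_integrable M (\<lambda>x. f K x - g x)"
    unfolding square_integrable_def using K
    by (auto intro!: integrableI_bounded simp: le_less_trans)
  then have "square_integrable M (\<lambda>x. f K x - (f K x - g x))"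
    by (rule square_integrable_diff[OF f])
  then have g: "square_integrable M g" by simp
  have "(\<lambda>n. \<integral>x. (cmod (f n x - g x))\<^sup>2 \<partial>M) \<longlonglongrightarrow> 0"
  proof (rule LIMSEQ_I)
    fix e :: real assume "e > 0"
    then obtain K where K: "\<And>n. n \<ge> K \<Longrightarrow> (\<integral>\<^sup>+x. ennreal ((cmod (f n x - g x))\<^sup>2) \<partial>M) \<le> ennreal (e/2)"
      using bound[of "e/2"] by auto
    have "norm ((\<integral>x. (cmod (f n x - g x))\<^sup>2 \<partial>M) - 0) < e" if "n \<ge> K" for n
    proof -
      have "(\<integral>\<^sup>+x. ennreal ((cmod (f n x - g x))\<^sup>2) \<partial>M) = ennreal (\<integral>x. (cmod (f n x - g x))\<^sup>2 \<partial>M)"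
        using square_integrable_diff[OF f g, of n]
        by (intro nn_integral_eq_integral) (auto simp: square_integrable_def)
      then have "(\<integral>x. (cmod (f n x - g x))\<^sup>2 \<partial>M) \<le> e/2"
        using K[OF that] \<open>e > 0\<close> by simp
      then show ?thesis using \<open>e > 0\<close> by (simp add: abs_of_nonneg)
    qed
    then show "\<exists>K. \<forall>n\<ge>K. norm ((\<integral>x. (cmod (f n x - g x))\<^sup>2 \<partial>M) - 0) < e" by blast
  qed
  with g show ?thesis by blast
qed


section \<open>The space of square-summable families\<close>

typedef 'i ell2 = "{f :: 'i \<Rightarrow> complex. (\<lambda>i. (cmod (f i))\<^sup>2) summable_on UNIV}"
  morphisms ell2_apply Abs_ell2
  by (rule exI[of _ "\<lambda>_. 0"]) simp

setup_lifting type_definition_ell2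

lemma integrable_count_space_iff:
  fixes f :: "'i \<Rightarrow> real"
  assumes "\<And>i. 0 \<le> f i"
  shows "integrable (count_space UNIV) f \<longleftrightarrow> f summable_on UNIV"
proof -
  have "f summable_on UNIV \<longleftrightarrow> Infinite_Sum.abs_summable_on f UNIV" using assms by simp
  also have "\<dots> \<longleftrightarrow> integrable (count_space UNIV) f"
    by (simp only: abs_summable_equivalent Infinite_Set_Sum.abs_summable_on_def)
  finally show ?thesis ..
qed

lemma integral_count_space_eq_infsum:
  fixes f :: "'i \<Rightarrow> real"
  assumes "integrable (count_space UNIV) f"
  shows "(\<integral>i. f i \<partial>count_space UNIV) = infsum f UNIV"
  using infsetsum_infsum[of f UNIV] assms
  by (simp add: Infinite_Set_Sum.abs_summable_on_def infsetsum_def)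

lemma square_integrable_count_space_iff:
  "square_integrable (count_space UNIV) f \<longleftrightarrow> (\<lambda>i. (cmod (f i))\<^sup>2) summable_on UNIV"
  by (simp add: square_integrable_def integrable_count_space_iff)

lemma square_integrable_ell2_apply: "square_integrable (count_space UNIV) (ell2_apply f)"
  using ell2_apply[of f] by (simp add: square_integrable_count_space_iff)

instantiation ell2 :: (type) real_inner
begin

lift_definition zero_ell2 :: "'a ell2" is "\<lambda>_. 0" by simp

lift_definition plus_ell2 :: "'a ell2 \<Rightarrow> 'a ell2 \<Rightarrow> 'a ell2" is "\<lambda>f g i. f i + g i"
  unfolding square_integrable_count_space_iff[symmetric] by (rule square_integrable_add)

lift_definition minus_ell2 :: "'a ell2 \<Rightarrow> 'a ell2 \<Rightarrow> 'a ell2" is "\<lambda>f g i. f i - g i"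
  unfolding square_integrable_count_space_iff[symmetric] by (rule square_integrable_diff)

lift_definition uminus_ell2 :: "'a ell2 \<Rightarrow> 'a ell2" is "\<lambda>f i. - f i" by simp

lift_definition scaleR_ell2 :: "real \<Rightarrow> 'a ell2 \<Rightarrow> 'a ell2" is "\<lambda>r f i. of_real r * f i"
  unfolding square_integrable_count_space_iff[symmetric] by (rule square_integrable_cmult)

(* The real inner product Re <f, g>; it induces the usual norm. *)
lift_definition inner_ell2 :: "'a ell2 \<Rightarrow> 'a ell2 \<Rightarrow> real" is "\<lambda>f g. \<Sum>\<^sub>\<infinity>i. f i \<bullet> g i" .

lift_definition norm_ell2 :: "'a ell2 \<Rightarrow> real" is "\<lambda>f. sqrt (\<Sum>\<^sub>\<infinity>i. (cmod (f i))\<^sup>2)" .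

definition sgn_ell2 :: "'a ell2 \<Rightarrow> 'a ell2" where
  "sgn_ell2 x = inverse (norm x) *\<^sub>R x"

definition dist_ell2 :: "'a ell2 \<Rightarrow> 'a ell2 \<Rightarrow> real" where "dist_ell2 x y = norm (x - y)"

definition uniformity_ell2 :: "('a ell2 \<times> 'a ell2) filter" where
  "uniformity_ell2 = (INF e\<in>{0<..}. principal {(x, y). dist x y < e})"

definition open_ell2 :: "'a ell2 set \<Rightarrow> bool" where
  "open_ell2 U \<longleftrightarrow> (\<forall>x\<in>U. eventually (\<lambda>(x', y). x' = x \<longrightarrow> y \<in> U) uniformity)"

instance
proof
  fix x y z :: "'a ell2" and r s :: real and U :: "'a ell2 set"
  note int = integrable_inner_square[OF square_integrable_ell2_apply square_integrable_ell2_apply]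
  have inner_int: "x \<bullet> y = (\<integral>i. ell2_apply x i \<bullet> ell2_apply y i \<partial>count_space UNIV)"
    for x y :: "'a ell2"
    by (simp add: inner_ell2.rep_eq integral_count_space_eq_infsum[OF int])
  have inner_self: "x \<bullet> x = (\<integral>i. (cmod (ell2_apply x i))\<^sup>2 \<partial>count_space UNIV)"
    for x :: "'a ell2"
    by (simp add: inner_int power2_norm_eq_inner)
  show "x + y + z = x + (y + z)" by transfer (simp add: add.assoc)
  show "x + y = y + x" by transfer (simp add: add.commute)
  show "0 + x = x" by transfer simp
  show "- x + x = 0" by transfer simp
  show "x - y = x + - y" by transfer simp
  show "r *\<^sub>R (x + y) = r *\<^sub>R x + r *\<^sub>R y" by transfer (simp add: algebra_simps)
  show "(r + s) *\<^sub>R x = r *\<^sub>R x + s *\<^sub>R x" by transfer (simp add: algebra_simps)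
  show "r *\<^sub>R s *\<^sub>R x = (r * s) *\<^sub>R x" by transfer (simp add: algebra_simps)
  show "1 *\<^sub>R x = x" by transfer simp
  show "sgn x = inverse (norm x) *\<^sub>R x" by (rule sgn_ell2_def)
  show "dist x y = norm (x - y)" by (rule dist_ell2_def)
  show "uniformity = (INF e\<in>{0<..}. principal {(x, y). dist (x :: 'a ell2) y < e})"
    by (rule uniformity_ell2_def)
  show "open U \<longleftrightarrow> (\<forall>x\<in>U. eventually (\<lambda>(x', y). x' = x \<longrightarrow> y \<in> U) uniformity)"
    by (rule open_ell2_def)
  show "x \<bullet> y = y \<bullet> x" by transfer (simp add: inner_commute)
  show "(x + y) \<bullet> z = x \<bullet> z + y \<bullet> z"
    unfolding inner_int plus_ell2.rep_eq inner_add_left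
    by (rule Bochner_Integration.integral_add[OF int int])
  show "(r *\<^sub>R x) \<bullet> y = r * (x \<bullet> y)"
    unfolding inner_int scaleR_ell2.rep_eq
    by (simp add: scaleR_conv_of_real[symmetric])
  show "0 \<le> x \<bullet> x" unfolding inner_self by simp
  show "x \<bullet> x = 0 \<longleftrightarrow> x = 0"
  proof -
    have "x \<bullet> x = 0 \<longleftrightarrow> (AE i in count_space UNIV. (cmod (ell2_apply x i))\<^sup>2 = 0)"
      unfolding inner_self using square_integrable_ell2_apply[of x]
      by (intro integral_nonneg_eq_0_iff_AE) (auto simp: square_integrable_def)
    also have "\<dots> \<longleftrightarrow> x = 0"
      by (auto simp: AE_count_space ell2_apply_inject[symmetric] zero_ell2.rep_eq)
    finally show ?thesis .
  qed
  show "norm x = sqrt (x \<bullet> x)" by transfer (simp add: power2_norm_eq_inner)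
qed

end

lemma norm_ell2_square:
  "(norm x)\<^sup>2 = (\<integral>i. (cmod (ell2_apply x i))\<^sup>2 \<partial>count_space UNIV)"
proof -
  have "(\<integral>i. (cmod (ell2_apply x i))\<^sup>2 \<partial>count_space UNIV) = (\<Sum>\<^sub>\<infinity>i. (cmod (ell2_apply x i))\<^sup>2)"
    using square_integrable_ell2_apply[of x]
    by (intro integral_count_space_eq_infsum) (simp add: square_integrable_def)
  then show ?thesis by (simp add: norm_ell2.rep_eq infsum_nonneg)
qed

instantiation ell2 :: (type) complex_banach
begin

lift_definition scaleC_ell2 :: "complex \<Rightarrow> 'a ell2 \<Rightarrow> 'a ell2" is "\<lambda>c f i. c * f i"
  unfolding square_integrable_count_space_iff[symmetric] by (rule square_integrable_cmult)

instance
proof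
  fix X :: "nat \<Rightarrow> 'a ell2"
  assume X: "Cauchy X"
  have diff: "(norm (X m - X n))\<^sup>2 =
      (\<integral>i. (cmod (ell2_apply (X m) i - ell2_apply (X n) i))\<^sup>2 \<partial>count_space UNIV)" for m n
    by (simp add: norm_ell2_square minus_ell2.rep_eq)
  have "\<exists>g. square_integrable (count_space UNIV) g \<and>
      (\<lambda>n. \<integral>i. (cmod (ell2_apply (X n) i - g i))\<^sup>2 \<partial>count_space UNIV) \<longlonglongrightarrow> 0"
  proof (rule square_integrable_complete[OF square_integrable_ell2_apply])
    fix e :: real assume "e > 0"
    then have "sqrt e > 0" by simp
    then obtain N where N: "\<And>m n. m \<ge> N \<Longrightarrow> n \<ge> N \<Longrightarrow> norm (X m - X n) < sqrt e"
      using X unfolding Cauchy_def dist_norm by blast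
    have "(norm (X m - X n))\<^sup>2 < e" if "m \<ge> N" "n \<ge> N" for m n
      using power_strict_mono[OF N[OF that], of 2] \<open>e > 0\<close> by simp
    then show "\<exists>N. \<forall>m\<ge>N. \<forall>n\<ge>N.
        (\<integral>i. (cmod (ell2_apply (X m) i - ell2_apply (X n) i))\<^sup>2 \<partial>count_space UNIV) < e"
      unfolding diff by blast
  qed
  then obtain g where g: "square_integrable (count_space UNIV) g"
    and lim: "(\<lambda>n. \<integral>i. (cmod (ell2_apply (X n) i - g i))\<^sup>2 \<partial>count_space UNIV) \<longlonglongrightarrow> 0"
    by blast
  have G: "ell2_apply (Abs_ell2 g) = g"
    using g by (simp add: Abs_ell2_inverse square_integrable_count_space_iff)
  have "(\<lambda>n. (norm (X n - Abs_ell2 g))\<^sup>2) \<longlonglongrightarrow> 0"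
    using lim by (simp add: norm_ell2_square minus_ell2.rep_eq G)
  then have "(\<lambda>n. norm (X n - Abs_ell2 g)) \<longlonglongrightarrow> 0"
    using tendsto_real_sqrt by fastforce
  then have "X \<longlonglongrightarrow> Abs_ell2 g" by (simp add: LIM_zero_iff tendsto_norm_zero_iff)
  then show "convergent X" by (rule convergentI)
next
  fix b c :: complex and r :: real and x y :: "'a ell2"
  show "c *\<^sub>C (x + y) = c *\<^sub>C x + c *\<^sub>C y" by transfer (simp add: algebra_simps)
  show "(b + c) *\<^sub>C x = b *\<^sub>C x + c *\<^sub>C x" by transfer (simp add: algebra_simps)
  show "b *\<^sub>C (c *\<^sub>C x) = (b * c) *\<^sub>C x" by transfer (simp add: algebra_simps)
  show "complex_of_real r *\<^sub>C x = r *\<^sub>R x" by transfer simp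
  have "(norm (c *\<^sub>C x))\<^sup>2 = (cmod c * norm x)\<^sup>2"
    by (simp add: norm_ell2_square scaleC_ell2.rep_eq norm_mult power_mult_distrib)
  then show "norm (c *\<^sub>C x) = cmod c * norm x" by (simp add: power2_eq_iff_nonneg)
qed

end


section \<open>The Poincare algebra\<close>

lift_definition ell2_unit :: "'i \<Rightarrow> 'i ell2" is "\<lambda>k j. if j = k then 1 else 0"
  by (rule finite_nonzero_values_imp_summable_on) (simp add: if_distrib cong: if_cong)

(* For bounded complex-linear A, (A phi)(j) is the sum over k of entry A j k * phi(k). *)
definition entry :: "('i ell2 \<Rightarrow> 'i ell2) \<Rightarrow> 'i \<Rightarrow> 'i \<Rightarrow> complex" where
  "entry A j k = ell2_apply (A (ell2_unit k)) j"

definition poincare_algebra :: "((int^'n) ell2 \<Rightarrow> (int^'n) ell2) set" where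
  "poincare_algebra = {A. bounded_clinear A \<and> (\<lambda>(j, k). cmod (entry A j k)) summable_on UNIV}"

definition poincare_norm :: "((int^'n) ell2 \<Rightarrow> (int^'n) ell2) \<Rightarrow> real" where
  "poincare_norm A = (\<Sum>\<^sub>\<infinity>(j, k). cmod (entry A j k))"


section \<open>The torus and its space of square-integrable functions\<close>

quotient_type (overloaded) 'n torus = "real^'n" / "\<lambda>x y. \<forall>i. x $ i - y $ i \<in> \<int>"
proof (rule equivpI)
  show "reflp (\<lambda>x y :: real^'n. \<forall>i. x $ i - y $ i \<in> \<int>)" by (simp add: reflp_def)
  show "symp (\<lambda>x y :: real^'n. \<forall>i. x $ i - y $ i \<in> \<int>)"
    by (auto simp: symp_def) (metis Ints_minus minus_diff_eq)
  show "transp (\<lambda>x y :: real^'n. \<forall>i. x $ i - y $ i \<in> \<int>)"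
    by (auto simp: transp_def) (metis Ints_add diff_add_cancel add_diff_eq)
qed

instantiation torus :: (finite) topological_space
begin

(* the quotient topology *)
definition open_torus :: "'a torus set \<Rightarrow> bool" where
  "open_torus U \<longleftrightarrow> open (abs_torus -` U)"

instance
proof
  show "open (UNIV :: 'a torus set)" by (simp add: open_torus_def)
  show "open (S \<inter> T)" if "open S" "open T" for S T :: "'a torus set"
    using that by (simp add: open_torus_def open_Int)
  show "open (\<Union>K)" if "\<forall>S\<in>K. open S" for K :: "'a torus set set"
    using that by (auto simp: open_torus_def vimage_Union)
qed

end

(* Normalised Haar measure: push-forward of Lebesgue measure on the fundamental domain [0,1)^n. *)
definition torus_measure :: "('n::finite) torus measure" where
  "torus_measure = distr (restrict_space lborel {x :: real^'n. \<forall>i. 0 \<le> x $ i \<and> x $ i < 1}) borel abs_torus"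

lemma sets_torus_measure [simp, measurable_cong]: "sets torus_measure = sets borel"
  by (simp add: torus_measure_def)

quotient_type (overloaded) 'n l2_torus = "('n::finite) torus \<Rightarrow> complex" /
  partial: "\<lambda>f g. square_integrable torus_measure f \<and> square_integrable torus_measure g \<and>
    (AE x in torus_measure. f x = g x)"
proof (rule part_equivpI)
  show "\<exists>f :: 'n torus \<Rightarrow> complex. square_integrable torus_measure f \<and>
      square_integrable torus_measure f \<and> (AE x in torus_measure. f x = f x)"
    by (rule exI[of _ "\<lambda>_. 0"]) simp
  show "symp (\<lambda>f g :: 'n torus \<Rightarrow> complex. square_integrable torus_measure f \<and>
      square_integrable torus_measure g \<and> (AE x in torus_measure. f x = g x))"
    by (auto simp: symp_def elim: AE_mp)
  show "transp (\<lambda>f g :: 'n torus \<Rightarrow> complex. square_integrable torus_measure f \<and>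
      square_integrable torus_measure g \<and> (AE x in torus_measure. f x = g x))"
    by (auto simp: transp_def)
qed

instantiation l2_torus :: (finite) real_inner
begin

lift_definition zero_l2_torus :: "'a l2_torus" is "\<lambda>_. 0" by simp

lift_definition plus_l2_torus :: "'a l2_torus \<Rightarrow> 'a l2_torus \<Rightarrow> 'a l2_torus"
  is "\<lambda>f g x. f x + g x" by (auto intro: square_integrable_add)

lift_definition minus_l2_torus :: "'a l2_torus \<Rightarrow> 'a l2_torus \<Rightarrow> 'a l2_torus"
  is "\<lambda>f g x. f x - g x" by (auto intro: square_integrable_diff)

lift_definition uminus_l2_torus :: "'a l2_torus \<Rightarrow> 'a l2_torus"
  is "\<lambda>f x. - f x" by (auto intro: square_integrable_uminus)

lift_definition scaleR_l2_torus :: "real \<Rightarrow> 'a l2_torus \<Rightarrow> 'a l2_torus"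
  is "\<lambda>r f x. of_real r * f x" by (auto intro: square_integrable_cmult)

(* The real inner product Re <f, g>; it induces the usual norm. *)
lift_definition inner_l2_torus :: "'a l2_torus \<Rightarrow> 'a l2_torus \<Rightarrow> real"
  is "\<lambda>f g. \<integral>x. f x \<bullet> g x \<partial>torus_measure"
proof -
  fix f g h k :: "'a torus \<Rightarrow> complex"
  assume 1: "square_integrable torus_measure f \<and> square_integrable torus_measure g \<and>
      (AE x in torus_measure. f x = g x)"
    and 2: "square_integrable torus_measure h \<and> square_integrable torus_measure k \<and>
      (AE x in torus_measure. h x = k x)"
  have "(AE x in torus_measure. f x \<bullet> h x = g x \<bullet> k x)" using 1 2 by auto
  moreover have "(\<lambda>x. f x \<bullet> h x) \<in> borel_measurable torus_measure"
      "(\<lambda>x. g x \<bullet> k x) \<in> borel_measurable torus_measure"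
    using 1 2 by (auto intro!: borel_measurable_integrable integrable_inner_square)
  ultimately show "(\<integral>x. f x \<bullet> h x \<partial>torus_measure) = (\<integral>x. g x \<bullet> k x \<partial>torus_measure)"
    by (intro integral_cong_AE)
qed

lift_definition norm_l2_torus :: "'a l2_torus \<Rightarrow> real"
  is "\<lambda>f. sqrt (\<integral>x. (cmod (f x))\<^sup>2 \<partial>torus_measure)"
proof -
  fix f g :: "'a torus \<Rightarrow> complex"
  assume 1: "square_integrable torus_measure f \<and> square_integrable torus_measure g \<and>
      (AE x in torus_measure. f x = g x)"
  have "(\<integral>x. (cmod (f x))\<^sup>2 \<partial>torus_measure) = (\<integral>x. (cmod (g x))\<^sup>2 \<partial>torus_measure)"
    using 1 by (intro integral_cong_AE) (auto simp: square_integrable_def)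
  then show "sqrt (\<integral>x. (cmod (f x))\<^sup>2 \<partial>torus_measure) = sqrt (\<integral>x. (cmod (g x))\<^sup>2 \<partial>torus_measure)"
    by simp
qed

definition sgn_l2_torus :: "'a l2_torus \<Rightarrow> 'a l2_torus" where
  "sgn_l2_torus x = inverse (norm x) *\<^sub>R x"

definition dist_l2_torus :: "'a l2_torus \<Rightarrow> 'a l2_torus \<Rightarrow> real" where
  "dist_l2_torus x y = norm (x - y)"

definition uniformity_l2_torus :: "('a l2_torus \<times> 'a l2_torus) filter" where
  "uniformity_l2_torus = (INF e\<in>{0<..}. principal {(x, y). dist x y < e})"

definition open_l2_torus :: "'a l2_torus set \<Rightarrow> bool" where
  "open_l2_torus U \<longleftrightarrow> (\<forall>x\<in>U. eventually (\<lambda>(x', y). x' = x \<longrightarrow> y \<in> U) uniformity)"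

instance
proof
  fix x y z :: "'a l2_torus" and r s :: real and U :: "'a l2_torus set"
  show "x + y + z = x + (y + z)"
    by transfer (auto simp: add.assoc intro: square_integrable_add)
  show "x + y = y + x" by transfer (auto simp: add.commute intro: square_integrable_add)
  show "0 + x = x" by transfer simp
  show "- x + x = 0" by transfer simp
  show "x - y = x + - y" by transfer (auto intro: square_integrable_diff)
  show "r *\<^sub>R (x + y) = r *\<^sub>R x + r *\<^sub>R y"
    by transfer (auto simp: distrib_left intro!: square_integrable_add square_integrable_cmult)
  show "(r + s) *\<^sub>R x = r *\<^sub>R x + s *\<^sub>R x"
    by transfer (auto simp: distrib_right intro!: square_integrable_add square_integrable_cmult)
  show "r *\<^sub>R s *\<^sub>R x = (r * s) *\<^sub>R x"
    by transfer (auto simp: mult.assoc intro!: square_integrable_cmult)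
  show "1 *\<^sub>R x = x" by transfer simp
  show "sgn x = inverse (norm x) *\<^sub>R x" by (rule sgn_l2_torus_def)
  show "dist x y = norm (x - y)" by (rule dist_l2_torus_def)
  show "uniformity = (INF e\<in>{0<..}. principal {(x, y). dist (x :: 'a l2_torus) y < e})"
    by (rule uniformity_l2_torus_def)
  show "open U \<longleftrightarrow> (\<forall>x\<in>U. eventually (\<lambda>(x', y). x' = x \<longrightarrow> y \<in> U) uniformity)"
    by (rule open_l2_torus_def)
  show "x \<bullet> y = y \<bullet> x" by transfer (simp add: inner_commute)
  show "(x + y) \<bullet> z = x \<bullet> z + y \<bullet> z"
    by transfer (simp add: inner_add_left integrable_inner_square)
  show "(r *\<^sub>R x) \<bullet> y = r * (x \<bullet> y)"
    by transfer (simp add: scaleR_conv_of_real[symmetric])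
  show "0 \<le> x \<bullet> x" by transfer simp
  show "x \<bullet> x = 0 \<longleftrightarrow> x = 0"
  proof (transfer, goal_cases)
    case (1 f)
    have "(\<integral>x. f x \<bullet> f x \<partial>torus_measure) = 0 \<longleftrightarrow> (AE x in torus_measure. f x \<bullet> f x = 0)"
      using 1 by (intro integral_nonneg_eq_0_iff_AE) (auto intro: integrable_inner_square)
    with 1 show ?case by simp
  qed
  show "norm x = sqrt (x \<bullet> x)" by transfer (simp add: power2_norm_eq_inner)
qed

end

instantiation l2_torus :: (finite) complex_banach
begin

lift_definition scaleC_l2_torus :: "complex \<Rightarrow> 'a l2_torus \<Rightarrow> 'a l2_torus"
  is "\<lambda>c f x. c * f x" by (auto intro: square_integrable_cmult)

instance
proof
  fix X :: "nat \<Rightarrow> 'a l2_torus"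
  assume X: "Cauchy X"
  define f where "f n = rep_l2_torus (X n)" for n
  have f: "square_integrable torus_measure (f n)" for n
    using Quotient_rep_reflp[OF Quotient_l2_torus, of "X n"] by (simp add: f_def)
  have Xf: "X n = abs_l2_torus (f n)" for n
    by (simp add: f_def Quotient_abs_rep[OF Quotient_l2_torus])
  have diff: "(norm (X n - abs_l2_torus g))\<^sup>2 = (\<integral>x. (cmod (f n x - g x))\<^sup>2 \<partial>torus_measure)"
    if g: "square_integrable torus_measure g" for n g
    unfolding Xf using f[of n] g square_integrable_diff[OF f[of n] g]
    by (subst minus_l2_torus.abs_eq) (simp_all add: eq_onp_def norm_l2_torus.abs_eq)
  have "\<exists>g. square_integrable torus_measure g \<and>
      (\<lambda>n. \<integral>x. (cmod (f n x - g x))\<^sup>2 \<partial>torus_measure) \<longlonglongrightarrow> 0"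
  proof (rule square_integrable_complete[OF f])
    fix e :: real assume "e > 0"
    then have "sqrt e > 0" by simp
    then obtain N where N: "\<And>m n. m \<ge> N \<Longrightarrow> n \<ge> N \<Longrightarrow> norm (X m - X n) < sqrt e"
      using X unfolding Cauchy_def dist_norm by blast
    have "(norm (X m - X n))\<^sup>2 < e" if "m \<ge> N" "n \<ge> N" for m n
      using power_strict_mono[OF N[OF that], of 2] \<open>e > 0\<close> by simp
    then show "\<exists>N. \<forall>m\<ge>N. \<forall>n\<ge>N. (\<integral>x. (cmod (f m x - f n x))\<^sup>2 \<partial>torus_measure) < e"
      using diff[OF f] Xf by metis
  qed
  then obtain g where g: "square_integrable torus_measure g"
    and lim: "(\<lambda>n. \<integral>x. (cmod (f n x - g x))\<^sup>2 \<partial>torus_measure) \<longlonglongrightarrow> 0"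
    by blast
  have "(\<lambda>n. (norm (X n - abs_l2_torus g))\<^sup>2) \<longlonglongrightarrow> 0"
    using lim by (simp add: diff[OF g])
  then have "(\<lambda>n. norm (X n - abs_l2_torus g)) \<longlonglongrightarrow> 0"
    using tendsto_real_sqrt by fastforce
  then have "X \<longlonglongrightarrow> abs_l2_torus g" by (simp add: LIM_zero_iff tendsto_norm_zero_iff)
  then show "convergent X" by (rule convergentI)
next
  fix b c :: complex and r :: real and x y :: "'a l2_torus"
  show "c *\<^sub>C (x + y) = c *\<^sub>C x + c *\<^sub>C y"
    by transfer (auto simp: distrib_left intro!: square_integrable_add square_integrable_cmult)
  show "(b + c) *\<^sub>C x = b *\<^sub>C x + c *\<^sub>C x"
    by transfer (auto simp: distrib_right intro!: square_integrable_add square_integrable_cmult)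
  show "b *\<^sub>C (c *\<^sub>C x) = (b * c) *\<^sub>C x"
    by transfer (auto simp: mult.assoc intro!: square_integrable_cmult)
  show "complex_of_real r *\<^sub>C x = r *\<^sub>R x"
    by transfer (auto intro!: square_integrable_cmult)
  show "norm (c *\<^sub>C x) = cmod c * norm x"
    by transfer (simp add: norm_mult power_mult_distrib real_sqrt_mult)
qed

end


section \<open>The Fourier transform and the transported algebra\<close>

definition lattice_dot :: "real^'n \<Rightarrow> int^'n \<Rightarrow> real" where
  "lattice_dot x k = (\<Sum>j\<in>UNIV. x $ j * of_int (k $ j))"

lemma exp_lattice_dot_cong:
  fixes k :: "int^'n" and x y :: "real^'n"
  assumes "\<forall>i. x $ i - y $ i \<in> \<int>"
  shows "exp (- 2 * complex_of_real pi * \<i> * complex_of_real (lattice_dot x k)) =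
    exp (- 2 * complex_of_real pi * \<i> * complex_of_real (lattice_dot y k))"
proof -
  have "lattice_dot x k - lattice_dot y k = (\<Sum>j\<in>UNIV. (x $ j - y $ j) * of_int (k $ j))"
    by (simp add: lattice_dot_def sum_subtractf left_diff_distrib)
  moreover have "(\<Sum>j\<in>UNIV. (x $ j - y $ j) * of_int (k $ j)) \<in> \<int>"
    using assms by (intro Ints_sum Ints_mult) auto
  ultimately obtain m where "lattice_dot x k - lattice_dot y k = of_int m"
    by (metis Ints_cases)
  then have m: "lattice_dot x k = lattice_dot y k + of_int m" by simp
  show ?thesis
    unfolding exp_eq by (rule exI[of _ "- m"]) (simp add: m algebra_simps)
qed

lift_definition fourier_kernel :: "int^'n \<Rightarrow> 'n torus \<Rightarrow> complex"
  is "\<lambda>k x. exp (- 2 * complex_of_real pi * \<i> * complex_of_real (lattice_dot x k))"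
  by (intro exp_lattice_dot_cong allI)

lemma fourier_kernel_measurable [measurable]: "fourier_kernel k \<in> borel_measurable torus_measure"
proof -
  have "fourier_kernel k \<in> borel_measurable borel"
  proof (rule borel_measurableI)
    fix S :: "complex set" assume S: "open S"
    have "abs_torus -` (fourier_kernel k -` S) =
        (\<lambda>x. exp (- 2 * complex_of_real pi * \<i> * complex_of_real (lattice_dot x k))) -` S"
      by (auto simp: fourier_kernel.abs_eq)
    also have "open \<dots>"
      unfolding lattice_dot_def by (rule open_vimage[OF S]) (intro continuous_intros)
    finally have "open (fourier_kernel k -` S)" by (simp add: open_torus_def)
    then show "fourier_kernel k -` S \<inter> space borel \<in> sets borel" by simp
  qed
  then show ?thesis by simp
qed

lift_definition fourier_coeff :: "('n::finite) l2_torus \<Rightarrow> int^'n \<Rightarrow> complex"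
  is "\<lambda>f k. \<integral>x. fourier_kernel k x * f x \<partial>torus_measure"
proof -
  fix f g :: "'n torus \<Rightarrow> complex"
  assume 1: "square_integrable torus_measure f \<and> square_integrable torus_measure g \<and>
      (AE x in torus_measure. f x = g x)"
  then have [measurable]: "f \<in> borel_measurable torus_measure" "g \<in> borel_measurable torus_measure"
    by (auto simp: square_integrable_def)
  have "(\<integral>x. fourier_kernel k x * f x \<partial>torus_measure) =
      (\<integral>x. fourier_kernel k x * g x \<partial>torus_measure)" for k
    using 1 by (intro integral_cong_AE) auto
  then show "(\<lambda>k. \<integral>x. fourier_kernel k x * f x \<partial>torus_measure) =
      (\<lambda>k. \<integral>x. fourier_kernel k x * g x \<partial>torus_measure)" by blast
qed

(* The coefficient family is square-summable by Bessel's inequality, so Abs_ell2 applies. *)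
definition fourier :: "('n::finite) l2_torus \<Rightarrow> (int^'n) ell2" where
  "fourier f = Abs_ell2 (fourier_coeff f)"

(* The Fourier transform is a unitary bijection (Plancherel), so the inverse is a genuine one. *)
definition Gamma_op ::
    "((int^'n) ell2 \<Rightarrow> (int^'n) ell2) \<Rightarrow> ('n::finite) l2_torus \<Rightarrow> 'n l2_torus" where
  "Gamma_op A = inv_into UNIV fourier \<circ> A \<circ> fourier"

definition Gamma_algebra :: "(('n::finite) l2_torus \<Rightarrow> 'n l2_torus) set" where
  "Gamma_algebra = Gamma_op ` poincare_algebra"

(* Norm of Gamma_op A := poincare_norm A; Gamma_op is injective because fourier is bijective. *)
definition Gamma_norm :: "(('n::finite) l2_torus \<Rightarrow> 'n l2_torus) \<Rightarrow> real" where
  "Gamma_norm T = poincare_norm (the_inv_into poincare_algebra Gamma_op T)"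

end

theory Submission
  imports Defs
begin

text \<open>
  The Fourier transform $U$ is a unitary bijection, and everything in the assertion is invariant under
  $A \mapsto U^{-1} A U$, so only the Poincare algebra itself needs an argument.  There, put
  $g(A) = \lim_m \det(I + A_m)$ along finite sections $A_m$.  Expanding determinants over permutations gives
  $|\det(I + A) - \det(I + B)| \le \|A - B\| \exp(\|B\| + \|A - B\|)$ in the entrywise $1$-norm, uniformly
  in the size; so the limit exists and is continuous.  If $F = \sum_l u_l \otimes \varphi_l$ has finite rank,
  the identity $\det(I + XY) = \det(I + YX)$ turns both $\det(I + F_m)$ and the determinant of $I + F$ on a
  splitting into determinants of the fixed size of the matrix $(\varphi_k(u_l))$, and the former
  converge to the latter.
\<close>

section \<open>Determinants of the form $\det(I + A)$\<close>

text \<open>The 1-norm enters through rows: the moduli in row \<open>i\<close> of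
  \<open>I + B\<close> sum to at most one plus the row sum of \<open>B\<close>, hence to at most its
  exponential, and the product over all rows is controlled by the total sum, whatever the size. The
  obstacle is agreement with \<open>det_one_plus\<close>. A finite rank operator may have infinitely
  many nonzero entries, so its sections need not become stationary, and their limit has to meet a
  value defined by descriptions over splittings and bases. The choice of functionals decides whether
  the small determinants converge: they are taken to be coordinates of \<open>F x\<close>, hence
  rows of the matrix of \<open>F\<close>, so that the partial sums along a section are partial sums
  of a convergent expansion. On the torus, isometry is read off from bijectivity: Riesz-Fischer
  gives each sequence a preimage of equal norm, and completeness of the characters makes that
  preimage the only one.\<close>

lemma det_one_plus_mult_commute:
  fixes A B :: "'a::idom mat"
  assumes A: "A \<in> carrier_mat n m" and B: "B \<in> carrier_mat m n"
  shows "Determinant.det (1\<^sub>m n + A * B) = Determinant.det (1\<^sub>m m + B * A)"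
proof -
  have nA: "- A \<in> carrier_mat n m" using A by simp
  have AB: "A * B \<in> carrier_mat n n" and BA: "B * A \<in> carrier_mat m m" using A B by auto
  \<comment> \<open>The block matrix with rows \<open>(1, -A)\<close> and \<open>(B, 1)\<close>
    factors both as \<open>?L * ?D1\<close> and as \<open>?D2 * ?L\<close>, with \<open>?L\<close>
    of determinant 1. Comparing determinants gives the identity.\<close>
  let ?L = "four_block_mat (1\<^sub>m n) (0\<^sub>m n m) B (1\<^sub>m m)"
  let ?D1 = "four_block_mat (1\<^sub>m n) (- A) (0\<^sub>m m n) (1\<^sub>m m + B * A)"
  let ?D2 = "four_block_mat (1\<^sub>m n + A * B) (- A) (0\<^sub>m m n) (1\<^sub>m m)"
  have L: "?L \<in> carrier_mat (n + m) (n + m)" and D1: "?D1 \<in> carrier_mat (n + m) (n + m)"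
    and D2: "?D2 \<in> carrier_mat (n + m) (n + m)"
    using A B AB BA by auto
  have "B * - A + (1\<^sub>m m + B * A) = 1\<^sub>m m"
    using A B BA by (intro eq_matI) auto
  then have 1: "?L * ?D1 = four_block_mat (1\<^sub>m n) (- A) B (1\<^sub>m m)"
    using A B AB BA nA by (subst mult_four_block_mat) auto
  have "1\<^sub>m n + A * B + - A * B = 1\<^sub>m n"
    using A B AB by (intro eq_matI) auto
  then have 2: "?D2 * ?L = four_block_mat (1\<^sub>m n) (- A) B (1\<^sub>m m)"
    using A B AB BA nA by (subst mult_four_block_mat) auto
  have detL: "Determinant.det ?L = 1"
    using B by (subst det_four_block_mat_upper_right_zero) auto
  have "Determinant.det ?D1 = Determinant.det (1\<^sub>m m + B * A)"
    using B BA nA by (subst det_four_block_mat_lower_left_zero) auto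
  moreover have "Determinant.det ?D2 = Determinant.det (1\<^sub>m n + A * B)"
    using B AB nA by (subst det_four_block_mat_lower_left_zero) auto
  ultimately show ?thesis
    using det_mult[OF L D1] det_mult[OF D2 L] 1 2 detL by simp
qed

text \<open>Taking an array on all of \<open>nat\<close> lets sections of different sizes share one
  argument, and limits be taken entrywise without carrier conditions.\<close>

definition id_plus_det :: "nat \<Rightarrow> (nat \<Rightarrow> nat \<Rightarrow> complex) \<Rightarrow> complex" where
  "id_plus_det n a = Determinant.det (Matrix.mat n n (\<lambda>(i, j). of_bool (i = j) + a i j))"

lemma id_plus_det_cong:
  "(\<And>i j. i < n \<Longrightarrow> j < n \<Longrightarrow> a i j = b i j) \<Longrightarrow> id_plus_det n a = id_plus_det n b"
  unfolding id_plus_det_def by (rule arg_cong[where f = Determinant.det]) auto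

lemma id_plus_det_expand:
  "id_plus_det n a =
    (\<Sum>p | p permutes {..<n}. signof p * (\<Prod>i<n. of_bool (i = p i) + a i (p i)))"
proof -
  have "(\<Prod>i = 0..<n. Matrix.mat n n (\<lambda>(i, j). of_bool (i = j) + a i j) $$ (i, p i)) =
      (\<Prod>i<n. of_bool (i = p i) + a i (p i))" if "p permutes {..<n}" for p
    unfolding atLeast0LessThan
  proof (rule prod.cong)
    fix i assume "i \<in> {..<n}"
    moreover from this that have "p i < n" using permutes_in_image[OF that, of i] by simp
    ultimately show "Matrix.mat n n (\<lambda>(i, j). of_bool (i = j) + a i j) $$ (i, p i) =
        of_bool (i = p i) + a i (p i)" by simp
  qed simp
  then show ?thesis
    unfolding id_plus_det_def Determinant.det_def
    by (auto simp: atLeast0LessThan intro!: sum.cong)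
qed

text \<open>With \<open>n\<close> the size of a section and \<open>m\<close> the number of rank-one
  terms, the right-hand determinant keeps its size while \<open>n\<close> grows.\<close>

lemma id_plus_det_swap:
  "id_plus_det n (\<lambda>i j. \<Sum>l<m. x i l * y l j) = id_plus_det m (\<lambda>k l. \<Sum>i<n. y k i * x i l)"
proof -
  let ?X = "Matrix.mat n m (\<lambda>(i, l). x i l)" and ?Y = "Matrix.mat m n (\<lambda>(l, j). y l j)"
  have "Matrix.mat n n (\<lambda>(i, j). of_bool (i = j) + (\<Sum>l<m. x i l * y l j)) = 1\<^sub>m n + ?X * ?Y"
    by (intro eq_matI) (auto simp: scalar_prod_def atLeast0LessThan)
  moreover have "Matrix.mat m m (\<lambda>(k, l). of_bool (k = l) + (\<Sum>i<n. y k i * x i l)) = 1\<^sub>m m + ?Y * ?X"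
    by (intro eq_matI) (auto simp: scalar_prod_def atLeast0LessThan)
  ultimately show ?thesis
    unfolding id_plus_det_def using det_one_plus_mult_commute[of ?X n m ?Y] by simp
qed

text \<open>A case of \<open>id_plus_det_swap\<close>: the padded array factors through the
  inclusion \<open>x\<close> of the first \<open>m\<close> coordinates. It allows sections of
  different sizes to be compared at one size.\<close>

lemma id_plus_det_extend:
  assumes "m \<le> n"
  shows "id_plus_det m a = id_plus_det n (\<lambda>i j. if i < m \<and> j < m then a i j else 0)"
proof -
  define x where "x i l = (of_bool (i = l) :: complex)" for i l :: nat
  define y where "y l j = (if j < m then a l j else 0)" for l j
  have "id_plus_det n (\<lambda>i j. if i < m \<and> j < m then a i j else 0) =
      id_plus_det n (\<lambda>i j. \<Sum>l<m. x i l * y l j)"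
    by (rule id_plus_det_cong) (auto simp: x_def y_def if_distrib cong: if_cong)
  also have "\<dots> = id_plus_det m (\<lambda>k l. \<Sum>i<n. y k i * x i l)"
    by (rule id_plus_det_swap)
  also have "\<dots> = id_plus_det m a"
  proof (rule id_plus_det_cong)
    fix k l assume "k < m" "l < m"
    then have "(\<Sum>i<n. y k i * x i l) = (\<Sum>i<n. if i = l then a k l else 0)"
      by (intro sum.cong) (auto simp: x_def y_def)
    then show "(\<Sum>i<n. y k i * x i l) = a k l" using \<open>l < m\<close> assms by simp
  qed
  finally show ?thesis by simp
qed

lemma tendsto_id_plus_det:
  assumes "\<And>i j. i < n \<Longrightarrow> j < n \<Longrightarrow> ((\<lambda>k. a k i j) \<longlongrightarrow> b i j) F"
  shows "((\<lambda>k. id_plus_det n (a k)) \<longlongrightarrow> id_plus_det n b) F"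
  unfolding id_plus_det_expand
proof (intro tendsto_sum tendsto_mult tendsto_const tendsto_prod tendsto_add)
  fix p i assume "p \<in> {p. p permutes {..<n}}" "i \<in> {..<n}"
  then show "((\<lambda>k. a k i (p i)) \<longlongrightarrow> b i (p i)) F"
    using permutes_in_image[of p "{..<n}" i] by (intro assms) auto
qed

text \<open>Expand the product of \<open>y i + (x i - y i)\<close>: the difference consists of the
  terms with at least one increment, and their moduli add up to the right-hand side. That bound is
  again a difference of products, so it can later be summed row by row.\<close>

lemma norm_prod_diff_le:
  fixes x y :: "'i \<Rightarrow> complex"
  shows "cmod ((\<Prod>i\<in>S. x i) - (\<Prod>i\<in>S. y i)) \<le>
    (\<Prod>i\<in>S. cmod (y i) + cmod (x i - y i)) - (\<Prod>i\<in>S. cmod (y i))"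
proof (induction S rule: infinite_finite_induct)
  case (insert k S)
  let ?X = "\<Prod>i\<in>S. x i" and ?Y = "\<Prod>i\<in>S. y i"
  let ?P = "\<Prod>i\<in>S. cmod (y i) + cmod (x i - y i)" and ?Q = "\<Prod>i\<in>S. cmod (y i)"
  have "cmod ?X \<le> ?P"
    unfolding prod_norm[symmetric]
    by (intro prod_mono) (auto intro: norm_triangle_sub)
  have "x k * ?X - y k * ?Y = (x k - y k) * ?X + y k * (?X - ?Y)" by (simp add: algebra_simps)
  then have "cmod (x k * ?X - y k * ?Y) \<le> cmod (x k - y k) * cmod ?X + cmod (y k) * cmod (?X - ?Y)"
    by (metis norm_mult norm_triangle_ineq)
  also have "\<dots> \<le> cmod (x k - y k) * ?P + cmod (y k) * (?P - ?Q)"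
    using insert.IH \<open>cmod ?X \<le> ?P\<close> by (intro add_mono mult_left_mono) auto
  finally show ?case using insert.hyps by (simp add: algebra_simps)
qed auto

text \<open>Exchanging factor \<open>i\<close> costs \<open>D i\<close>, and every other factor is
  at most \<open>exp (r i + D i)\<close>. In the application \<open>Y\<close> holds row sums of
  \<open>I + B\<close> in modulus, \<open>r\<close> those of \<open>B\<close> and \<open>D\<close>
  those of the difference.\<close>

lemma prod_add_diff_le_exp:
  fixes Y D r :: "'i \<Rightarrow> real"
  assumes "\<And>i. i \<in> S \<Longrightarrow> 0 \<le> Y i" "\<And>i. i \<in> S \<Longrightarrow> Y i \<le> exp (r i)"
    and "\<And>i. i \<in> S \<Longrightarrow> 0 \<le> D i" "\<And>i. i \<in> S \<Longrightarrow> 0 \<le> r i"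
  shows "(\<Prod>i\<in>S. Y i + D i) - (\<Prod>i\<in>S. Y i) \<le> (\<Sum>i\<in>S. D i) * exp (\<Sum>i\<in>S. r i + D i)"
  using assms
proof (induction S rule: infinite_finite_induct)
  case (insert k S)
  let ?P = "\<Prod>i\<in>S. Y i + D i" and ?Q = "\<Prod>i\<in>S. Y i" and ?E = "exp (\<Sum>i\<in>S. r i + D i)"
  have factor: "Y i + D i \<le> exp (r i + D i)" if "i \<in> insert k S" for i
  proof -
    have "Y i + D i \<le> exp (r i) + exp (r i) * D i"
      using insert.prems(2)[OF that] insert.prems(3)[OF that] insert.prems(4)[OF that]
        mult_right_mono[of 1 "exp (r i)" "D i"] by simp
    also have "\<dots> = exp (r i) * (1 + D i)" by (simp add: algebra_simps)
    also have "\<dots> \<le> exp (r i) * exp (D i)"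
      using exp_ge_add_one_self[of "D i"] by (intro mult_left_mono) auto
    finally show ?thesis by (simp add: exp_add)
  qed
  have "?P \<le> (\<Prod>i\<in>S. exp (r i + D i))"
    using insert.prems factor by (intro prod_mono) auto
  then have P: "?P \<le> ?E" using insert.hyps by (simp add: exp_sum)
  have DE: "0 \<le> (\<Sum>i\<in>S. D i) * ?E" using insert.prems by (auto intro!: mult_nonneg_nonneg sum_nonneg)
  have k: "0 \<le> Y k" "Y k \<le> exp (r k + D k)" "0 \<le> D k" "1 \<le> exp (r k + D k)"
    using insert.prems[of k] factor[of k] by auto
  have IH: "?P - ?Q \<le> (\<Sum>i\<in>S. D i) * ?E"
    using insert.prems by (intro insert.IH) auto
  have "(Y k + D k) * ?P - Y k * ?Q = Y k * (?P - ?Q) + D k * ?P" by (simp add: algebra_simps)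
  also have "\<dots> \<le> Y k * ((\<Sum>i\<in>S. D i) * ?E) + D k * ?E"
    using k IH P by (intro add_mono mult_left_mono) auto
  also have "\<dots> \<le> exp (r k + D k) * ((\<Sum>i\<in>S. D i) * ?E) + D k * (exp (r k + D k) * ?E)"
    using k DE by (intro add_mono mult_right_mono mult_left_mono) auto
  also have "\<dots> = (\<Sum>i\<in>insert k S. D i) * exp (\<Sum>i\<in>insert k S. r i + D i)"
    using insert.hyps by (simp add: exp_add algebra_simps)
  finally show ?case using insert.hyps by simp
qed auto

text \<open>The permutations in the expansion may be enlarged to all self-maps of the index set, because the
  bound on each difference of products is nonnegative; the sum then factorizes over the rows.\<close>

lemma id_plus_det_diff_le:
  fixes n a b
  defines "s \<equiv> (\<Sum>i<n. \<Sum>j<n. cmod (a i j - b i j))" and "t \<equiv> (\<Sum>i<n. \<Sum>j<n. cmod (b i j))"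
  shows "cmod (id_plus_det n a - id_plus_det n b) \<le> s * exp (t + s)"
proof -
  let ?d = "\<lambda>i j. of_bool (i = j) :: complex"
  define y where "y i j = cmod (?d i j + b i j)" for i j
  define z where "z i j = cmod (a i j - b i j)" for i j
  have fin: "finite (PiE {..<n} (\<lambda>_. {..<n}))" by (intro finite_PiE) auto
  have "cmod (id_plus_det n a - id_plus_det n b) =
      cmod (\<Sum>p | p permutes {..<n}. signof p *
        ((\<Prod>i<n. ?d i (p i) + a i (p i)) - (\<Prod>i<n. ?d i (p i) + b i (p i))))"
    unfolding id_plus_det_expand by (simp add: sum_subtractf right_diff_distrib)
  also have "\<dots> \<le> (\<Sum>p | p permutes {..<n}.
      cmod ((\<Prod>i<n. ?d i (p i) + a i (p i)) - (\<Prod>i<n. ?d i (p i) + b i (p i))))"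
    by (rule sum_norm_le) (simp add: norm_mult sign_def)
  also have "\<dots> \<le> (\<Sum>p | p permutes {..<n}. (\<Prod>i<n. y i (p i) + z i (p i)) - (\<Prod>i<n. y i (p i)))"
  proof (rule sum_mono)
    fix p
    show "cmod ((\<Prod>i<n. ?d i (p i) + a i (p i)) - (\<Prod>i<n. ?d i (p i) + b i (p i))) \<le>
        (\<Prod>i<n. y i (p i) + z i (p i)) - (\<Prod>i<n. y i (p i))"
      using norm_prod_diff_le[of "\<lambda>i. ?d i (p i) + a i (p i)" "{..<n}" "\<lambda>i. ?d i (p i) + b i (p i)"]
      by (simp add: y_def z_def)
  qed
  \<comment> \<open>Permutations are the identity outside the index range, members of
    \<open>PiE\<close> are \<open>undefined\<close> there; \<open>restrict\<close> translates,
    injectively.\<close>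
  also have "\<dots> = (\<Sum>f\<in>(\<lambda>p. restrict p {..<n}) ` {p. p permutes {..<n}}.
      (\<Prod>i<n. y i (f i) + z i (f i)) - (\<Prod>i<n. y i (f i)))"
  proof (subst sum.reindex)
    show "inj_on (\<lambda>p. restrict p {..<n}) {p. p permutes {..<n}}"
    proof (rule inj_onI, rule ext)
      fix p q :: "nat \<Rightarrow> nat" and i
      assume "p \<in> {p. p permutes {..<n}}" "q \<in> {p. p permutes {..<n}}"
        "restrict p {..<n} = restrict q {..<n}"
      then show "p i = q i"
        by (cases "i < n") (auto simp: permutes_def dest: fun_cong[of _ _ i])
    qed
  qed simp
  also have "\<dots> \<le> (\<Sum>f\<in>PiE {..<n} (\<lambda>_. {..<n}).
      (\<Prod>i<n. y i (f i) + z i (f i)) - (\<Prod>i<n. y i (f i)))"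
  proof (rule sum_mono2[OF fin])
    show "(\<lambda>p. restrict p {..<n}) ` {p. p permutes {..<n}} \<subseteq> PiE {..<n} (\<lambda>_. {..<n})"
    proof clarify
      fix p assume p: "p permutes {..<n}"
      show "restrict p {..<n} \<in> PiE {..<n} (\<lambda>_. {..<n})"
        unfolding restrict_PiE_iff using permutes_in_image[OF p] by simp
    qed
    show "0 \<le> (\<Prod>i<n. y i (f i) + z i (f i)) - (\<Prod>i<n. y i (f i))" for f
      by (simp, intro prod_mono) (auto simp: y_def z_def)
  qed
  also have "\<dots> = (\<Prod>i<n. \<Sum>j<n. y i j + z i j) - (\<Prod>i<n. \<Sum>j<n. y i j)"
    by (simp only: sum_subtractf prod_sum_PiE[OF finite_lessThan finite_lessThan])
  also have "\<dots> = (\<Prod>i<n. (\<Sum>j<n. y i j) + (\<Sum>j<n. z i j)) - (\<Prod>i<n. \<Sum>j<n. y i j)"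
    by (simp add: sum.distrib)
  also have "\<dots> \<le> (\<Sum>i<n. \<Sum>j<n. z i j) * exp (\<Sum>i<n. (\<Sum>j<n. cmod (b i j)) + (\<Sum>j<n. z i j))"
  proof (rule prod_add_diff_le_exp)
    fix i assume i: "i \<in> {..<n}"
    \<comment> \<open>Each row meets the identity matrix in a single 1, so the row sum is at most 1
      plus that of \<open>b\<close>. This keeps \<open>n\<close> out of the final bound.\<close>
    have "(\<Sum>j<n. y i j) \<le> (\<Sum>j<n. of_bool (i = j) + cmod (b i j))"
      unfolding y_def by (intro sum_mono order_trans[OF norm_triangle_ineq]) auto
    also have "\<dots> = 1 + (\<Sum>j<n. cmod (b i j))" using i by (simp add: sum.distrib)
    also have "\<dots> \<le> exp (\<Sum>j<n. cmod (b i j))" by (rule exp_ge_add_one_self)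
    finally show "(\<Sum>j<n. y i j) \<le> exp (\<Sum>j<n. cmod (b i j))" .
  qed (auto simp: y_def z_def intro: sum_nonneg)
  finally show ?thesis by (simp add: s_def t_def z_def sum.distrib)
qed

section \<open>Finite rank operators\<close>

interpretation complex_pair: vector_space_pair
  "scaleC :: complex \<Rightarrow> 'a \<Rightarrow> 'a::complex_banach" "scaleC :: complex \<Rightarrow> 'b \<Rightarrow> 'b::complex_banach" ..

interpretation complex_functional: vector_space_pair
  "scaleC :: complex \<Rightarrow> 'a \<Rightarrow> 'a::complex_banach" "(*) :: complex \<Rightarrow> complex \<Rightarrow> complex" ..

lemma bounded_clinear_linear:
  "bounded_clinear F \<Longrightarrow> Vector_Spaces.linear (*\<^sub>C) (*\<^sub>C) F"
  by (simp add: Vector_Spaces.linear_iff complex_vector.vector_space_axioms bounded_clinear_def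
      linear_add bounded_linear.linear)

section \<open>Determinants of finite rank perturbations computed in a basis\<close>

lemma sum_nth_distinct: "distinct xs \<Longrightarrow> (\<Sum>i<length xs. f (xs ! i)) = (\<Sum>x\<in>set xs. f x)"
  by (rule sum.reindex_bij_betw[OF bij_betw_nth]) auto

lemma sum_scaleC_representation:
  assumes "is_basis_of bs M" "x \<in> M"
  shows "(\<Sum>i<length bs. complex_vector.representation (set bs) x (bs ! i) *\<^sub>C bs ! i) = x"
  using assms sum_nth_distinct[of bs "\<lambda>b. complex_vector.representation (set bs) x b *\<^sub>C b"]
  by (simp add: is_basis_of_def complex_vector.sum_representation_eq)

text \<open>The matrix of \<open>F\<close> is the product of the coordinates of the
  \<open>u l\<close> with the values \<open>\<phi> l (bs ! j)\<close>. In the opposite order the sum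
  over the basis reassembles \<open>u l\<close>, and the basis disappears from the result.\<close>

lemma det_matrix_in_basis_id_plus:
  fixes u :: "nat \<Rightarrow> 'a::complex_banach"
  assumes bs: "is_basis_of bs M"
    and \<phi>: "\<And>l. l < r \<Longrightarrow> Vector_Spaces.linear (*\<^sub>C) (*) (\<phi> l)"
    and u: "\<And>l. l < r \<Longrightarrow> u l \<in> M"
    and F: "\<And>x. F x = (\<Sum>l<r. \<phi> l x *\<^sub>C u l)"
  shows "Determinant.det (matrix_in_basis bs (\<lambda>x. x + F x)) = id_plus_det r (\<lambda>k l. \<phi> k (u l))"
proof -
  let ?rep = "complex_vector.representation (set bs)"
  define m where "m = length bs"
  have d: "distinct bs" and ind: "complex_vector.independent (set bs)"
    and M: "complex_vector.span (set bs) = M"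
    using bs by (auto simp: is_basis_of_def)
  have sub: "complex_vector.subspace M" by (simp flip: M)
  have FM: "F x \<in> M" for x
    unfolding F using u sub by (intro complex_vector.subspace_sum complex_vector.subspace_scale) auto
  have entry: "?rep (bs ! j + F (bs ! j)) (bs ! i) =
      of_bool (i = j) + (\<Sum>l<r. ?rep (u l) (bs ! i) * \<phi> l (bs ! j))" if "i < m" "j < m" for i j
  proof -
    have bj: "bs ! j \<in> set bs" using that by (simp add: m_def)
    have "?rep (F (bs ! j)) (bs ! i) = (\<Sum>l<r. \<phi> l (bs ! j) * ?rep (u l) (bs ! i))"
      unfolding F using u sub M ind
      by (subst complex_vector.representation_sum)
        (auto simp: complex_vector.representation_scale complex_vector.span_scale)
    moreover have "?rep (bs ! j) (bs ! i) = of_bool (i = j)"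
      using that d by (simp add: complex_vector.representation_basis[OF ind bj] m_def nth_eq_iff_index_eq)
    moreover have "bs ! j \<in> M" using bj complex_vector.span_base M by blast
    ultimately show ?thesis
      using M FM ind by (simp add: complex_vector.representation_add mult.commute)
  qed
  have "Determinant.det (matrix_in_basis bs (\<lambda>x. x + F x)) =
      id_plus_det m (\<lambda>i j. \<Sum>l<r. ?rep (u l) (bs ! i) * \<phi> l (bs ! j))"
    unfolding id_plus_det_def matrix_in_basis_def m_def[symmetric]
    by (rule arg_cong[where f = Determinant.det], rule eq_matI) (auto simp: entry)
  also have "\<dots> = id_plus_det r (\<lambda>k l. \<Sum>i<m. \<phi> k (bs ! i) * ?rep (u l) (bs ! i))"
    by (rule id_plus_det_swap)
  also have "\<dots> = id_plus_det r (\<lambda>k l. \<phi> k (u l))"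
  proof (rule id_plus_det_cong)
    fix k l assume k: "k < r" and l: "l < r"
    have "\<phi> k (u l) = \<phi> k (\<Sum>i<m. ?rep (u l) (bs ! i) *\<^sub>C bs ! i)"
      using sum_scaleC_representation[OF bs u[OF l]] by (simp add: m_def)
    also have "\<dots> = (\<Sum>i<m. \<phi> k (bs ! i) * ?rep (u l) (bs ! i))"
      by (simp add: complex_functional.linear_sum[OF \<phi>[OF k]]
          complex_functional.linear_scale[OF \<phi>[OF k]] mult.commute)
    finally show "(\<Sum>i<m. \<phi> k (bs ! i) * ?rep (u l) (bs ! i)) = \<phi> k (u l)" by simp
  qed
  finally show ?thesis .
qed

lemma finite_span_has_basis:
  assumes "finite S"
  shows "\<exists>bs. is_basis_of bs (complex_vector.span S)"
proof -
  obtain B where B: "B \<subseteq> S" "complex_vector.independent B" "S \<subseteq> complex_vector.span B"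
    using complex_vector.maximal_independent_subset[of S] by blast
  have "complex_vector.span B = complex_vector.span S"
    using B complex_vector.span_mono[OF B(1)] complex_vector.span_minimal[OF B(3)] by auto
  moreover obtain bs where "distinct bs" "set bs = B"
    using finite_distinct_list[of B] finite_subset[OF B(1) assms] by blast
  ultimately show ?thesis using B by (auto simp: is_basis_of_def)
qed

lemma subspace_finitely_spanned_has_basis:
  assumes "complex_vector.subspace V" "V \<subseteq> complex_vector.span S" "finite S"
  shows "\<exists>bs. is_basis_of bs V"
proof -
  obtain B where B: "B \<subseteq> V" "complex_vector.independent B" "V \<subseteq> complex_vector.span B"
    using complex_vector.maximal_independent_subset[of V] by blast
  have "finite B" using complex_vector.independent_span_bound[OF assms(3) B(2)] B(1) assms(2) by auto
  then obtain bs where "distinct bs" "set bs = B" using finite_distinct_list by blast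
  moreover have "complex_vector.span B = V"
    using B complex_vector.span_minimal[OF B(1) assms(1)] by auto
  ultimately show ?thesis using B by (auto simp: is_basis_of_def)
qed

text \<open>By independence, the representation of a common vector is supported both in
  \<open>A\<close> and in \<open>B - A\<close>.\<close>

lemma span_Int_span_Diff:
  assumes "complex_vector.independent B" "A \<subseteq> B"
  shows "complex_vector.span A \<inter> complex_vector.span (B - A) = {0}"
proof -
  have "v = 0" if v: "v \<in> complex_vector.span A" "v \<in> complex_vector.span (B - A)" for v
  proof -
    have 1: "complex_vector.representation B v = complex_vector.representation A v"
      using assms v by (intro complex_vector.representation_extend) auto
    have 2: "complex_vector.representation B v = complex_vector.representation (B - A) v"
      using assms v by (intro complex_vector.representation_extend) auto
    have "complex_vector.representation B v b = 0" for b
      using complex_vector.representation_ne_zero[of A v b]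
        complex_vector.representation_ne_zero[of "B - A" v b] 1 2 by auto
    moreover have "v \<in> complex_vector.span B" using v(1) complex_vector.span_mono[OF assms(2)] by auto
    ultimately show ?thesis
      using complex_vector.sum_nonzero_representation_eq[OF assms(1), of v] by simp
  qed
  then show ?thesis using complex_vector.span_zero by auto
qed

lemma finite_rank_range_basis:
  assumes "finite_rank F"
  shows "\<exists>bs. is_basis_of bs (range F)"
proof -
  obtain S where "finite S" "range F \<subseteq> complex_vector.span S"
    using assms by (auto simp: finite_rank_def)
  moreover have "complex_vector.subspace (range F)"
    using complex_pair.linear_subspace_image[OF bounded_clinear_linear, of F UNIV] assms
    by (simp add: finite_rank_def)
  ultimately show ?thesis using subspace_finitely_spanned_has_basis by blast
qed

text \<open>The range of \<open>F\<close> alone may fail as \<open>M\<close>: for a nilpotent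
  \<open>F\<close> it can lie inside the kernel. Adding preimages of a basis of the range makes
  \<open>M\<close> and the kernel \<open>K\<close> span everything; \<open>N\<close> is then a
  complement of \<open>M \<inter> K\<close> within \<open>K\<close>.\<close>

lemma splitting_exists:
  assumes F: "finite_rank F"
  shows "\<exists>M N. splitting F M N"
proof -
  have lin: "Vector_Spaces.linear (*\<^sub>C) (*\<^sub>C) F"
    using F by (auto simp: finite_rank_def intro: bounded_clinear_linear)
  obtain bs where bs: "complex_vector.span (set bs) = range F"
    using finite_rank_range_basis[OF F] by (auto simp: is_basis_of_def)
  define p where "p s = (SOME x. F x = s)" for s
  have p: "F (p s) = s" if "s \<in> range F" for s
    unfolding p_def using that by (auto intro: someI)
  define M where "M = complex_vector.span (set bs \<union> p ` set bs)"
  define K where "K = {x. F x = 0}"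
  have subM: "complex_vector.subspace M" by (simp add: M_def)
  have subK: "complex_vector.subspace K"
    unfolding K_def using complex_pair.linear_subspace_kernel[OF lin] .
  have rM: "range F \<subseteq> M" unfolding M_def using bs complex_vector.span_mono by blast
  have MK: "\<exists>m\<in>M. x - m \<in> K" for x
  proof -
    have "F x \<in> complex_vector.span (set bs)" using bs by simp
    then obtain c where c: "F x = (\<Sum>s\<in>set bs. c s *\<^sub>C s)"
      by (auto simp: complex_vector.span_finite)
    let ?m = "\<Sum>s\<in>set bs. c s *\<^sub>C p s"
    have "set bs \<subseteq> range F" using bs complex_vector.span_superset by blast
    then have "F ?m = (\<Sum>s\<in>set bs. c s *\<^sub>C s)"
      using p by (auto simp: complex_pair.linear_sum[OF lin] complex_pair.linear_scale[OF lin] intro!: sum.cong)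
    then have "x - ?m \<in> K" by (simp add: K_def complex_pair.linear_diff[OF lin] c)
    moreover have "?m \<in> M" unfolding M_def
      by (intro complex_vector.span_sum complex_vector.span_scale complex_vector.span_base) auto
    ultimately show ?thesis by blast
  qed
  obtain B0 where B0: "B0 \<subseteq> M \<inter> K" "complex_vector.independent B0" "M \<inter> K \<subseteq> complex_vector.span B0"
    using complex_vector.maximal_independent_subset[of "M \<inter> K"] by blast
  have "B0 \<subseteq> K" using B0 by auto
  then obtain B where B: "B0 \<subseteq> B" "B \<subseteq> K" "complex_vector.independent B" "K \<subseteq> complex_vector.span B"
    using complex_vector.maximal_independent_subset_extend[OF _ B0(2), of K] by blast
  define N where "N = complex_vector.span (B - B0)"
  have NK: "N \<subseteq> K"
    unfolding N_def using B subK by (intro complex_vector.span_minimal) auto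
  have "M \<inter> N \<subseteq> complex_vector.span B0 \<inter> complex_vector.span (B - B0)"
    using B0 NK by (auto simp: N_def)
  then have "M \<inter> N \<subseteq> {0}" by (simp only: span_Int_span_Diff[OF B(3,1)])
  then have "M \<inter> N = {0}"
    using complex_vector.subspace_0[OF subM] by (auto simp: N_def complex_vector.span_zero)
  moreover have "\<exists>m\<in>M. \<exists>n\<in>N. x = m + n" for x
  proof -
    obtain m where m: "m \<in> M" "x - m \<in> K" using MK by blast
    have "B = B0 \<union> (B - B0)" using B(1) by auto
    then have "x - m \<in> {a + b |a b. a \<in> complex_vector.span B0 \<and> b \<in> complex_vector.span (B - B0)}"
      using m(2) B(4) complex_vector.span_Un[of B0 "B - B0"] by auto
    then obtain a b where ab: "x - m = a + b" "a \<in> complex_vector.span B0" "b \<in> N"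
      by (auto simp: N_def)
    have "a \<in> M" using ab(2) complex_vector.span_minimal[of B0 M] B0(1) subM by auto
    then have "m + a \<in> M" using m(1) subM by (simp add: complex_vector.subspace_add)
    moreover have "x = (m + a) + b" using ab(1) by (simp add: algebra_simps)
    ultimately show ?thesis using ab(3) by blast
  qed
  moreover have "\<exists>S. finite S \<and> M = complex_vector.span S"
    by (rule exI[of _ "set bs \<union> p ` set bs"]) (simp add: M_def)
  ultimately have "splitting F M N"
    unfolding splitting_def using subM rM NK by (auto simp: N_def K_def)
  then show ?thesis by blast
qed

text \<open>The Weinstein--Aronszajn identity computes the determinant in every basis of every splitting, so
  that independence of these choices comes for free.\<close>

lemma det_one_plus_eq:
  fixes u :: "nat \<Rightarrow> 'a::complex_banach"
  assumes F: "finite_rank F"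
    and \<phi>: "\<And>l. l < r \<Longrightarrow> Vector_Spaces.linear (*\<^sub>C) (*) (\<phi> l)"
    and u: "\<And>l. l < r \<Longrightarrow> u l \<in> range F"
    and eq: "\<And>x. F x = (\<Sum>l<r. \<phi> l x *\<^sub>C u l)"
  shows "det_one_plus F = id_plus_det r (\<lambda>k l. \<phi> k (u l))"
proof -
  have lin: "Vector_Spaces.linear (*\<^sub>C) (*\<^sub>C) F"
    using F by (auto simp: finite_rank_def intro: bounded_clinear_linear)
  have det_on: "det_on M (\<lambda>x. x + F x) = id_plus_det r (\<lambda>k l. \<phi> k (u l))" if MN: "splitting F M N" for M N
  proof -
    have MN': "\<forall>x. \<exists>m\<in>M. \<exists>n\<in>N. x = m + n" "\<forall>x\<in>N. F x = 0" "F ` M \<subseteq> M"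
      "\<exists>S. finite S \<and> M = complex_vector.span S"
      using MN by (simp_all add: splitting_def)
    \<comment> \<open>Since \<open>F\<close> vanishes on \<open>N\<close>, every admissible
      \<open>M\<close> contains the range of \<open>F\<close>. Vectors \<open>u l\<close> taken from
      the range therefore suit all splittings at once.\<close>
    have "F x \<in> M" for x
    proof -
      obtain m n where mn: "m \<in> M" "n \<in> N" "x = m + n" using MN'(1) by metis
      then have "F m \<in> M" "F n = 0" using MN'(2,3) by auto
      then show ?thesis using complex_pair.linear_add[OF lin, of m n] mn(3) by simp
    qed
    then have uM: "u l \<in> M" if "l < r" for l using u[OF that] by auto
    obtain S where "finite S" "M = complex_vector.span S" using MN'(4) by blast
    then obtain bs where bs: "is_basis_of bs M" using finite_span_has_basis by blast
    have det: "Determinant.det (matrix_in_basis bs (\<lambda>x. x + F x)) = id_plus_det r (\<lambda>k l. \<phi> k (u l))"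
      if "is_basis_of bs M" for bs
      using that by (rule det_matrix_in_basis_id_plus) (fact \<phi> uM eq)+
    show ?thesis unfolding det_on_def
      by (rule the_equality) (use bs det in auto)
  qed
  show ?thesis unfolding det_one_plus_def
  proof (rule the_equality)
    show "\<exists>M N. splitting F M N \<and> id_plus_det r (\<lambda>k l. \<phi> k (u l)) = det_on M (\<lambda>x. x + F x)"
      using splitting_exists[OF F] det_on by metis
  qed (use det_on in auto)
qed

section \<open>The Poincare algebra\<close>

lemma ell2_eqI: "(\<And>i. ell2_apply x i = ell2_apply y i) \<Longrightarrow> x = y"
  by (metis ell2_apply_inject ext)

lemma ell2_apply_sum: "ell2_apply (sum f S) i = (\<Sum>s\<in>S. ell2_apply (f s) i)"
  by (induction S rule: infinite_finite_induct) (auto simp: zero_ell2.rep_eq plus_ell2.rep_eq)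

lemma norm_ell2_has_sum: "((\<lambda>i. (cmod (ell2_apply x i))\<^sup>2) has_sum (norm x)\<^sup>2) UNIV"
  using ell2_apply[of x] by (simp add: norm_ell2.rep_eq infsum_nonneg has_sum_infsum)

lemma norm_ell2_unit [simp]: "norm (ell2_unit k) = 1"
proof -
  have "((\<lambda>i. (cmod (ell2_apply (ell2_unit k) i))\<^sup>2) has_sum 1) {k}"
    by (rule has_sum_finiteI) (auto simp: ell2_unit.rep_eq)
  then have "((\<lambda>i. (cmod (ell2_apply (ell2_unit k) i))\<^sup>2) has_sum 1) UNIV"
    by (subst has_sum_cong_neutral[where T = "{k}"]) (auto simp: ell2_unit.rep_eq)
  from has_sum_unique[OF this norm_ell2_has_sum] show ?thesis
    by (metis norm_ge_zero one_power2 power2_eq_iff_nonneg zero_le_one)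
qed

lemma cmod_ell2_apply_le: "cmod (ell2_apply x i) \<le> norm x"
proof (rule power2_le_imp_le)
  show "(cmod (ell2_apply x i))\<^sup>2 \<le> (norm x)\<^sup>2"
    using finite_sum_le_has_sum[OF norm_ell2_has_sum, of "{i}" x] by simp
qed simp

lemma bounded_linear_ell2_apply: "bounded_linear (\<lambda>x. ell2_apply x i)"
  by (rule bounded_linear_intro[where K = 1])
    (auto simp: plus_ell2.rep_eq scaleR_ell2.rep_eq cmod_ell2_apply_le scaleR_conv_of_real)

lemma bounded_linear_scaleC_left: "bounded_linear (\<lambda>c. c *\<^sub>C x)"
  by (rule bounded_linear_intro[where K = "norm x"])
    (auto simp: scaleC_add_left norm_scaleC scaleC_scaleC scaleR_conv_of_real simp flip: scaleC_of_real)

lemma bounded_clinear_sum: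
  "(\<And>s. s \<in> S \<Longrightarrow> bounded_clinear (f s)) \<Longrightarrow> bounded_clinear (\<lambda>x. \<Sum>s\<in>S. f s x)"
  by (auto simp: bounded_clinear_def bounded_linear_sum complex_vector.scale_sum_right)

text \<open>The error after a finite set \<open>S\<close> has the coordinates of \<open>- x\<close>
  off \<open>S\<close> and zero on \<open>S\<close>, so its squared norm is the tail of a convergent
  sum.\<close>

lemma ell2_unit_expansion: "((\<lambda>i. ell2_apply x i *\<^sub>C ell2_unit i) has_sum x) UNIV"
proof -
  have diff: "(norm ((\<Sum>i\<in>S. ell2_apply x i *\<^sub>C ell2_unit i) - x))\<^sup>2 =
      (norm x)\<^sup>2 - (\<Sum>i\<in>S. (cmod (ell2_apply x i))\<^sup>2)" if S: "finite S" for S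
  proof -
    let ?y = "(\<Sum>i\<in>S. ell2_apply x i *\<^sub>C ell2_unit i) - x"
    have "ell2_apply ?y j = (if j \<in> S then 0 else - ell2_apply x j)" for j
      using S by (simp add: minus_ell2.rep_eq ell2_apply_sum scaleC_ell2.rep_eq ell2_unit.rep_eq
          if_distrib[of "\<lambda>c. _ * c"] cong: if_cong)
    then have "((\<lambda>j. (cmod (ell2_apply x j))\<^sup>2) has_sum (norm ?y)\<^sup>2) (UNIV - S)"
      using norm_ell2_has_sum[of ?y]
      by (subst has_sum_cong_neutral[where T = UNIV and g = "\<lambda>j. (cmod (ell2_apply ?y j))\<^sup>2"]) auto
    moreover have "((\<lambda>j. (cmod (ell2_apply x j))\<^sup>2) has_sum
        ((norm x)\<^sup>2 - (\<Sum>i\<in>S. (cmod (ell2_apply x i))\<^sup>2))) (UNIV - S)"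
      using S by (intro has_sum_Diff norm_ell2_has_sum has_sum_finite) auto
    ultimately show ?thesis by (rule has_sum_unique)
  qed
  have lim: "((\<lambda>S. (norm x)\<^sup>2 - (\<Sum>i\<in>S. (cmod (ell2_apply x i))\<^sup>2)) \<longlongrightarrow> (norm x)\<^sup>2 - (norm x)\<^sup>2)
      (finite_subsets_at_top UNIV)"
    using norm_ell2_has_sum[of x] unfolding has_sum_def by (intro tendsto_intros) auto
  have "((\<lambda>S. (norm ((\<Sum>i\<in>S. ell2_apply x i *\<^sub>C ell2_unit i) - x))\<^sup>2) \<longlongrightarrow> 0)
      (finite_subsets_at_top UNIV)"
  proof (rule Lim_transform_eventually)
    show "\<forall>\<^sub>F S in finite_subsets_at_top UNIV. (norm x)\<^sup>2 - (\<Sum>i\<in>S. (cmod (ell2_apply x i))\<^sup>2) =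
        (norm ((\<Sum>i\<in>S. ell2_apply x i *\<^sub>C ell2_unit i) - x))\<^sup>2"
      by (rule eventually_finite_subsets_at_top_weakI) (simp add: diff)
  qed (use lim in simp)
  then have "((\<lambda>S. sqrt ((norm ((\<Sum>i\<in>S. ell2_apply x i *\<^sub>C ell2_unit i) - x))\<^sup>2)) \<longlongrightarrow> sqrt 0)
      (finite_subsets_at_top UNIV)"
    by (rule tendsto_real_sqrt)
  then have "((\<lambda>S. norm ((\<Sum>i\<in>S. ell2_apply x i *\<^sub>C ell2_unit i) - x)) \<longlongrightarrow> 0)
      (finite_subsets_at_top UNIV)" by simp
  then show ?thesis unfolding has_sum_def by (simp add: LIM_zero_iff tendsto_norm_zero_iff)
qed

lemma has_sum_sum_finite:
  fixes f :: "'k \<Rightarrow> 'i \<Rightarrow> 'v::topological_comm_monoid_add"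
  assumes "finite K" "\<And>k. k \<in> K \<Longrightarrow> (f k has_sum s k) A"
  shows "((\<lambda>i. \<Sum>k\<in>K. f k i) has_sum (\<Sum>k\<in>K. s k)) A"
  using assms by (induction K rule: finite_induct) (auto intro: has_sum_add)

text \<open>The 2-norm is at most the 1-norm. The bound is joint in \<open>k\<close> because it
  serves for the columns of a matrix; separate bounds would lose a factor
  \<open>card K\<close>.\<close>

lemma sum_norm_ell2_le:
  assumes K: "finite K" and b: "\<And>S. finite S \<Longrightarrow> (\<Sum>k\<in>K. \<Sum>i\<in>S. cmod (ell2_apply (x k) i)) \<le> b"
  shows "(\<Sum>k\<in>K. norm (x k)) \<le> b"
proof -
  have sum: "(\<lambda>i. cmod (ell2_apply (x k) i)) summable_on UNIV" if k: "k \<in> K" for k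
  proof (intro nonneg_bdd_above_summable_on bdd_aboveI2)
    fix S assume "S \<in> {F. F \<subseteq> (UNIV :: 'b set) \<and> finite F}"
    then have S: "finite S" by simp
    have "(\<Sum>i\<in>S. cmod (ell2_apply (x k) i)) \<le> (\<Sum>k\<in>K. \<Sum>i\<in>S. cmod (ell2_apply (x k) i))"
      using K k by (intro member_le_sum) (auto intro: sum_nonneg)
    then show "(\<Sum>i\<in>S. cmod (ell2_apply (x k) i)) \<le> b" using b[OF S] by simp
  qed simp
  have "(\<Sum>k\<in>K. norm (x k)) \<le> (\<Sum>k\<in>K. \<Sum>\<^sub>\<infinity>i. cmod (ell2_apply (x k) i))"
  proof (rule sum_mono)
    fix k assume "k \<in> K"
    then show "norm (x k) \<le> (\<Sum>\<^sub>\<infinity>i. cmod (ell2_apply (x k) i))"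
      using sum by (intro norm_has_sum_bound[OF _ ell2_unit_expansion])
        (auto simp: norm_scaleC has_sum_infsum)
  qed
  also have "\<dots> \<le> b"
  proof (rule has_sum_le_finite_sums)
    show "((\<lambda>i. \<Sum>k\<in>K. cmod (ell2_apply (x k) i)) has_sum (\<Sum>k\<in>K. \<Sum>\<^sub>\<infinity>i. cmod (ell2_apply (x k) i))) UNIV"
      using K sum by (intro has_sum_sum_finite) (auto intro: has_sum_infsum)
    show "(\<Sum>i\<in>S. \<Sum>k\<in>K. cmod (ell2_apply (x k) i)) \<le> b" if "finite S" for S
      using b[OF that] by (subst sum.swap)
  qed
  finally show ?thesis .
qed

lemma norm_ell2_le_sum:
  assumes "\<And>S. finite S \<Longrightarrow> (\<Sum>i\<in>S. cmod (ell2_apply x i)) \<le> b"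
  shows "norm x \<le> b"
  using sum_norm_ell2_le[of "{()}" "\<lambda>_. x" b] assms by simp

section \<open>Matrix entries and the norm of the Poincare algebra\<close>

lemma entry_has_sum:
  assumes "bounded_clinear A"
  shows "((\<lambda>k. entry A j k * ell2_apply x k) has_sum ell2_apply (A x) j) UNIV"
proof -
  have A: "bounded_linear A" and sc: "A (c *\<^sub>C y) = c *\<^sub>C A y" for c y
    using assms by (auto simp: bounded_clinear_def)
  \<comment> \<open>A bounded functional passes through the unconditional expansion in unit vectors;
    this is what makes \<open>entry A\<close> a matrix of \<open>A\<close>.\<close>
  have "bounded_linear (\<lambda>y. ell2_apply (A y) j)"
    by (rule bounded_linear_compose[OF bounded_linear_ell2_apply A])
  from has_sum_bounded_linear[OF this ell2_unit_expansion[of x]] show ?thesis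
    by (simp add: o_def sc entry_def scaleC_ell2.rep_eq mult.commute)
qed

lemma entry_eqI:
  assumes "bounded_clinear A" "bounded_clinear B" "\<And>j k. entry A j k = entry B j k"
  shows "A = B"
proof (intro ext ell2_eqI)
  show "ell2_apply (A x) j = ell2_apply (B x) j" for x j
    using has_sum_unique[OF entry_has_sum[OF assms(1)] entry_has_sum[OF assms(2), of j x, folded assms(3)]] .
qed

lemma entry_zero: "entry (\<lambda>x. 0) j k = 0"
  by (simp add: entry_def zero_ell2.rep_eq)

lemma entry_add: "entry (\<lambda>x. A x + B x) j k = entry A j k + entry B j k"
  by (simp add: entry_def plus_ell2.rep_eq)

lemma entry_diff: "entry (\<lambda>x. A x - B x) j k = entry A j k - entry B j k"
  by (simp add: entry_def minus_ell2.rep_eq)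

lemma entry_scaleC: "entry (\<lambda>x. c *\<^sub>C A x) j k = c * entry A j k"
  by (simp add: entry_def scaleC_ell2.rep_eq)

lemma bounded_clinear_zero: "bounded_clinear (\<lambda>x. 0)"
  by (simp add: bounded_clinear_def bounded_linear_zero)

lemma bounded_clinear_add:
  "bounded_clinear A \<Longrightarrow> bounded_clinear B \<Longrightarrow> bounded_clinear (\<lambda>x. A x + B x)"
  by (simp add: bounded_clinear_def bounded_linear_add scaleC_add_right)

lemma bounded_linear_scaleC_right: "bounded_linear (\<lambda>x. c *\<^sub>C x)"
  by (rule bounded_linear_intro[where K = "cmod c"])
    (auto simp: scaleC_add_right norm_scaleC scaleC_scaleC mult.commute simp flip: scaleC_of_real)

lemma bounded_clinear_scaleC: "bounded_clinear A \<Longrightarrow> bounded_clinear (\<lambda>x. c *\<^sub>C A x)"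
  by (auto simp: bounded_clinear_def scaleC_scaleC mult.commute
      intro: bounded_linear_compose[OF bounded_linear_scaleC_right])

lemma bounded_clinear_comp: "bounded_clinear A \<Longrightarrow> bounded_clinear B \<Longrightarrow> bounded_clinear (A \<circ> B)"
  by (auto simp: bounded_clinear_def bounded_linear_compose o_def)

lemma has_sum_poincare_norm:
  assumes "A \<in> poincare_algebra"
  shows "((\<lambda>(j, k). cmod (entry A j k)) has_sum poincare_norm A) UNIV"
  using assms by (simp add: poincare_algebra_def poincare_norm_def has_sum_infsum)

lemma sum_entry_le_poincare_norm:
  assumes "A \<in> poincare_algebra" "finite P"
  shows "(\<Sum>(j, k)\<in>P. cmod (entry A j k)) \<le> poincare_norm A"
  by (rule finite_sum_le_has_sum[OF has_sum_poincare_norm]) (use assms in auto)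

lemma sum_sum_entry_le_poincare_norm:
  assumes "A \<in> poincare_algebra" "finite J" "finite K"
  shows "(\<Sum>j\<in>J. \<Sum>k\<in>K. cmod (entry A j k)) \<le> poincare_norm A"
  using sum_entry_le_poincare_norm[OF assms(1), of "J \<times> K"] assms by (simp add: sum.cartesian_product)

text \<open>A finite set of index pairs lies in a finite rectangle, so rectangles suffice. Columns
  are outermost since column \<open>k\<close> of \<open>A \<circ> B\<close> is \<open>A\<close>
  applied to column \<open>k\<close> of \<open>B\<close>.\<close>

lemma poincare_algebraI:
  assumes "bounded_clinear A"
    and "\<And>J K. finite J \<Longrightarrow> finite K \<Longrightarrow> (\<Sum>k\<in>K. \<Sum>j\<in>J. cmod (entry A j k)) \<le> b"
  shows "A \<in> poincare_algebra" "poincare_norm A \<le> b"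
proof -
  have bound: "(\<Sum>(j, k)\<in>P. cmod (entry A j k)) \<le> b" if "finite P" for P
  proof -
    have "(\<Sum>(j, k)\<in>P. cmod (entry A j k)) \<le> (\<Sum>(j, k)\<in>fst ` P \<times> snd ` P. cmod (entry A j k))"
      using that by (intro sum_mono2 subset_fst_snd) auto
    also have "\<dots> \<le> b"
      unfolding sum.cartesian_product[symmetric]
      by (subst sum.swap) (use assms(2) that in simp)
    finally show ?thesis .
  qed
  have sum: "(\<lambda>(j, k). cmod (entry A j k)) summable_on UNIV"
    using bound by (intro nonneg_bdd_above_summable_on) (auto intro!: bdd_aboveI2)
  then show "A \<in> poincare_algebra" using assms(1) by (simp add: poincare_algebra_def)
  show "poincare_norm A \<le> b"
    unfolding poincare_norm_def using sum bound by (intro infsum_le_finite_sums) auto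
qed

text \<open>The phases \<open>sgn (cnj _)\<close> turn the sum of moduli into a single limit of
  finite double sums, each bounded using \<open>cmod (ell2_apply x k) \<le> norm x\<close>. The
  result controls the 1-norm of \<open>A x\<close>, as the product estimate requires.\<close>

lemma sum_ell2_apply_le_poincare_norm:
  assumes A: "A \<in> poincare_algebra" and J: "finite J"
  shows "(\<Sum>j\<in>J. cmod (ell2_apply (A x) j)) \<le> poincare_norm A * norm x"
proof -
  have bA: "bounded_clinear A" using A by (simp add: poincare_algebra_def)
  have "((\<lambda>k. \<Sum>j\<in>J. sgn (cnj (ell2_apply (A x) j)) * (entry A j k * ell2_apply x k)) has_sum
      (\<Sum>j\<in>J. sgn (cnj (ell2_apply (A x) j)) * ell2_apply (A x) j)) UNIV"
    by (intro has_sum_sum_finite has_sum_cmult_right entry_has_sum[OF bA]) (rule J)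
  then have lim: "((\<lambda>K. \<Sum>k\<in>K. \<Sum>j\<in>J. sgn (cnj (ell2_apply (A x) j)) * (entry A j k * ell2_apply x k)) \<longlongrightarrow>
      (\<Sum>j\<in>J. sgn (cnj (ell2_apply (A x) j)) * ell2_apply (A x) j)) (finite_subsets_at_top UNIV)"
    by (simp add: has_sum_def)
  have "cmod (\<Sum>j\<in>J. sgn (cnj (ell2_apply (A x) j)) * ell2_apply (A x) j) \<le> poincare_norm A * norm x"
  proof (rule tendsto_upperbound[OF tendsto_norm[OF lim]])
    show "\<forall>\<^sub>F K in finite_subsets_at_top UNIV.
        cmod (\<Sum>k\<in>K. \<Sum>j\<in>J. sgn (cnj (ell2_apply (A x) j)) * (entry A j k * ell2_apply x k)) \<le>
        poincare_norm A * norm x"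
    proof (rule eventually_finite_subsets_at_top_weakI)
      fix K :: "(int^'a) set" assume K: "finite K"
      have "cmod (\<Sum>k\<in>K. \<Sum>j\<in>J. sgn (cnj (ell2_apply (A x) j)) * (entry A j k * ell2_apply x k)) \<le>
          (\<Sum>k\<in>K. \<Sum>j\<in>J. cmod (entry A j k) * norm x)"
      proof (intro sum_norm_le)
        fix k j
        show "cmod (sgn (cnj (ell2_apply (A x) j)) * (entry A j k * ell2_apply x k)) \<le>
            cmod (entry A j k) * norm x"
          by (auto simp: norm_mult norm_sgn intro!: mult_left_mono cmod_ell2_apply_le)
      qed
      also have "\<dots> = (\<Sum>j\<in>J. \<Sum>k\<in>K. cmod (entry A j k)) * norm x"
        by (subst sum.swap) (simp add: sum_distrib_right)
      also have "\<dots> \<le> poincare_norm A * norm x"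
        by (intro mult_right_mono sum_sum_entry_le_poincare_norm A J K) simp
      finally show "cmod (\<Sum>k\<in>K. \<Sum>j\<in>J. sgn (cnj (ell2_apply (A x) j)) * (entry A j k * ell2_apply x k)) \<le>
        poincare_norm A * norm x" .
    qed
  qed simp
  moreover have "sgn (cnj z) * z = of_real (cmod z)" for z
    by (simp add: sgn_eq complex_norm_square[symmetric] mult.commute power2_eq_square)
  ultimately show ?thesis by (simp flip: of_real_sum add: sum_nonneg)
qed

lemma norm_le_poincare_norm: "A \<in> poincare_algebra \<Longrightarrow> norm (A x) \<le> poincare_norm A * norm x"
  by (intro norm_ell2_le_sum sum_ell2_apply_le_poincare_norm)

lemma poincare_norm_nonneg: "0 \<le> poincare_norm A"
  by (auto simp: poincare_norm_def intro: infsum_nonneg)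

lemma poincare_algebra_zero: "(\<lambda>x. 0) \<in> poincare_algebra" "poincare_norm (\<lambda>x. 0) = 0"
  by (simp_all add: poincare_algebra_def poincare_norm_def bounded_clinear_zero entry_zero case_prod_unfold)

lemma poincare_algebra_add:
  assumes "A \<in> poincare_algebra" "B \<in> poincare_algebra"
  shows "(\<lambda>x. A x + B x) \<in> poincare_algebra"
    and "poincare_norm (\<lambda>x. A x + B x) \<le> poincare_norm A + poincare_norm B"
proof -
  have bound: "(\<Sum>k\<in>K. \<Sum>j\<in>J. cmod (entry (\<lambda>x. A x + B x) j k)) \<le> poincare_norm A + poincare_norm B"
    if "finite J" "finite K" for J K
  proof -
    have "(\<Sum>k\<in>K. \<Sum>j\<in>J. cmod (entry (\<lambda>x. A x + B x) j k)) \<le>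
        (\<Sum>k\<in>K. \<Sum>j\<in>J. cmod (entry A j k) + cmod (entry B j k))"
      by (intro sum_mono) (simp add: entry_add norm_triangle_ineq)
    also have "\<dots> = (\<Sum>j\<in>J. \<Sum>k\<in>K. cmod (entry A j k)) + (\<Sum>j\<in>J. \<Sum>k\<in>K. cmod (entry B j k))"
      by (subst sum.swap) (simp add: sum.distrib)
    also have "\<dots> \<le> poincare_norm A + poincare_norm B"
      using assms that by (intro add_mono sum_sum_entry_le_poincare_norm)
    finally show ?thesis .
  qed
  have "bounded_clinear (\<lambda>x. A x + B x)"
    using assms by (simp add: poincare_algebra_def bounded_clinear_add)
  note * = poincare_algebraI[OF this]
  show "(\<lambda>x. A x + B x) \<in> poincare_algebra" by (rule *(1)) (rule bound)
  show "poincare_norm (\<lambda>x. A x + B x) \<le> poincare_norm A + poincare_norm B" by (rule *(2)) (rule bound)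
qed

lemma poincare_algebra_scaleC:
  assumes "A \<in> poincare_algebra"
  shows "(\<lambda>x. c *\<^sub>C A x) \<in> poincare_algebra" "poincare_norm (\<lambda>x. c *\<^sub>C A x) = cmod c * poincare_norm A"
proof -
  have "((\<lambda>(j, k). cmod (entry (\<lambda>x. c *\<^sub>C A x) j k)) has_sum (cmod c * poincare_norm A)) UNIV"
    using has_sum_cmult_right[OF has_sum_poincare_norm[OF assms], of "cmod c"]
    by (simp add: entry_scaleC norm_mult case_prod_unfold)
  then show "(\<lambda>x. c *\<^sub>C A x) \<in> poincare_algebra" "poincare_norm (\<lambda>x. c *\<^sub>C A x) = cmod c * poincare_norm A"
    using assms by (auto simp: poincare_algebra_def poincare_norm_def bounded_clinear_scaleC
        summable_on_def infsumI)
qed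

lemma poincare_algebra_diff:
  assumes "A \<in> poincare_algebra" "B \<in> poincare_algebra"
  shows "(\<lambda>x. A x - B x) \<in> poincare_algebra"
proof -
  have "- 1 *\<^sub>C y = - y" for y :: "(int^'n) ell2" by (simp add: complex_vector.scale_minus_left)
  then show ?thesis
    using poincare_algebra_add(1)[OF assms(1) poincare_algebra_scaleC(1)[OF assms(2), of "-1"]] by simp
qed

text \<open>No product of infinite matrices is expanded: the 1-norm of column \<open>k\<close> is at
  most \<open>poincare_norm A\<close> times the 2-norm of column \<open>k\<close> of
  \<open>B\<close>, and those 2-norms sum to at most \<open>poincare_norm B\<close>.\<close>

lemma poincare_algebra_comp:
  assumes A: "A \<in> poincare_algebra" and B: "B \<in> poincare_algebra"
  shows "A \<circ> B \<in> poincare_algebra" "poincare_norm (A \<circ> B) \<le> poincare_norm A * poincare_norm B"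
proof -
  have cols: "(\<Sum>k\<in>K. norm (B (ell2_unit k))) \<le> poincare_norm B" if K: "finite K" for K
  proof (rule sum_norm_ell2_le[OF K])
    fix S :: "(int^'a) set" assume "finite S"
    then show "(\<Sum>k\<in>K. \<Sum>i\<in>S. cmod (ell2_apply (B (ell2_unit k)) i)) \<le> poincare_norm B"
      using sum_sum_entry_le_poincare_norm[OF B _ K, of S] by (subst sum.swap) (simp add: entry_def)
  qed
  have bound: "(\<Sum>k\<in>K. \<Sum>j\<in>J. cmod (entry (A \<circ> B) j k)) \<le> poincare_norm A * poincare_norm B"
    if "finite J" "finite K" for J K
  proof -
    have "(\<Sum>k\<in>K. \<Sum>j\<in>J. cmod (entry (A \<circ> B) j k)) \<le> (\<Sum>k\<in>K. poincare_norm A * norm (B (ell2_unit k)))"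
      using sum_ell2_apply_le_poincare_norm[OF A that(1)] by (intro sum_mono) (simp add: entry_def)
    also have "\<dots> \<le> poincare_norm A * poincare_norm B"
      unfolding sum_distrib_left[symmetric]
      by (intro mult_left_mono cols that poincare_norm_nonneg)
    finally show ?thesis .
  qed
  have "bounded_clinear (A \<circ> B)"
    using assms by (simp add: poincare_algebra_def bounded_clinear_comp)
  note * = poincare_algebraI[OF this]
  show "A \<circ> B \<in> poincare_algebra" by (rule *(1)) (rule bound)
  show "poincare_norm (A \<circ> B) \<le> poincare_norm A * poincare_norm B" by (rule *(2)) (rule bound)
qed

lemma embedded_subalgebra_poincare:
  "embedded_subalgebra (poincare_algebra :: ((int^'n) ell2 \<Rightarrow> (int^'n) ell2) set) poincare_norm"
  unfolding embedded_subalgebra_def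
proof (intro conjI)
  show "subalgebra poincare_algebra"
    unfolding subalgebra_def
    by (auto simp: poincare_algebra_zero poincare_algebra_add poincare_algebra_scaleC poincare_algebra_comp)
      (simp add: poincare_algebra_def)
  have zero: "A = (\<lambda>x. 0)" if A: "A \<in> poincare_algebra" "poincare_norm A = 0"
    for A :: "(int^'n) ell2 \<Rightarrow> (int^'n) ell2"
  proof (rule entry_eqI)
    show "entry A j k = entry (\<lambda>x. 0) j k" for j k
      using sum_entry_le_poincare_norm[OF A(1), of "{(j, k)}"] A(2) by (simp add: entry_zero)
  qed (use A in \<open>auto simp: poincare_algebra_def bounded_clinear_zero\<close>)
  show "norm_on (poincare_algebra :: ((int^'n) ell2 \<Rightarrow> (int^'n) ell2) set) poincare_norm"
    unfolding norm_on_def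
    by (intro conjI ballI allI iffI)
      (auto simp: poincare_algebra_zero poincare_algebra_add poincare_algebra_scaleC
        poincare_norm_nonneg intro: zero)
  show "\<exists>C>0. \<forall>A\<in>(poincare_algebra :: ((int^'n) ell2 \<Rightarrow> (int^'n) ell2) set). onorm A \<le> C * poincare_norm A"
  proof (intro exI[of _ 1] conjI ballI)
    fix A :: "(int^'n) ell2 \<Rightarrow> (int^'n) ell2" assume "A \<in> poincare_algebra"
    then show "onorm A \<le> 1 * poincare_norm A"
      by (simp add: onorm_bound norm_le_poincare_norm poincare_norm_nonneg)
  qed simp
qed (auto simp: poincare_algebra_comp)

section \<open>Density of the finite rank operators\<close>

lemma bounded_clinear_rank_one: "bounded_clinear (\<lambda>x. (c * ell2_apply x k) *\<^sub>C y)"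
  unfolding bounded_clinear_def
  by (auto simp: scaleC_ell2.rep_eq scaleC_scaleC algebra_simps
      intro!: bounded_linear_compose[OF bounded_linear_scaleC_left]
        bounded_linear_compose[OF bounded_linear_mult_right] bounded_linear_ell2_apply)

lemma approximable_poincare:
  "approximable (poincare_algebra :: ((int^'n) ell2 \<Rightarrow> (int^'n) ell2) set) poincare_norm"
  unfolding approximable_def
proof (intro ballI allI impI)
  fix A :: "(int^'n) ell2 \<Rightarrow> (int^'n) ell2" and e :: real assume A: "A \<in> poincare_algebra" and e: "e > 0"
  have "(sum (\<lambda>(j, k). cmod (entry A j k)) \<longlongrightarrow> poincare_norm A) (finite_subsets_at_top UNIV)"
    using has_sum_poincare_norm[OF A] by (simp add: has_sum_def)
  \<comment> \<open>\<open>P\<close> carries all but less than \<open>e\<close> of the norm; cutting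
    the matrix down to \<open>P\<close> leaves exactly the remaining mass as error.\<close>
  from order_tendstoD(1)[OF this, of "poincare_norm A - e"] e
  obtain P where P: "finite P" "poincare_norm A - e < (\<Sum>(j, k)\<in>P. cmod (entry A j k))"
    by (auto simp: eventually_finite_subsets_at_top)
  define F where "F x = (\<Sum>(j, k)\<in>P. (entry A j k * ell2_apply x k) *\<^sub>C ell2_unit j)" for x
  have bF: "bounded_clinear F"
    unfolding F_def case_prod_unfold by (intro bounded_clinear_sum bounded_clinear_rank_one)
  have entF: "entry F j k = (if (j, k) \<in> P then entry A j k else 0)" for j k
  proof -
    have "entry F j k = (\<Sum>p\<in>P. if p = (j, k) then entry A j k else 0)"
      unfolding entry_def[of F] F_def ell2_apply_sum
      by (intro sum.cong) (auto simp: scaleC_ell2.rep_eq ell2_unit.rep_eq split: if_splits)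
    then show ?thesis using P(1) by simp
  qed
  have "finite_rank F"
    unfolding finite_rank_def
  proof (intro conjI bF exI[of _ "ell2_unit ` fst ` P"])
    show "range F \<subseteq> complex_vector.span (ell2_unit ` fst ` P)"
      unfolding F_def case_prod_unfold
      by (intro image_subsetI complex_vector.span_sum complex_vector.span_scale complex_vector.span_base) auto
  qed (use P in auto)
  have "((\<lambda>(j, k). cmod (entry F j k)) has_sum (\<Sum>(j, k)\<in>P. cmod (entry A j k))) UNIV"
    by (rule has_sum_finite_neutralI[OF P(1)]) (auto simp: entF intro!: sum.cong)
  then have "F \<in> poincare_algebra" using bF by (auto simp: poincare_algebra_def summable_on_def)
  have "((\<lambda>(j, k). cmod (entry A j k)) has_sum (poincare_norm A - (\<Sum>(j, k)\<in>P. cmod (entry A j k)))) (UNIV - P)"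
    using P by (intro has_sum_Diff has_sum_poincare_norm[OF A] has_sum_finite) auto
  then have "((\<lambda>(j, k). cmod (entry (\<lambda>x. A x - F x) j k)) has_sum
      (poincare_norm A - (\<Sum>(j, k)\<in>P. cmod (entry A j k)))) UNIV"
    by (subst has_sum_cong_neutral[where T = "UNIV - P"]) (auto simp: entry_diff entF)
  then have "poincare_norm (\<lambda>x. A x - F x) < e"
    unfolding poincare_norm_def[of "\<lambda>x. A x - F x"] using P(2) by (simp add: infsumI)
  then show "\<exists>F\<in>poincare_algebra. finite_rank F \<and> poincare_norm (\<lambda>x. A x - F x) < e"
    using \<open>F \<in> poincare_algebra\<close> \<open>finite_rank F\<close> by blast
qed

text \<open>Gaussian elimination.  Unlike for an arbitrary basis, the coefficients with respect to this one are
  visibly continuous.\<close>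

lemma coordinate_basis:
  fixes S :: "'i ell2 set"
  assumes "finite S"
  shows "\<exists>J u. finite J \<and> (\<forall>j\<in>J. u j \<in> complex_vector.span S) \<and>
    (\<forall>i\<in>J. \<forall>j\<in>J. ell2_apply (u j) i = of_bool (i = j)) \<and>
    (\<forall>v\<in>complex_vector.span S. v = (\<Sum>j\<in>J. ell2_apply v j *\<^sub>C u j))"
  using assms
proof (induction S rule: finite_induct)
  case empty
  show ?case by (rule exI[of _ "{}"]) simp
next
  case (insert s S)
  then obtain J and u :: "'i \<Rightarrow> 'i ell2" where J: "finite J"
    and uS: "\<And>j. j \<in> J \<Longrightarrow> u j \<in> complex_vector.span S"
    and dual: "\<And>i j. i \<in> J \<Longrightarrow> j \<in> J \<Longrightarrow> ell2_apply (u j) i = of_bool (i = j)"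
    and rep: "\<And>v. v \<in> complex_vector.span S \<Longrightarrow> v = (\<Sum>j\<in>J. ell2_apply v j *\<^sub>C u j)"
    by metis
  \<comment> \<open>Removing from \<open>s\<close> what the pivots in \<open>J\<close> already
    determine leaves a residue \<open>w\<close> vanishing at each of them.\<close>
  define p where "p = (\<Sum>j\<in>J. ell2_apply s j *\<^sub>C u j)"
  define w where "w = s - p"
  have pS: "p \<in> complex_vector.span S"
    unfolding p_def using uS by (intro complex_vector.span_sum complex_vector.span_scale)
  have spp: "complex_vector.span S \<subseteq> complex_vector.span (insert s S)"
    by (rule complex_vector.span_mono) auto
  show ?case
  proof (cases "w = 0")
    case True
    then have "s \<in> complex_vector.span S" using pS by (simp add: w_def)
    then have "complex_vector.span (insert s S) = complex_vector.span S"
      by (rule complex_vector.span_redundant)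
    then show ?thesis using J uS dual rep by (intro exI[of _ J] exI[of _ u]) auto
  next
    case False
    \<comment> \<open>A nonzero coordinate of the residue is the new pivot.\<close>
    then obtain i where i: "ell2_apply w i \<noteq> 0" by (metis ell2_eqI zero_ell2.rep_eq)
    have wJ: "ell2_apply w j = 0" if "j \<in> J" for j
    proof -
      have "ell2_apply p j = (\<Sum>k\<in>J. if k = j then ell2_apply s j else 0)"
        unfolding p_def ell2_apply_sum using that dual by (intro sum.cong) (auto simp: scaleC_ell2.rep_eq)
      then show ?thesis using J that by (simp add: w_def minus_ell2.rep_eq)
    qed
    have iJ: "i \<notin> J" using i wJ by auto
    define q where "q = (1 / ell2_apply w i) *\<^sub>C w"
    have q: "ell2_apply q j = (if j = i then 1 else 0)" if "j \<in> insert i J" for j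
      using that i wJ iJ by (auto simp: q_def scaleC_ell2.rep_eq)
    have wq: "w = ell2_apply w i *\<^sub>C q" using i by (simp add: q_def)
    have wS: "w \<in> complex_vector.span (insert s S)"
      unfolding w_def
      by (rule complex_vector.span_diff[OF complex_vector.span_base subsetD[OF spp pS]]) simp
    have qS: "q \<in> complex_vector.span (insert s S)"
      unfolding q_def using wS by (rule complex_vector.span_scale)
    \<comment> \<open>The old vectors are cleared at the pivot \<open>i\<close> by multiples of
      \<open>q\<close>. As \<open>q\<close> vanishes on \<open>J\<close>, duality at the old pivots
      survives.\<close>
    define u' where "u' j = (if j = i then q else u j - ell2_apply (u j) i *\<^sub>C q)" for j
    have u': "u' i = q" "\<And>j. j \<in> J \<Longrightarrow> u' j = u j - ell2_apply (u j) i *\<^sub>C q"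
      using iJ by (auto simp: u'_def)
    \<comment> \<open>The vectors reproduced by \<open>P\<close> form a subspace, so testing
      \<open>s\<close> and the members of \<open>S\<close> suffices.\<close>
    define P where "P v = (\<Sum>j\<in>insert i J. ell2_apply v j *\<^sub>C u' j)" for v
    have Psub: "complex_vector.subspace {v. v = P v}"
    proof -
      have "P 0 = 0" "P (x + y) = P x + P y" "P (c *\<^sub>C x) = c *\<^sub>C P x" for x y c
        by (simp_all add: P_def zero_ell2.rep_eq plus_ell2.rep_eq scaleC_ell2.rep_eq scaleC_add_left
            sum.distrib complex_vector.scale_sum_right scaleC_scaleC)
      then show ?thesis by (intro complex_vector.subspaceI) auto
    qed
    have PS: "v = P v" if v: "v \<in> complex_vector.span S" for v
    proof -
      have vi: "ell2_apply v i = (\<Sum>j\<in>J. ell2_apply v j * ell2_apply (u j) i)"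
        by (subst rep[OF v]) (simp add: ell2_apply_sum scaleC_ell2.rep_eq)
      have "P v = ell2_apply v i *\<^sub>C q + (\<Sum>j\<in>J. ell2_apply v j *\<^sub>C u j)
          - (\<Sum>j\<in>J. ell2_apply v j * ell2_apply (u j) i) *\<^sub>C q"
        unfolding P_def using J iJ u'
        by (simp add: complex_vector.scale_right_diff_distrib sum_subtractf scaleC_scaleC
            complex_vector.scale_sum_left)
      then show ?thesis using rep[OF v] vi by simp
    qed
    have "P w = ell2_apply w i *\<^sub>C q"
      unfolding P_def using J iJ u' wJ by simp
    then have "w \<in> {v. v = P v}" using wq by simp
    then have "s \<in> {v. v = P v}"
      using complex_vector.subspace_add[OF Psub, of w p] PS[OF pS] by (simp add: w_def)
    moreover have "S \<subseteq> {v. v = P v}" using PS complex_vector.span_base by blast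
    ultimately have "complex_vector.span (insert s S) \<subseteq> {v. v = P v}"
      by (intro complex_vector.span_minimal Psub) auto
    moreover have "u' j \<in> complex_vector.span (insert s S)" if "j \<in> insert i J" for j
      using that qS subsetD[OF spp uS] u'
      by (auto intro!: complex_vector.span_diff complex_vector.span_scale)
    moreover have "ell2_apply (u' j) k = of_bool (k = j)" if "j \<in> insert i J" "k \<in> insert i J" for j k
      using that dual u' q iJ by (auto simp: minus_ell2.rep_eq scaleC_ell2.rep_eq)
    ultimately show ?thesis
      using J by (intro exI[of _ "insert i J"] exI[of _ u']) (auto simp: P_def)
  qed
qed

text \<open>The coefficient of \<open>u l\<close> is coordinate \<open>c l\<close> of
  \<open>F x\<close>, a functional given by a row of the matrix of \<open>F\<close>;
  \<open>entry_has_sum\<close> then applies to it.\<close>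

lemma finite_rank_coordinate_form:
  fixes F :: "'i ell2 \<Rightarrow> 'i ell2"
  assumes F: "finite_rank F"
  obtains r and c :: "nat \<Rightarrow> 'i" and u :: "nat \<Rightarrow> 'i ell2"
  where "\<And>l. l < r \<Longrightarrow> u l \<in> range F"
    "\<And>x. F x = (\<Sum>l<r. ell2_apply (F x) (c l) *\<^sub>C u l)"
proof -
  obtain bs where bs: "complex_vector.span (set bs) = range F"
    using finite_rank_range_basis[OF F] by (auto simp: is_basis_of_def)
  obtain J and u :: "'i \<Rightarrow> 'i ell2" where J: "finite J" and u: "\<forall>j\<in>J. u j \<in> range F"
    and rep: "\<forall>v\<in>range F. v = (\<Sum>j\<in>J. ell2_apply v j *\<^sub>C u j)"
    using coordinate_basis[OF finite_set, of bs] unfolding bs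
    by (elim exE conjE) (rule that, assumption+)
  obtain js where js: "distinct js" "set js = J" using finite_distinct_list[OF J] by blast
  show ?thesis
  proof (rule that[of "length js" "\<lambda>l. u (js ! l)" "\<lambda>l. js ! l"])
    show "u (js ! l) \<in> range F" if "l < length js" for l using that js u by auto
    show "F x = (\<Sum>l<length js. ell2_apply (F x) (js ! l) *\<^sub>C u (js ! l))" for x
      using bspec[OF rep rangeI, of x] sum_nth_distinct[OF js(1), of "\<lambda>j. ell2_apply (F x) j *\<^sub>C u j"] js(2) by simp
  qed
qed

section \<open>Determinants of finite sections and their limit\<close>

definition section_det :: "(nat \<Rightarrow> 'i) \<Rightarrow> ('i ell2 \<Rightarrow> 'i ell2) \<Rightarrow> nat \<Rightarrow> complex" where
  "section_det e A m = id_plus_det m (\<lambda>i j. entry A (e i) (e j))"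

text \<open>After the swap each section is an \<open>r\<close>-by-\<open>r\<close> determinant whose
  entries are partial sums of the matrix expansion of \<open>\<phi> k (u l)\<close>. Boundedness and
  finite rank give the convergence; summability of all entries does not enter.\<close>

lemma section_det_tendsto_det_one_plus:
  fixes F :: "'i ell2 \<Rightarrow> 'i ell2"
  assumes e: "bij e" and F: "finite_rank F"
  shows "section_det e F \<longlonglongrightarrow> det_one_plus F"
proof -
  obtain r and c :: "nat \<Rightarrow> 'i" and u :: "nat \<Rightarrow> 'i ell2"
    where u: "\<And>l. l < r \<Longrightarrow> u l \<in> range F"
    and rep: "\<And>x. F x = (\<Sum>l<r. ell2_apply (F x) (c l) *\<^sub>C u l)"
    by (rule finite_rank_coordinate_form[OF F]) (rule that)
  define \<phi> where "\<phi> l x = ell2_apply (F x) (c l)" for l x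
  have bF: "bounded_clinear F" using F by (simp add: finite_rank_def)
  have lin: "Vector_Spaces.linear (*\<^sub>C) (*) (\<phi> l)" for l
    using bounded_clinear_linear[OF bF] unfolding Vector_Spaces.linear_iff
    by (auto simp: \<phi>_def plus_ell2.rep_eq scaleC_ell2.rep_eq vector_space_over_itself.vector_space_axioms)
  have det: "det_one_plus F = id_plus_det r (\<lambda>k l. \<phi> k (u l))"
    by (rule det_one_plus_eq[OF F lin]) (use u rep in \<open>auto simp: \<phi>_def\<close>)
  have sec: "section_det e F m = id_plus_det r (\<lambda>k l. \<Sum>i<m. entry F (c k) (e i) * ell2_apply (u l) (e i))" for m
  proof -
    have "entry F (e i) (e j) = (\<Sum>l<r. ell2_apply (u l) (e i) * entry F (c l) (e j))" for i j
      unfolding entry_def by (subst rep) (simp add: ell2_apply_sum scaleC_ell2.rep_eq mult.commute)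
    then show ?thesis unfolding section_det_def by (simp only: id_plus_det_swap)
  qed
  have "(\<lambda>m. id_plus_det r (\<lambda>k l. \<Sum>i<m. entry F (c k) (e i) * ell2_apply (u l) (e i)))
      \<longlonglongrightarrow> id_plus_det r (\<lambda>k l. \<phi> k (u l))"
  proof (rule tendsto_id_plus_det)
    fix k l
    have "((\<lambda>i. entry F (c k) i * ell2_apply (u l) i) has_sum \<phi> k (u l)) (range e)"
      using entry_has_sum[OF bF, of "c k" "u l"] e by (simp add: \<phi>_def bij_is_surj)
    then have "((\<lambda>i. entry F (c k) (e i) * ell2_apply (u l) (e i)) has_sum \<phi> k (u l)) UNIV"
      using e by (subst (asm) has_sum_reindex) (auto simp: bij_is_inj o_def)
    then show "(\<lambda>m. \<Sum>i<m. entry F (c k) (e i) * ell2_apply (u l) (e i)) \<longlonglongrightarrow> \<phi> k (u l)"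
      by (drule_tac has_sum_imp_sums) (simp add: sums_def)
  qed
  then show ?thesis unfolding det sec[abs_def, symmetric] .
qed

lemma section_sum_le_poincare_norm:
  fixes e :: "nat \<Rightarrow> int^'n"
  assumes e: "bij e" and A: "A \<in> poincare_algebra"
  shows "(\<Sum>i<m. \<Sum>j<m. cmod (entry A (e i) (e j))) \<le> poincare_norm A"
proof -
  have "(\<Sum>i<m. \<Sum>j<m. cmod (entry A (e i) (e j))) = (\<Sum>i\<in>e ` {..<m}. \<Sum>j\<in>e ` {..<m}. cmod (entry A i j))"
    using e by (simp add: sum.reindex inj_on_subset[OF bij_is_inj])
  also have "\<dots> \<le> poincare_norm A" by (intro sum_sum_entry_le_poincare_norm[OF A] finite_imageI finite_lessThan)
  finally show ?thesis .
qed

lemma section_det_diff_le: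
  assumes e: "bij e" and A: "A \<in> poincare_algebra" and B: "B \<in> poincare_algebra"
  defines "d \<equiv> poincare_norm (\<lambda>x. B x - A x)"
  shows "cmod (section_det e B m - section_det e A m) \<le> d * exp (poincare_norm A + d)"
proof -
  let ?s = "\<Sum>i<m. \<Sum>j<m. cmod (entry B (e i) (e j) - entry A (e i) (e j))"
  let ?t = "\<Sum>i<m. \<Sum>j<m. cmod (entry A (e i) (e j))"
  have s: "?s \<le> d"
    using section_sum_le_poincare_norm[OF e poincare_algebra_diff[OF B A], of m] by (simp add: entry_diff d_def)
  have "cmod (section_det e B m - section_det e A m) \<le> ?s * exp (?t + ?s)"
    unfolding section_det_def by (rule id_plus_det_diff_le)
  also have "\<dots> \<le> d * exp (poincare_norm A + d)"
    using s section_sum_le_poincare_norm[OF e A, of m]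
    by (intro mult_mono) (auto intro: add_mono sum_nonneg simp: d_def poincare_norm_nonneg)
  finally show ?thesis .
qed

text \<open>The entrywise norms \<open>sq m\<close> of the sections increase and are bounded, hence
  form a Cauchy sequence. After padding to a common size, the determinants differ by at most a
  constant times the increment of \<open>sq\<close>.\<close>

lemma convergent_section_det:
  assumes e: "bij e" and A: "A \<in> poincare_algebra"
  shows "convergent (section_det e A)"
proof -
  define a where "a i j = entry A (e i) (e j)" for i j
  define sq where "sq m = (\<Sum>i<m. \<Sum>j<m. cmod (a i j))" for m
  have sq: "sq m \<le> poincare_norm A" for m
    unfolding sq_def a_def by (rule section_sum_le_poincare_norm[OF e A])
  have sq0: "0 \<le> sq m" for m by (auto simp: sq_def intro!: sum_nonneg)
  have mono: "sq m \<le> sq n" if "m \<le> n" for m n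
  proof -
    have "sq m \<le> (\<Sum>i<m. \<Sum>j<n. cmod (a i j))"
      unfolding sq_def using that by (intro sum_mono sum_mono2) auto
    also have "\<dots> \<le> sq n"
      unfolding sq_def using that by (intro sum_mono2 sum_nonneg) auto
    finally show ?thesis .
  qed
  have diff: "cmod (section_det e A m - section_det e A n) \<le> (sq n - sq m) * exp (2 * poincare_norm A)"
    if mn: "m \<le> n" for m n
  proof -
    let ?a = "\<lambda>i j. if i < m \<and> j < m then a i j else 0"
    have "(\<Sum>i<n. \<Sum>j<n. cmod (?a i j)) = (\<Sum>i<n. \<Sum>j<n. if j < m then (if i < m then cmod (a i j) else 0) else 0)"
      by (intro sum.cong) auto
    also have "\<dots> = (\<Sum>i<n. \<Sum>j<m. if i < m then cmod (a i j) else 0)"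
    proof (rule sum.cong[OF refl])
      show "(\<Sum>j<n. if j < m then (if i < m then cmod (a i j) else 0) else 0) =
          (\<Sum>j<m. if i < m then cmod (a i j) else 0)" for i
        by (rule sum.mono_neutral_cong_right) (use mn in auto)
    qed
    also have "\<dots> = sq m"
      unfolding sq_def by (rule sum.mono_neutral_cong_right) (use mn in auto)
    finally have 1: "(\<Sum>i<n. \<Sum>j<n. cmod (?a i j)) = sq m" .
    \<comment> \<open>Each padded entry either equals the original or is 0, so the modulus of the
      difference is the difference of the moduli.\<close>
    have "(\<Sum>i<n. \<Sum>j<n. cmod (?a i j - a i j)) = (\<Sum>i<n. \<Sum>j<n. cmod (a i j) - cmod (?a i j))"
      by (intro sum.cong) auto
    then have 2: "(\<Sum>i<n. \<Sum>j<n. cmod (?a i j - a i j)) = sq n - sq m"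
      using 1 by (simp add: sum_subtractf sq_def)
    \<comment> \<open>Here \<open>a\<close> is the reference array, with norm \<open>sq n\<close>,
      and the increment is at most \<open>sq n\<close> too; hence the 2 in
      \<open>exp (2 * poincare_norm A)\<close>.\<close>
    have "cmod (section_det e A m - section_det e A n) \<le> (sq n - sq m) * exp (sq n + (sq n - sq m))"
      using id_plus_det_diff_le[of n ?a a]
      unfolding section_det_def a_def[symmetric] id_plus_det_extend[OF mn, of a] 2 sq_def[symmetric] .
    also have "\<dots> \<le> (sq n - sq m) * exp (2 * poincare_norm A)"
      using mono[OF mn] sq[of n] sq0[of m] by (intro mult_left_mono) auto
    finally show ?thesis .
  qed
  have "incseq sq" using mono by (simp add: incseq_def)
  then obtain L where "sq \<longlonglongrightarrow> L" using incseq_convergent[of sq "poincare_norm A"] sq by blast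
  then have "Cauchy sq" by (rule LIMSEQ_imp_Cauchy)
  have "Cauchy (section_det e A)"
  proof (rule CauchyI)
    fix \<epsilon> :: real assume "\<epsilon> > 0"
    then obtain M where M: "\<And>m n. m \<ge> M \<Longrightarrow> n \<ge> M \<Longrightarrow> \<bar>sq m - sq n\<bar> < \<epsilon> / exp (2 * poincare_norm A)"
      using CauchyD[OF \<open>Cauchy sq\<close>, of "\<epsilon> / exp (2 * poincare_norm A)"] by auto
    have le: "cmod (section_det e A m - section_det e A n) < \<epsilon>" if "m \<ge> M" "n \<ge> M" "m \<le> n" for m n
    proof -
      have "sq n - sq m < \<epsilon> / exp (2 * poincare_norm A)" using M[OF that(2,1)] by linarith
      then have "(sq n - sq m) * exp (2 * poincare_norm A) < \<epsilon>" by (simp add: pos_less_divide_eq)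
      then show ?thesis using diff[OF that(3)] by linarith
    qed
    show "\<exists>M. \<forall>m\<ge>M. \<forall>n\<ge>M. cmod (section_det e A m - section_det e A n) < \<epsilon>"
    proof (intro exI[of _ M] allI impI)
      fix m n assume "m \<ge> M" "n \<ge> M"
      then show "cmod (section_det e A m - section_det e A n) < \<epsilon>"
        using le[of m n] le[of n m] by (cases "m \<le> n") (auto simp: norm_minus_commute)
    qed
  qed
  then show ?thesis by (rule Cauchy_convergent)
qed

lemma bij_nat_int_vec: "\<exists>e :: nat \<Rightarrow> int^'n. bij e"
proof -
  have "inj (\<lambda>z :: int. \<chi> i :: 'n. z)" 
    by (rule injI) (metis vec_lambda_beta)
  then have "infinite (UNIV :: (int^'n) set)"
    using infinite_UNIV_int finite_imageD[of "\<lambda>z :: int. \<chi> i :: 'n. z" UNIV] rev_finite_subset by blast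
  then have "bij_betw (from_nat_into (UNIV :: (int^'n) set)) UNIV UNIV"
    by (intro bij_betw_from_nat_into) auto
  then show ?thesis by blast
qed

lemma poincare_det_extension:
  "\<exists>g. is_det_extension (poincare_algebra :: ((int^'n) ell2 \<Rightarrow> (int^'n) ell2) set) poincare_norm g"
proof -
  obtain e :: "nat \<Rightarrow> int^'n" where e: "bij e" using bij_nat_int_vec by blast
  define g where "g A = lim (section_det e A)" for A
  have lim: "section_det e A \<longlonglongrightarrow> g A" if "A \<in> poincare_algebra" for A
    unfolding g_def using convergent_section_det[OF e that] by (simp add: convergent_LIMSEQ_iff)
  have diff: "cmod (g B - g A) \<le> poincare_norm (\<lambda>x. B x - A x) * exp (poincare_norm A + poincare_norm (\<lambda>x. B x - A x))"
    if "A \<in> poincare_algebra" "B \<in> poincare_algebra" for A B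
  proof (rule LIMSEQ_le_const2)
    show "(\<lambda>m. cmod (section_det e B m - section_det e A m)) \<longlonglongrightarrow> cmod (g B - g A)"
      by (intro tendsto_norm tendsto_diff lim that)
    show "\<exists>N. \<forall>m\<ge>N. cmod (section_det e B m - section_det e A m) \<le>
        poincare_norm (\<lambda>x. B x - A x) * exp (poincare_norm A + poincare_norm (\<lambda>x. B x - A x))"
      using section_det_diff_le[OF e that] by blast
  qed
  have "is_det_extension poincare_algebra poincare_norm g"
    unfolding is_det_extension_def
  proof (intro conjI ballI impI allI)
    fix F :: "(int^'n) ell2 \<Rightarrow> (int^'n) ell2"
    assume "F \<in> poincare_algebra" "finite_rank F"
    then show "g F = det_one_plus F"
      using LIMSEQ_unique[OF lim section_det_tendsto_det_one_plus[OF e]] by blast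
  next
    fix A :: "(int^'n) ell2 \<Rightarrow> (int^'n) ell2" and \<epsilon> :: real
    assume A: "A \<in> poincare_algebra" and \<epsilon>: "\<epsilon> > 0"
    \<comment> \<open>The cap 1 bounds the increment inside the exponent; the other term then makes
      the linear factor small.\<close>
    define d where "d = min 1 (\<epsilon> / exp (poincare_norm A + 1))"
    have "cmod (g B - g A) < \<epsilon>" if B: "B \<in> poincare_algebra" and s: "poincare_norm (\<lambda>x. B x - A x) < d" for B
    proof -
      let ?s = "poincare_norm (\<lambda>x. B x - A x)"
      have "cmod (g B - g A) \<le> ?s * exp (poincare_norm A + ?s)" by (rule diff[OF A B])
      also have "\<dots> \<le> ?s * exp (poincare_norm A + 1)"
        using s by (intro mult_left_mono) (auto simp: d_def poincare_norm_nonneg)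
      also have "\<dots> < \<epsilon>" using s by (simp add: d_def pos_less_divide_eq)
      finally show ?thesis .
    qed
    moreover have "d > 0" using \<epsilon> by (simp add: d_def)
    ultimately show "\<exists>d>0. \<forall>B\<in>poincare_algebra. poincare_norm (\<lambda>x. B x - A x) < d \<longrightarrow> cmod (g B - g A) < \<epsilon>"
      by blast
  qed
  then show ?thesis by blast
qed

section \<open>The Fourier transform on the torus\<close>

lemma fourier_kernel_add: "fourier_kernel k t * fourier_kernel l t = fourier_kernel (k + l) t"
  by transfer (simp add: lattice_dot_def sum.distrib algebra_simps flip: exp_add)

lemma fourier_kernel_zero: "fourier_kernel 0 t = 1"
  by transfer (simp add: lattice_dot_def)

lemma cnj_fourier_kernel: "cnj (fourier_kernel k t) = fourier_kernel (- k) t"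
  by transfer (simp add: lattice_dot_def sum_negf exp_cnj)

lemma norm_fourier_kernel [simp]: "cmod (fourier_kernel k t) = 1"
  by transfer simp

text \<open>The universal property of the quotient topology.\<close>

lemma continuous_on_torusI:
  fixes f :: "'n::finite torus \<Rightarrow> 'b::topological_space"
  assumes "continuous_on UNIV (\<lambda>x. f (abs_torus x))"
  shows "continuous_on UNIV f"
proof (rule continuous_on_open_vimage[THEN iffD2, rule_format])
  fix B :: "'b set" assume "open B"
  then have "open ((\<lambda>x. f (abs_torus x)) -` B)" using assms by (simp add: continuous_on_open_vimage)
  then show "open (f -` B \<inter> UNIV)" by (simp add: open_torus_def vimage_def)
qed simp

lemma continuous_abs_torus: "continuous_on UNIV (abs_torus :: real^'n::finite \<Rightarrow> 'n torus)"
  by (rule continuous_on_open_vimage[THEN iffD2, rule_format]) (auto simp: open_torus_def)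

lemma continuous_fourier_kernel_abs: "continuous_on UNIV (\<lambda>x. fourier_kernel k (abs_torus x))"
  unfolding fourier_kernel.abs_eq lattice_dot_def by (intro continuous_intros)

section \<open>Integrals of the characters over the torus\<close>

lemma integral_unit_interval_exp:
  fixes m :: int
  shows "(\<integral>x. indicator {0..<1} x *\<^sub>R exp (- 2 * complex_of_real pi * \<i> * complex_of_real (x * of_int m)) \<partial>lborel)
    = of_bool (m = 0)"
    and "integrable lborel (\<lambda>x. indicator {0..<1} x *\<^sub>R exp (- 2 * complex_of_real pi * \<i> * complex_of_real (x * of_int m)))"
proof -
  let ?f = "\<lambda>x. exp (- 2 * complex_of_real pi * \<i> * complex_of_real (x * of_int m))"
  let ?c = "- 2 * complex_of_real pi * \<i> * of_int m"
  define F where "F x = (if m = 0 then x *\<^sub>R 1 else exp (complex_of_real x * ?c) / ?c)" for x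
  have cont: "continuous_on {0..1} ?f" by (intro continuous_intros)
  have "has_bochner_integral lborel (\<lambda>x. indicator {0..1} x *\<^sub>R ?f x) (F 1 - F 0)"
  proof (rule has_bochner_integral_FTC_Icc[OF _ _ cont])
    fix x :: real
    show "(F has_vector_derivative ?f x) (at x within {0..1})"
    proof (cases "m = 0")
      case True
      then show ?thesis unfolding F_def by (auto intro!: derivative_eq_intros simp: has_vector_derivative_def)
    next
      case False
      have "((\<lambda>z. exp (z * ?c) / ?c) has_field_derivative exp (of_real x * ?c)) (at (of_real x))"
        using False by (auto intro!: derivative_eq_intros)
      from has_vector_derivative_real_field[OF this]
      show ?thesis using False by (simp add: F_def[abs_def] mult_ac)
    qed
  qed simp
  moreover have "F 1 - F 0 = of_bool (m = 0)"
  proof (cases "m = 0")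
    case False
    have "exp ?c = 1"
      unfolding exp_eq_1 by (auto intro!: exI[of _ "- m"])
    then show ?thesis using False by (simp add: F_def)
  qed (simp add: F_def)
  ultimately have I: "has_bochner_integral lborel (\<lambda>x. indicator {0..1} x *\<^sub>R ?f x) (of_bool (m = 0))"
    by simp
  \<comment> \<open>The fundamental theorem of calculus is applied on the closed interval, whereas
    the fundamental domain is half-open; the point 1 is a null set.\<close>
  have "AE x in lborel. indicator {0..1} x *\<^sub>R ?f x = indicator {0..<1} x *\<^sub>R ?f x"
    using AE_lborel_singleton[of 1] by eventually_elim (auto simp: indicator_def)
  then have "has_bochner_integral lborel (\<lambda>x. indicator {0..<1} x *\<^sub>R ?f x) (of_bool (m = 0))"
    using I by (subst (asm) has_bochner_integral_cong_AE) auto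
  then show "(\<integral>x. indicator {0..<1} x *\<^sub>R ?f x \<partial>lborel) = of_bool (m = 0)"
    "integrable lborel (\<lambda>x. indicator {0..<1} x *\<^sub>R ?f x)"
    by (auto simp: has_bochner_integral_iff)
qed

lemma sets_unit_cube [measurable]: "{x :: real^'n::finite. \<forall>i. 0 \<le> x $ i \<and> x $ i < 1} \<in> sets borel"
  by measurable

lemma integral_torus:
  fixes f :: "'n::finite torus \<Rightarrow> complex"
  assumes [measurable]: "f \<in> borel_measurable borel"
  shows "(\<integral>t. f t \<partial>torus_measure) =
    (\<integral>x. indicator {x :: real^'n. \<forall>i. 0 \<le> x $ i \<and> x $ i < 1} x *\<^sub>R f (abs_torus x) \<partial>lborel)"
proof -
  have [measurable]: "abs_torus \<in> borel_measurable (borel :: (real^'n) measure)"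
    by (intro borel_measurable_continuous_onI continuous_abs_torus)
  show ?thesis
    unfolding torus_measure_def
    by (subst integral_distr) (auto simp: integral_restrict_space intro: measurable_restrict_space1)
qed

lemma integral_fourier_kernel:
  fixes k :: "int^'n::finite"
  shows "(\<integral>t. fourier_kernel k t \<partial>torus_measure) = of_bool (k = 0)"
proof -
  \<comment> \<open>Lebesgue measure is unfolded as a product over basis vectors;
    \<open>axis_index\<close> recovers the coordinate that a basis vector stands for.\<close>
  define h :: "real^'n \<Rightarrow> real \<Rightarrow> complex" where "h b x = indicator {0..<1} x *\<^sub>R
    exp (- 2 * complex_of_real pi * \<i> * complex_of_real (x * of_int (k $ axis_index b)))" for b x
  have Basis: "(Basis :: (real^'n) set) = (\<lambda>i. axis i 1) ` UNIV" by (auto simp: Basis_vec_def)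
  have inj: "inj_on (\<lambda>i. axis i (1::real) :: real^'n) UNIV" by (rule injI) (simp add: axis_eq_axis)
  have prod: "indicator {x :: real^'n. \<forall>i. 0 \<le> x $ i \<and> x $ i < 1} x *\<^sub>R fourier_kernel k (abs_torus x) =
      (\<Prod>b\<in>Basis. h b (x \<bullet> b))" for x :: "real^'n"
  proof -
    have "(\<Prod>b\<in>Basis. h b (x \<bullet> b)) = (\<Prod>i\<in>UNIV. h (axis i 1) (x $ i))"
      unfolding Basis by (simp add: prod.reindex[OF inj] inner_axis)
    also have "\<dots> = (\<Prod>i\<in>UNIV. of_real (indicator {0..<1} (x $ i))) *
        (\<Prod>i\<in>UNIV. exp (- 2 * complex_of_real pi * \<i> * complex_of_real (x $ i * of_int (k $ i))))"
      by (simp add: h_def scaleR_conv_of_real prod.distrib)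
    also have "(\<Prod>i\<in>UNIV. complex_of_real (indicator {0..<1} (x $ i))) =
        of_real (indicator {x :: real^'n. \<forall>i. 0 \<le> x $ i \<and> x $ i < 1} x)"
    proof (cases "\<forall>i. 0 \<le> x $ i \<and> x $ i < 1")
      case False
      then obtain i where "indicator {0..<1} (x $ i) = (0::real)" by (auto simp: indicator_def)
      then show ?thesis using False by (intro trans[OF prod_zero]) (auto intro!: bexI[of _ i])
    qed simp
    also have "(\<Prod>i\<in>UNIV. exp (- 2 * complex_of_real pi * \<i> * complex_of_real (x $ i * of_int (k $ i)))) =
        fourier_kernel k (abs_torus x)"
      by (simp add: fourier_kernel.abs_eq lattice_dot_def sum_distrib_left flip: exp_sum)
    finally show ?thesis by (simp add: scaleR_conv_of_real)
  qed
  interpret product_sigma_finite "\<lambda>b :: real^'n. lborel :: real measure" by standard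
  have "(\<integral>t. fourier_kernel k t \<partial>torus_measure) = (\<integral>x. (\<Prod>b\<in>Basis. h b (x \<bullet> b)) \<partial>lborel)"
    by (subst integral_torus) (use fourier_kernel_measurable[of k] in \<open>simp_all add: prod cong: measurable_cong_sets\<close>)
  also have "\<dots> = (\<integral>f. (\<Prod>b\<in>Basis. h b ((\<Sum>b\<in>Basis. f b *\<^sub>R b) \<bullet> b)) \<partial>Pi\<^sub>M Basis (\<lambda>_. lborel))"
    by (subst lborel_eq, subst integral_distr) (auto simp: h_def)
  also have "\<dots> = (\<integral>f. (\<Prod>b\<in>Basis. h b (f b)) \<partial>Pi\<^sub>M Basis (\<lambda>_. lborel))"
    by (simp cong: prod.cong)
  also have "\<dots> = (\<Prod>b\<in>Basis. \<integral>x. h b x \<partial>lborel)"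
    unfolding h_def by (intro product_integral_prod finite_Basis integral_unit_interval_exp(2))
  also have "\<dots> = (\<Prod>i\<in>UNIV. of_bool (k $ i = 0))"
    unfolding Basis h_def integral_unit_interval_exp(1) by (simp add: prod.reindex[OF inj])
  also have "\<dots> = of_bool (k = 0)"
  proof (cases "k = 0")
    case False
    then obtain i where "k $ i \<noteq> 0" by (auto simp: Finite_Cartesian_Product.vec_eq_iff)
    then show ?thesis using False by (intro trans[OF prod_zero]) (auto intro!: bexI[of _ i])
  qed simp
  finally show ?thesis .
qed

lemma space_torus_measure [simp]: "space torus_measure = UNIV"
  by (simp add: torus_measure_def)

text \<open>\<open>measure\<close> gives 0 to a set of infinite mass, so the value 1, read off from
  the zero frequency, excludes that case.\<close>

lemma finite_measure_torus: "finite_measure (torus_measure :: 'n::finite torus measure)"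
proof
  have "measure (torus_measure :: 'n torus measure) UNIV = 1"
    using integral_fourier_kernel[of "0 :: int^'n"] by (simp add: fourier_kernel_zero scaleR_conv_of_real)
  then show "emeasure (torus_measure :: 'n torus measure) (space torus_measure) \<noteq> \<infinity>"
    by (auto simp: measure_def)
qed

lemma square_integrable_imp_integrable:
  assumes "square_integrable (torus_measure :: 'n::finite torus measure) f"
  shows "integrable torus_measure f"
proof -
  interpret finite_measure "torus_measure :: 'n torus measure" by (rule finite_measure_torus)
  have [measurable]: "f \<in> borel_measurable torus_measure" using assms by (simp add: square_integrable_def)
  have "integrable torus_measure (\<lambda>x. 1 + (cmod (f x))\<^sup>2)"
    using assms by (auto simp: square_integrable_def)
  then show ?thesis
  proof (rule Bochner_Integration.integrable_bound)
    show "AE x in torus_measure. cmod (f x) \<le> norm (1 + (cmod (f x))\<^sup>2)"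
    proof (rule AE_I2)
      fix x
      have "0 \<le> (cmod (f x) - 1)\<^sup>2" by simp
      then show "cmod (f x) \<le> norm (1 + (cmod (f x))\<^sup>2)"
        unfolding power2_eq_square by (simp add: algebra_simps) (smt (verit) norm_ge_zero)
    qed
  qed measurable
qed

lemma integrable_bounded_mult:
  fixes f g :: "'n::finite torus \<Rightarrow> complex"
  assumes "integrable torus_measure f" "g \<in> borel_measurable torus_measure" "\<And>x. cmod (g x) \<le> C"
  shows "integrable torus_measure (\<lambda>x. g x * f x)"
proof (rule Bochner_Integration.integrable_bound)
  show "integrable torus_measure (\<lambda>x. C * cmod (f x))" using assms(1) by auto
  have [measurable]: "f \<in> borel_measurable torus_measure" "g \<in> borel_measurable torus_measure"
    using assms by auto
  show "(\<lambda>x. g x * f x) \<in> borel_measurable torus_measure" by measurable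
  show "AE x in torus_measure. cmod (g x * f x) \<le> norm (C * cmod (f x))"
  proof (rule AE_I2)
    fix x
    have "cmod (g x * f x) \<le> C * cmod (f x)" using assms(3)[of x] by (simp add: norm_mult mult_right_mono)
    then show "cmod (g x * f x) \<le> norm (C * cmod (f x))" by simp
  qed
qed

text \<open>Completeness of the characters: embedding the torus into $\mathbb{C}^n$ makes trigonometric
  polynomials out of real polynomials, so Stone--Weierstrass applies there and no topology on the torus
  beyond the quotient topology is needed.\<close>

inductive trig_poly :: "('n::finite torus \<Rightarrow> complex) \<Rightarrow> bool" where
  monomial: "trig_poly (\<lambda>t. c * fourier_kernel k t)"
| add: "trig_poly f \<Longrightarrow> trig_poly g \<Longrightarrow> trig_poly (\<lambda>t. f t + g t)"

lemma trig_poly_const: "trig_poly (\<lambda>t. c)"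
  using trig_poly.monomial[of c 0] by (simp add: fourier_kernel_zero)

lemma trig_poly_mult: "trig_poly f \<Longrightarrow> trig_poly g \<Longrightarrow> trig_poly (\<lambda>t. f t * g t)"
proof (induction f rule: trig_poly.induct)
  case (monomial c k)
  then show ?case
  proof (induction g rule: trig_poly.induct)
    case (monomial d l)
    have "(\<lambda>t. c * fourier_kernel k t * (d * fourier_kernel l t)) =
        (\<lambda>t. (c * d) * fourier_kernel (k + l) t)"
      by (simp only: fourier_kernel_add[symmetric] mult_ac)
    then show ?case by (simp only: trig_poly.monomial)
  next
    case (add f g)
    then show ?case by (simp add: distrib_left trig_poly.add)
  qed
qed (simp add: distrib_right trig_poly.add)

lemma trig_poly_sum: "(\<And>s. s \<in> S \<Longrightarrow> trig_poly (f s)) \<Longrightarrow> trig_poly (\<lambda>t. \<Sum>s\<in>S. f s t)"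
  by (induction S rule: infinite_finite_induct) (auto intro: trig_poly_const trig_poly.add)

definition torus_embed :: "'n::finite torus \<Rightarrow> complex^'n" where
  "torus_embed t = (\<chi> j. fourier_kernel (axis j 1) t)"

lemma lattice_dot_axis: "lattice_dot x (axis j 1) = x $ j"
  by (simp add: lattice_dot_def axis_def if_distrib cong: if_cong)

lemma continuous_torus_embed_abs: "continuous_on UNIV (\<lambda>x. torus_embed (abs_torus x))"
  unfolding torus_embed_def
  by (intro continuous_on_vec_lambda continuous_fourier_kernel_abs)

lemma continuous_torus_embed: "continuous_on UNIV torus_embed"
  by (rule continuous_on_torusI continuous_torus_embed_abs)+

lemma torus_embed_measurable [measurable]: "torus_embed \<in> borel_measurable borel"
  by (intro borel_measurable_continuous_onI continuous_torus_embed)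

lemma abs_torus_surj: "\<exists>x. t = abs_torus x"
  by (induction t rule: torus.abs_induct) auto

lemma inj_torus_embed: "inj (torus_embed :: 'n::finite torus \<Rightarrow> _)"
proof (rule injI)
  fix s t :: "'n torus" assume eq: "torus_embed s = torus_embed t"
  obtain x where s: "s = abs_torus x" using abs_torus_surj by blast
  obtain y where t: "t = abs_torus y" using abs_torus_surj by blast
  have "x $ j - y $ j \<in> \<int>" for j
  proof -
    have "fourier_kernel (axis j 1) s = fourier_kernel (axis j 1) t"
      using eq by (simp add: torus_embed_def Finite_Cartesian_Product.vec_eq_iff)
    then obtain m :: int where
      "- 2 * complex_of_real pi * \<i> * complex_of_real (x $ j) =
       - 2 * complex_of_real pi * \<i> * complex_of_real (y $ j) + complex_of_real (real_of_int (2 * m) * pi) * \<i>"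
      unfolding s t fourier_kernel.abs_eq lattice_dot_axis exp_eq by blast
    then have "Im (- 2 * complex_of_real pi * \<i> * complex_of_real (x $ j)) =
       Im (- 2 * complex_of_real pi * \<i> * complex_of_real (y $ j) + complex_of_real (real_of_int (2 * m) * pi) * \<i>)"
      by (rule arg_cong)
    then have "pi * (x $ j - y $ j) = pi * (- of_int m)" by (simp add: algebra_simps)
    then have "x $ j - y $ j = of_int (- m)" unfolding mult_cancel_left by auto
    then show ?thesis by (metis Ints_of_int)
  qed
  then show "s = t" unfolding s t by (simp add: torus.abs_eq_iff)
qed

text \<open>Fractional parts provide representatives in the compact unit cube. The whole torus is
  needed for Stone-Weierstrass, complements of open sets for distance functions.\<close>

lemma compact_torus_embed_image:
  assumes "closed K"
  shows "compact (torus_embed ` K)"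
proof -
  have "torus_embed ` K = (\<lambda>x. torus_embed (abs_torus x)) ` (cbox 0 1 \<inter> abs_torus -` K)"
  proof (intro equalityI subsetI)
    fix z assume "z \<in> torus_embed ` K"
    then obtain t where t: "t \<in> K" "z = torus_embed t" by blast
    obtain x where x: "t = abs_torus x" using abs_torus_surj by blast
    define y where "y = (\<chi> j. frac (x $ j))"
    have "x $ j - y $ j \<in> \<int>" for j by (simp add: y_def frac_def)
    then have "abs_torus x = abs_torus y" by (simp add: torus.abs_eq_iff)
    moreover have "y \<in> cbox 0 1"
      by (auto simp: y_def mem_box_cart frac_ge_0 less_imp_le[OF frac_lt_1])
    ultimately show "z \<in> (\<lambda>x. torus_embed (abs_torus x)) ` (cbox 0 1 \<inter> abs_torus -` K)"
      using t x by (intro image_eqI[of _ _ y]) auto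
  qed auto
  moreover have "closed (abs_torus -` K)"
    using assms unfolding closed_def by (simp add: open_torus_def vimage_Compl)
  then have "compact (cbox 0 1 \<inter> abs_torus -` K)" by (intro compact_Int_closed compact_cbox)
  ultimately show ?thesis
    using continuous_on_subset[OF continuous_torus_embed_abs] by (auto intro!: compact_continuous_image)
qed

text \<open>Real and imaginary parts of the coordinates combine the characters of frequency
  \<open>axis j 1\<close> and its negative, and trigonometric polynomials are closed under
  products.\<close>

lemma trig_poly_real_polynomial:
  assumes "real_polynomial_function p"
  shows "trig_poly (\<lambda>t. of_real (p (torus_embed t)))"
  using assms
proof (induction p rule: real_polynomial_function.induct)
  case (linear p)
  have coord: "trig_poly (\<lambda>t. complex_of_real (torus_embed t \<bullet> b))" if "b \<in> Basis" for b :: "complex^'a"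
  proof -
    have "\<exists>j u. b = axis j u \<and> (u = 1 \<or> u = \<i>)"
      using that by (auto simp: Basis_vec_def Basis_complex_def)
    then obtain j u where b: "b = axis j u" "u = 1 \<or> u = \<i>" by blast
    let ?k = "axis j 1 :: int^'a"
    have "complex_of_real (Re z) = 1/2 * z + 1/2 * cnj z" "complex_of_real (Im z) = - \<i>/2 * z + \<i>/2 * cnj z" for z
      by (simp_all add: complex_eq_iff)
    then have "complex_of_real (torus_embed t \<bullet> b) =
        (if u = 1 then 1/2 else - \<i>/2) * fourier_kernel ?k t + (if u = 1 then 1/2 else \<i>/2) * fourier_kernel (- ?k) t" for t
      using b by (auto simp: inner_axis torus_embed_def cnj_fourier_kernel)
    then show ?thesis by (simp only:) (intro trig_poly.intros)
  qed
  have p: "p z = (\<Sum>b\<in>Basis. (z \<bullet> b) * p b)" for z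
    using linear
    by (subst euclidean_representation[of z, symmetric])
      (simp add: linear_sum linear_scale bounded_linear.linear)
  have "(\<lambda>t. complex_of_real (p (torus_embed t))) =
      (\<lambda>t. \<Sum>b\<in>Basis. of_real (torus_embed t \<bullet> b) * of_real (p b))"
    by (rule ext, subst p) simp
  then show ?case by (auto intro!: trig_poly_sum trig_poly_mult trig_poly_const coord)
qed (auto intro: trig_poly_const trig_poly.add trig_poly_mult)

section \<open>Uniqueness: an integrable function whose Fourier coefficients all vanish is zero
  almost everywhere\<close>

context
  fixes f :: "'n::finite torus \<Rightarrow> complex"
  assumes f: "integrable torus_measure f"
    and orth: "\<And>k. (\<integral>t. fourier_kernel k t * f t \<partial>torus_measure) = 0"
begin

lemma integrand_measurable [measurable]: "f \<in> borel_measurable torus_measure"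
  using f by auto

lemma integral_trig_poly_eq_zero:
  "trig_poly g \<Longrightarrow> integrable torus_measure (\<lambda>t. g t * f t) \<and> (\<integral>t. g t * f t \<partial>torus_measure) = 0"
proof (induction rule: trig_poly.induct)
  case (monomial c k)
  have "integrable torus_measure (\<lambda>t. c * (fourier_kernel k t * f t))"
    by (intro integrable_mult_right integrable_bounded_mult[OF f, of _ 1]) auto
  then show ?case using orth[of k] by (simp add: mult.assoc)
qed (simp add: distrib_right)

text \<open>A polynomial uniformly \<open>e\<close>-close to \<open>g\<close> on the compact image
  integrates to 0 against \<open>f\<close>, which leaves an error of at most \<open>e\<close> times
  the 1-norm \<open>C\<close> of \<open>f\<close>.\<close>

lemma integral_continuous_eq_zero:
  assumes g: "continuous_on UNIV g"
  shows "(\<integral>t. of_real (g (torus_embed t)) * f t \<partial>torus_measure) = 0"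
proof -
  let ?I = "\<integral>t. of_real (g (torus_embed t)) * f t \<partial>torus_measure"
  define C where "C = (\<integral>t. cmod (f t) \<partial>torus_measure)"
  have C: "0 \<le> C" unfolding C_def by simp
  have cpt: "compact (range torus_embed :: (complex^'n) set)" by (rule compact_torus_embed_image) simp
  have [measurable]: "g \<in> borel_measurable borel" by (rule borel_measurable_continuous_onI[OF g])
  have gS: "continuous_on (range torus_embed) g" using g continuous_on_subset by blast
  have "cmod ?I \<le> e * C" if e: "e > 0" for e :: real
  proof -
    obtain p where p: "real_polynomial_function p" "\<And>z. z \<in> range torus_embed \<Longrightarrow> \<bar>g z - p z\<bar> < e"
      using Stone_Weierstrass_real_polynomial_function[OF cpt gS e] by blast
    let ?d = "\<lambda>t. complex_of_real (g (torus_embed t) - p (torus_embed t))"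
    note P = integral_trig_poly_eq_zero[OF trig_poly_real_polynomial[OF p(1)]]
    have [measurable]: "p \<in> borel_measurable borel"
      by (intro borel_measurable_continuous_onI continuous_real_polymonial_function[OF p(1)]
          continuous_at_imp_continuous_on) (simp add: continuous_real_polymonial_function[OF p(1)])
    have d: "cmod (?d t) \<le> e" for t using p(2)[of "torus_embed t"]
      by (simp del: of_real_diff)
    have id: "integrable torus_measure (\<lambda>t. ?d t * f t)"
      by (rule integrable_bounded_mult[OF f _ d]) measurable
    have "?I = (\<integral>t. ?d t * f t + of_real (p (torus_embed t)) * f t \<partial>torus_measure)"
      by (simp add: algebra_simps)
    also have "\<dots> = (\<integral>t. ?d t * f t \<partial>torus_measure)"
      using P id by (subst Bochner_Integration.integral_add) auto
    finally have "cmod ?I = cmod (\<integral>t. ?d t * f t \<partial>torus_measure)" by simp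
    also have "\<dots> \<le> (\<integral>t. cmod (?d t * f t) \<partial>torus_measure)" by simp
    also have "\<dots> \<le> (\<integral>t. e * cmod (f t) \<partial>torus_measure)"
    proof (rule integral_mono)
      show "integrable torus_measure (\<lambda>t. cmod (?d t * f t))" using id by (rule integrable_norm)
      show "cmod (?d t * f t) \<le> e * cmod (f t)" for t
        unfolding norm_mult by (intro mult_right_mono d) simp
    qed (use f in simp)
    finally show ?thesis by (simp add: C_def)
  qed
  then have "cmod ?I \<le> 0 + e" if "e > 0" for e :: real
    using that C by (cases "C = 0") (force, smt (verit) divide_pos_pos nonzero_eq_divide_eq)
  then have "cmod ?I \<le> 0" by (rule field_le_epsilon)
  then show ?thesis by simp
qed

text \<open>The indicator of \<open>U\<close> is the pointwise limit of the truncated distances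
  \<open>g m\<close> to the embedded complement; dominated convergence with bound
  \<open>cmod (f t)\<close> passes to it.\<close>

lemma integral_open_eq_zero:
  assumes U: "open U"
  shows "(\<integral>t. of_real (indicator U t) * f t \<partial>torus_measure) = 0"
\<comment> \<open>For \<open>U = UNIV\<close> the set \<open>K\<close> would be empty, where
  \<open>infdist\<close> defaults to 0 and \<open>g m\<close> would vanish; frequency 0 covers this
  case.\<close>
proof (cases "U = UNIV")
  case True
  then show ?thesis using orth[of 0] by (simp add: fourier_kernel_zero)
next
  case False
  define K where "K = torus_embed ` (- U)"
  have K: "closed K" "K \<noteq> {}"
    using False U by (auto simp: K_def intro!: compact_imp_closed compact_torus_embed_image)
  have mem: "torus_embed t \<in> K \<longleftrightarrow> t \<notin> U" for t
    by (auto simp: K_def inj_eq[OF inj_torus_embed])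
  have [measurable]: "U \<in> sets torus_measure" using U by simp
  define g where "g m z = min 1 (real m * infdist z K)" for m z
  have cg: "continuous_on UNIV (g m)" for m
    unfolding g_def by (intro continuous_intros)
  have [measurable]: "g m \<in> borel_measurable borel" for m by (rule borel_measurable_continuous_onI[OF cg])
  have lim: "(\<lambda>m. complex_of_real (g m (torus_embed t)) * f t) \<longlonglongrightarrow> of_real (indicator U t) * f t" for t
  proof (intro tendsto_mult tendsto_of_real tendsto_const)
    show "(\<lambda>m. g m (torus_embed t)) \<longlonglongrightarrow> indicator U t"
    proof (cases "t \<in> U")
      case True
      then have "infdist (torus_embed t) K > 0"
        using K mem[of t] infdist_pos_not_in_closed by blast
      then obtain N where N: "1 < real N * infdist (torus_embed t) K" using reals_Archimedean3 by blast
      have "g m (torus_embed t) = 1" if "m \<ge> N" for m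
      proof -
        have "real N * infdist (torus_embed t) K \<le> real m * infdist (torus_embed t) K"
          using that by (intro mult_right_mono) (auto simp: infdist_nonneg)
        then show ?thesis using N by (simp add: g_def)
      qed
      then have "eventually (\<lambda>m. g m (torus_embed t) = 1) sequentially"
        by (auto simp: eventually_sequentially)
      then show ?thesis using True by (simp add: tendsto_eventually)
    next
      case False
      then show ?thesis using mem[of t] by (simp add: g_def)
    qed
  qed
  have "(\<lambda>m. \<integral>t. complex_of_real (g m (torus_embed t)) * f t \<partial>torus_measure) \<longlonglongrightarrow>
      (\<integral>t. of_real (indicator U t) * f t \<partial>torus_measure)"
  proof (rule integral_dominated_convergence)
    show "integrable torus_measure (\<lambda>t. cmod (f t))" using f by simp
    show "AE t in torus_measure. cmod (complex_of_real (g m (torus_embed t)) * f t) \<le> cmod (f t)" for m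
    proof (rule AE_I2)
      fix t
      have "0 \<le> g m (torus_embed t)" "g m (torus_embed t) \<le> 1" by (auto simp: g_def infdist_nonneg)
      then show "cmod (complex_of_real (g m (torus_embed t)) * f t) \<le> cmod (f t)"
        by (simp add: norm_mult mult_left_le_one_le)
    qed
  qed (use lim in auto)
  then show ?thesis
    by (simp add: integral_continuous_eq_zero[OF cg] LIMSEQ_const_iff)
qed

text \<open>Dynkin's argument from the intersection-stable generator of open sets; the complement
  step uses frequency 0.\<close>

lemma integral_borel_eq_zero:
  assumes "A \<in> sets torus_measure"
  shows "(\<integral>t. of_real (indicator A t) * f t \<partial>torus_measure) = 0"
proof -
  have int: "integrable torus_measure (\<lambda>t. of_real (indicator A t) * f t)" if "A \<in> sets borel" for A
    by (rule integrable_bounded_mult[OF f, of _ 1]) (use that in \<open>auto simp: indicator_def\<close>)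
  have "Int_stable {U :: 'n torus set. open U}" "{U :: 'n torus set. open U} \<subseteq> Pow UNIV"
    "A \<in> sigma_sets UNIV {U. open U}"
    using assms by (auto simp: sets_borel Int_stable_def)
  then show ?thesis
  proof (induction rule: sigma_sets_induct_disjoint)
    case (basic A)
    then show ?case by (simp add: integral_open_eq_zero)
  next
    case (compl A)
    have "(\<integral>t. of_real (indicator (UNIV - A) t) * f t \<partial>torus_measure) =
        (\<integral>t. f t - of_real (indicator A t) * f t \<partial>torus_measure)"
      by (intro Bochner_Integration.integral_cong) (auto simp: indicator_def)
    also have "\<dots> = (\<integral>t. f t \<partial>torus_measure) - 0"
      using compl int[of A] f by (subst Bochner_Integration.integral_diff) (auto simp: sets_borel)
    also have "\<dots> = 0" using orth[of 0] by (simp add: fourier_kernel_zero)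
    finally show ?case .
  next
    case (union A)
    have A: "A i \<in> sets borel" for i using union by (auto simp: sets_borel)
    have "(LINT t:(\<Union>i. A i)|torus_measure. f t) = (\<Sum>i. (LINT t:(A i)|torus_measure. f t))"
    proof (rule lebesgue_integral_countable_add)
      show "A i \<inter> A j = {}" if "i \<noteq> j" for i j
        using union that by (auto simp: disjoint_family_on_def)
      show "set_integrable torus_measure (\<Union>i. A i) f"
        using int[of "\<Union>i. A i"] A by (simp add: set_integrable_def scaleR_conv_of_real)
    qed (use A in auto)
    then show ?case using union by (simp add: set_lebesgue_integral_def scaleR_conv_of_real)
  qed auto
qed

lemma AE_eq_zero_of_orthogonal: "AE t in torus_measure. f t = 0"
proof -
  have 1: "integrable torus_measure (\<lambda>t. of_real (indicator A t) * f t)" if "A \<in> sets torus_measure" for A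
    by (rule integrable_bounded_mult[OF f, of _ 1]) (use that in \<open>auto simp: indicator_def\<close>)
  \<comment> \<open>Real and imaginary part are each compared with the density 0, as
    \<open>density_unique_real\<close> concerns real densities.\<close>
  have "AE t in torus_measure. Re (f t) = 0"
  proof (rule density_unique_real)
    fix A :: "'n torus set" assume A: "A \<in> sets torus_measure"
    have "(\<integral>t. Re (of_real (indicator A t) * f t) \<partial>torus_measure) = 0"
      using integral_borel_eq_zero[OF A] by (simp add: integral_Re[OF 1[OF A]] del: times_complex.sel)
    then show "(LINT t:A|torus_measure. Re (f t)) = (LINT t:A|torus_measure. 0)"
      by (simp add: set_lebesgue_integral_def)
  qed (use f in auto)
  moreover have "AE t in torus_measure. Im (f t) = 0"
  proof (rule density_unique_real)
    fix A :: "'n torus set" assume A: "A \<in> sets torus_measure"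
    have "(\<integral>t. Im (of_real (indicator A t) * f t) \<partial>torus_measure) = 0"
      using integral_borel_eq_zero[OF A] by (simp add: integral_Im[OF 1[OF A]] del: times_complex.sel)
    then show "(LINT t:A|torus_measure. Im (f t)) = (LINT t:A|torus_measure. 0)"
      by (simp add: set_lebesgue_integral_def)
  qed (use f in auto)
  ultimately show ?thesis by eventually_elim (simp add: complex_eq_iff)
qed

end

section \<open>Bessel, Riesz-Fischer and Plancherel\<close>

lemma square_integrable_fourier_kernel: "square_integrable torus_measure (fourier_kernel k)"
  using finite_measure.integrable_const[OF finite_measure_torus, of "1::real"]
  by (simp add: square_integrable_def)

text \<open>The kernel itself carries the minus sign, so this is the class of
  \<open>exp(2 pi i k.x)\<close>, the vector whose transform is \<open>ell2_unit k\<close>.\<close>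

lift_definition torus_unit :: "int^'n::finite \<Rightarrow> 'n l2_torus" is "\<lambda>k. fourier_kernel (- k)"
  by (simp add: square_integrable_fourier_kernel)

lemma integrable_kernel_mult:
  "square_integrable torus_measure f \<Longrightarrow> integrable torus_measure (\<lambda>t. fourier_kernel k t * f t)"
  by (rule integrable_bounded_mult[where C = 1]) (auto intro: square_integrable_imp_integrable)

lemma fourier_coeff_add: "fourier_coeff (f + g) k = fourier_coeff f k + fourier_coeff g k"
  by transfer (simp add: distrib_left integrable_kernel_mult)

lemma fourier_coeff_scaleC: "fourier_coeff (c *\<^sub>C f) k = c * fourier_coeff f k"
  by transfer (simp add: mult.left_commute)

lemma fourier_coeff_torus_unit: "fourier_coeff (torus_unit k) l = of_bool (l = k)"
  by transfer (simp add: fourier_kernel_add integral_fourier_kernel)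

text \<open>The inner product is only the real part of the Hermitian one; the scalar
  \<open>c\<close> gives access to the full complex coefficient.\<close>

lemma inner_torus_unit: "f \<bullet> (c *\<^sub>C torus_unit k) = Re (cnj c * fourier_coeff f k)"
proof (transfer, goal_cases)
  case (1 f c k)
  then have int: "integrable torus_measure (\<lambda>t. cnj c * (fourier_kernel k t * f t))"
    using integrable_kernel_mult[of f k] by simp
  have "f t \<bullet> (c * fourier_kernel (- k) t) = Re (cnj c * (fourier_kernel k t * f t))" for t
    by (simp add: inner_complex_def algebra_simps flip: cnj_fourier_kernel)
  then show ?case using integral_Re[OF int] by (simp del: times_complex.sel)
qed

lemma fourier_coeff_eq_zero:
  assumes "fourier_coeff f = (\<lambda>_. 0)"
  shows "f = 0"
  using assms
proof (transfer, goal_cases)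
  case (1 f)
  have "AE t in torus_measure. f t = 0"
    by (rule AE_eq_zero_of_orthogonal)
      (use 1 in \<open>auto intro: square_integrable_imp_integrable dest: fun_cong\<close>)
  then show ?case using 1 by simp
qed

lemma fourier_coeff_sum: "fourier_coeff (\<Sum>s\<in>S. f s) k = (\<Sum>s\<in>S. fourier_coeff (f s) k)"
proof -
  have "fourier_coeff (0 :: 'a l2_torus) k = 0" by transfer simp
  then show ?thesis
    by (induction S rule: infinite_finite_induct) (auto simp: fourier_coeff_add)
qed

lemma fourier_coeff_sum_torus_unit:
  assumes "finite S"
  shows "fourier_coeff (\<Sum>k\<in>S. c k *\<^sub>C torus_unit k) l = (if l \<in> S then c l else 0)"
proof -
  have "fourier_coeff (\<Sum>k\<in>S. c k *\<^sub>C torus_unit k) l = (\<Sum>k\<in>S. if k = l then c k else 0)"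
    unfolding fourier_coeff_sum by (intro sum.cong) (auto simp: fourier_coeff_scaleC fourier_coeff_torus_unit)
  then show ?thesis using assms by simp
qed

lemma norm_sum_torus_unit:
  assumes "finite S"
  shows "(norm (\<Sum>k\<in>S. c k *\<^sub>C torus_unit k))\<^sup>2 = (\<Sum>k\<in>S. (cmod (c k))\<^sup>2)"
proof -
  have "cnj z * z = of_real ((cmod z)\<^sup>2)" for z by (simp only: complex_norm_square mult.commute)
  then show ?thesis
    using assms by (simp add: power2_norm_eq_inner inner_sum_right inner_torus_unit fourier_coeff_sum_torus_unit
        del: times_complex.sel)
qed

lemma bessel:
  assumes "finite S"
  shows "(\<Sum>k\<in>S. (cmod (fourier_coeff f k))\<^sup>2) \<le> (norm f)\<^sup>2"
proof -
  define p where "p = (\<Sum>k\<in>S. fourier_coeff f k *\<^sub>C torus_unit k)"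
  let ?s = "\<Sum>k\<in>S. (cmod (fourier_coeff f k))\<^sup>2"
  have "cnj z * z = of_real ((cmod z)\<^sup>2)" for z by (simp only: complex_norm_square mult.commute)
  then have fp: "f \<bullet> p = ?s" by (simp add: p_def inner_sum_right inner_torus_unit del: times_complex.sel)
  have pp: "p \<bullet> p = ?s"
    using norm_sum_torus_unit[OF assms, of "fourier_coeff f"] by (simp add: p_def power2_norm_eq_inner)
  have "0 \<le> (f - p) \<bullet> (f - p)" by simp
  also have "\<dots> = f \<bullet> f - ?s"
    using fp pp by (simp add: inner_diff_left inner_diff_right inner_commute)
  finally show ?thesis by (simp add: power2_norm_eq_inner)
qed

lemma cmod_fourier_coeff_le: "cmod (fourier_coeff f k) \<le> norm f"
  by (rule power2_le_imp_le) (use bessel[of "{k}" f] in simp_all)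

lemma bounded_linear_fourier_coeff: "bounded_linear (\<lambda>f. fourier_coeff f k)"
proof (rule bounded_linear_intro[where K = 1])
  show "fourier_coeff (r *\<^sub>R f) k = r *\<^sub>R fourier_coeff f k" for r f
    unfolding scaleC_of_real[symmetric] by (simp add: fourier_coeff_scaleC scaleR_conv_of_real)
qed (auto simp: fourier_coeff_add cmod_fourier_coeff_le)

text \<open>\<open>Abs_ell2\<close> can be inverted only on square-summable families, which Bessel's
  inequality guarantees here.\<close>

lemma ell2_apply_fourier: "ell2_apply (fourier f) = fourier_coeff f"
proof -
  have "(\<lambda>k. (cmod (fourier_coeff f k))\<^sup>2) summable_on UNIV"
    by (intro nonneg_bdd_above_summable_on bdd_aboveI2[where M = "(norm f)\<^sup>2"]) (auto intro: bessel)
  then show ?thesis by (simp add: fourier_def Abs_ell2_inverse)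
qed

text \<open>By orthonormality the squared distance of two partial sums is an increment of the real
  sequence \<open>s\<close>, so completeness gives a limit, and continuity of each coefficient
  identifies its transform. The equality of norms is recorded for
  \<open>norm_fourier\<close>.\<close>

lemma riesz_fischer:
  fixes a :: "(int^'n::finite) ell2"
  shows "\<exists>f. fourier f = a \<and> norm f = norm a"
proof -
  obtain e :: "nat \<Rightarrow> int^'n" where e: "bij e" using bij_nat_int_vec by blast
  define s where "s m = (\<Sum>i<m. (cmod (ell2_apply a (e i)))\<^sup>2)" for m
  have "((\<lambda>i. (cmod (ell2_apply a i))\<^sup>2) has_sum (norm a)\<^sup>2) (range e)"
    using norm_ell2_has_sum e by (simp add: bij_is_surj)
  then have "((\<lambda>i. (cmod (ell2_apply a (e i)))\<^sup>2) has_sum (norm a)\<^sup>2) UNIV"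
    using e by (subst (asm) has_sum_reindex) (auto simp: bij_is_inj o_def)
  then have s: "s \<longlonglongrightarrow> (norm a)\<^sup>2"
    unfolding s_def by (drule_tac has_sum_imp_sums) (simp add: sums_def)
  define X where "X m = (\<Sum>k\<in>e ` {..<m}. ell2_apply a k *\<^sub>C torus_unit k)" for m
  have sum_e: "(\<Sum>k\<in>e ` S. (cmod (ell2_apply a k))\<^sup>2) = (\<Sum>i\<in>S. (cmod (ell2_apply a (e i)))\<^sup>2)" for S
    using e by (simp add: sum.reindex inj_on_subset[OF bij_is_inj])
  have normX: "(norm (X m))\<^sup>2 = s m" for m
    by (simp add: X_def norm_sum_torus_unit sum_e s_def)
  have diff: "(norm (X n - X m))\<^sup>2 = s n - s m" if mn: "m \<le> n" for m n
  proof -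
    have split: "{..<n} = {..<m} \<union> {m..<n}" using mn by auto
    have "e ` {..<n} = e ` {..<m} \<union> e ` {m..<n}" by (simp add: split image_Un)
    moreover have "e ` {..<m} \<inter> e ` {m..<n} = {}"
      using e by (auto simp: bij_is_inj inj_eq)
    ultimately have "X n = X m + (\<Sum>k\<in>e ` {m..<n}. ell2_apply a k *\<^sub>C torus_unit k)"
      unfolding X_def by (simp add: sum.union_disjoint)
    moreover have "s n = s m + (\<Sum>i=m..<n. (cmod (ell2_apply a (e i)))\<^sup>2)"
      unfolding s_def split by (rule sum.union_disjoint) auto
    ultimately show ?thesis by (simp add: norm_sum_torus_unit sum_e)
  qed
  have "Cauchy X"
  proof (rule CauchyI)
    fix \<epsilon> :: real assume \<epsilon>: "\<epsilon> > 0"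
    then obtain M where M: "\<And>m n. m \<ge> M \<Longrightarrow> n \<ge> M \<Longrightarrow> norm (s m - s n) < \<epsilon>\<^sup>2"
      using CauchyD[OF LIMSEQ_imp_Cauchy[OF s], of "\<epsilon>\<^sup>2"] by auto
    have le: "norm (X n - X m) < \<epsilon>" if "m \<ge> M" "m \<le> n" for m n
    proof (rule power2_less_imp_less)
      show "(norm (X n - X m))\<^sup>2 < \<epsilon>\<^sup>2"
        using M[of n m] that by (simp add: diff)
    qed (use \<epsilon> in simp)
    show "\<exists>M. \<forall>m\<ge>M. \<forall>n\<ge>M. norm (X m - X n) < \<epsilon>"
    proof (intro exI[of _ M] allI impI)
      fix m n assume "m \<ge> M" "n \<ge> M"
      then show "norm (X m - X n) < \<epsilon>"
        using le[of m n] le[of n m] by (cases "m \<le> n") (auto simp: norm_minus_commute)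
    qed
  qed
  then obtain f where f: "X \<longlonglongrightarrow> f" using Cauchy_convergent by (auto simp: convergent_def)
  have "fourier_coeff f (e j) = ell2_apply a (e j)" for j
  proof -
    have "(\<lambda>m. fourier_coeff (X m) (e j)) \<longlonglongrightarrow> fourier_coeff f (e j)"
      by (rule bounded_linear.tendsto[OF bounded_linear_fourier_coeff f])
    moreover have "fourier_coeff (X m) (e j) = ell2_apply a (e j)" if "m > j" for m
      using that by (simp add: X_def fourier_coeff_sum_torus_unit)
    then have "eventually (\<lambda>m. fourier_coeff (X m) (e j) = ell2_apply a (e j)) sequentially"
      by (auto simp: eventually_at_top_dense)
    then have "(\<lambda>m. fourier_coeff (X m) (e j)) \<longlonglongrightarrow> ell2_apply a (e j)"
      by (rule tendsto_eventually)
    ultimately show ?thesis by (rule LIMSEQ_unique)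
  qed
  then have "ell2_apply (fourier f) k = ell2_apply a k" for k
    using bij_pointE[OF e, of k] by (auto simp: ell2_apply_fourier)
  then have "fourier f = a" by (rule ell2_eqI)
  moreover have "s \<longlonglongrightarrow> (norm f)\<^sup>2"
    unfolding normX[symmetric, abs_def] using f by (intro tendsto_intros)
  then have "(norm f)\<^sup>2 = (norm a)\<^sup>2" using s by (rule LIMSEQ_unique)
  then have "norm f = norm a" by (simp add: power2_eq_iff_nonneg)
  ultimately show ?thesis by blast
qed

lemma fourier_add: "fourier (f + g) = fourier f + fourier g"
  by (rule ell2_eqI) (simp add: ell2_apply_fourier plus_ell2.rep_eq fourier_coeff_add)

lemma fourier_scaleC: "fourier (c *\<^sub>C f) = c *\<^sub>C fourier f"
  by (rule ell2_eqI) (simp add: ell2_apply_fourier scaleC_ell2.rep_eq fourier_coeff_scaleC)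

lemma inj_fourier: "inj fourier"
proof (rule injI)
  fix f g :: "'a l2_torus" assume eq: "fourier f = fourier g"
  have fg: "fourier_coeff f k = fourier_coeff g k" for k
    unfolding ell2_apply_fourier[symmetric] eq ..
  have "fourier_coeff (f + (- 1) *\<^sub>C g) k = 0" for k
    unfolding fourier_coeff_add fourier_coeff_scaleC fg by simp
  then have "f + (- 1) *\<^sub>C g = 0"
    by (intro fourier_coeff_eq_zero ext)
  then show "f = g" by (simp add: complex_vector.scale_minus_left)
qed

lemma bij_fourier: "bij fourier"
  unfolding bij_def surj_def
proof (intro conjI inj_fourier allI)
  show "\<exists>f. a = fourier f" for a using riesz_fischer[of a] by blast
qed

text \<open>Riesz-Fischer yields a preimage of \<open>fourier f\<close> of the right norm, and
  injectivity says that it is \<open>f\<close>.\<close>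

lemma norm_fourier: "norm (fourier f) = norm f"
  using riesz_fischer[of "fourier f"] by (auto simp: inj_eq[OF inj_fourier])

section \<open>Transport along an isometric isomorphism\<close>

text \<open>Coordinates in a basis of the range. The functionals are merely linear, which is all
  that \<open>det_one_plus_eq\<close> asks of them, so this works in every Banach space.\<close>

lemma finite_rank_form:
  assumes F: "finite_rank F"
  obtains r and \<phi> :: "nat \<Rightarrow> 'a::complex_banach \<Rightarrow> complex" and u
  where "\<And>l. l < r \<Longrightarrow> Vector_Spaces.linear (*\<^sub>C) (*) (\<phi> l)"
    "\<And>l. l < r \<Longrightarrow> u l \<in> range F" "\<And>x. F x = (\<Sum>l<r. \<phi> l x *\<^sub>C u l)"
proof -
  obtain bs where bs: "is_basis_of bs (range F)" using finite_rank_range_basis[OF F] by blast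
  have lin: "Vector_Spaces.linear (*\<^sub>C) (*\<^sub>C) F"
    using F by (auto simp: finite_rank_def intro: bounded_clinear_linear)
  have ind: "complex_vector.independent (set bs)" and span: "complex_vector.span (set bs) = range F"
    using bs by (auto simp: is_basis_of_def)
  show thesis
  proof (rule that[of "length bs" "\<lambda>l x. complex_vector.representation (set bs) (F x) (bs ! l)" "\<lambda>l. bs ! l"])
    show "Vector_Spaces.linear (*\<^sub>C) (*) (\<lambda>x. complex_vector.representation (set bs) (F x) (bs ! l))" for l
      unfolding Vector_Spaces.linear_iff
      by (simp add: complex_vector.vector_space_axioms vector_space_over_itself.vector_space_axioms
          complex_pair.linear_add[OF lin] complex_pair.linear_scale[OF lin]
          complex_vector.representation_add complex_vector.representation_scale ind span)
    show "bs ! l \<in> range F" if "l < length bs" for l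
      using that complex_vector.span_base[of "bs ! l" "set bs"] by (simp add: span)
    show "F x = (\<Sum>l<length bs. complex_vector.representation (set bs) (F x) (bs ! l) *\<^sub>C bs ! l)" for x
      using sum_scaleC_representation[OF bs, of "F x"] by simp
  qed
qed

lemma subalgebra_diff:
  assumes "subalgebra D" "A \<in> D" "B \<in> D"
  shows "(\<lambda>x. A x - B x) \<in> D"
proof -
  have "(\<lambda>x. (- 1) *\<^sub>C B x) \<in> D" using assms by (simp only: subalgebra_def)
  then have "(\<lambda>x. A x + (- 1) *\<^sub>C B x) \<in> D" using assms by (simp only: subalgebra_def)
  then show ?thesis by (simp add: complex_vector.scale_minus_left)
qed

text \<open>Abstracting from \<open>fourier\<close> makes the inverse another instance, so
  implications about \<open>pull\<close> can be reversed.\<close>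

locale banach_isomorphism =
  fixes U :: "'a::complex_banach \<Rightarrow> 'b::complex_banach"
  assumes bij: "bij U"
    and add: "U (x + y) = U x + U y"
    and scaleC: "U (c *\<^sub>C x) = c *\<^sub>C U x"
    and norm: "norm (U x) = norm x"
begin

abbreviation V :: "'b \<Rightarrow> 'a" where
  "V \<equiv> inv_into UNIV U"

definition pull :: "('b \<Rightarrow> 'b) \<Rightarrow> 'a \<Rightarrow> 'a" where
  "pull A = V \<circ> A \<circ> U"

definition push :: "('a \<Rightarrow> 'a) \<Rightarrow> 'b \<Rightarrow> 'b" where
  "push T = U \<circ> T \<circ> V"

lemma U_inv [simp]: "U (V y) = y"
  by (rule surj_f_inv_f[OF bij_is_surj[OF bij]])

lemma inv_U [simp]: "V (U x) = x"
  by (rule inv_f_f[OF bij_is_inj[OF bij]])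

lemma U_eq_iff [simp]: "U x = U y \<longleftrightarrow> x = y"
  by (rule inj_eq[OF bij_is_inj[OF bij]])

lemma inv_add: "V (x + y) = V x + V y"
  by (subst U_eq_iff[symmetric]) (simp add: add)

lemma inv_scaleC: "V (c *\<^sub>C x) = c *\<^sub>C V x"
  by (subst U_eq_iff[symmetric]) (simp add: scaleC)

lemma inv_norm: "norm (V x) = norm x"
  using norm[of "V x"] by simp

lemma linear_inv_U: "Vector_Spaces.linear (*\<^sub>C) (*\<^sub>C) V"
  by (simp add: Vector_Spaces.linear_iff complex_vector.vector_space_axioms inv_add inv_scaleC)

lemma bounded_linear_U: "bounded_linear U"
  by (rule bounded_linear_intro[where K = 1]) (auto simp: add scaleC norm simp flip: scaleC_of_real)

lemma bounded_linear_inv_U: "bounded_linear V"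
  by (rule bounded_linear_intro[where K = 1])
    (auto simp: inv_add inv_scaleC inv_norm simp flip: scaleC_of_real)

lemma push_pull [simp]: "push (pull A) = A"
  by (auto simp: push_def pull_def)

lemma inj_pull: "inj pull"
  by (metis injI push_pull)

lemma pull_apply: "pull A x = V (A (U x))"
  by (simp add: pull_def)

lemma pull_zero: "pull (\<lambda>x. 0) = (\<lambda>x. 0)"
  using complex_pair.linear_0[OF linear_inv_U] by (auto simp: pull_def)

lemma pull_add: "pull (\<lambda>x. A x + B x) = (\<lambda>x. pull A x + pull B x)"
  by (auto simp: pull_def inv_add)

lemma pull_scaleC: "pull (\<lambda>x. c *\<^sub>C A x) = (\<lambda>x. c *\<^sub>C pull A x)"
  by (auto simp: pull_def inv_scaleC)

lemma pull_diff: "pull (\<lambda>x. A x - B x) = (\<lambda>x. pull A x - pull B x)"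
  using complex_pair.linear_diff[OF linear_inv_U] by (auto simp: pull_def)

lemma pull_comp: "pull (A \<circ> B) = pull A \<circ> pull B"
  by (auto simp: pull_def)

lemma bounded_clinear_pull: "bounded_clinear A \<Longrightarrow> bounded_clinear (pull A)"
  unfolding pull_def bounded_clinear_def o_def
  by (auto simp: scaleC inv_scaleC intro: bounded_linear_compose[OF bounded_linear_inv_U]
      bounded_linear_compose[OF _ bounded_linear_U])

lemma finite_rank_pull:
  assumes "finite_rank F"
  shows "finite_rank (pull F)"
proof -
  obtain S where S: "finite S" "range F \<subseteq> complex_vector.span S"
    using assms by (auto simp: finite_rank_def)
  have "range (pull F) \<subseteq> V ` range F" by (auto simp: pull_def)
  also have "\<dots> \<subseteq> V ` complex_vector.span S" using S(2) by (rule image_mono)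
  also have "\<dots> = complex_vector.span (V ` S)"
    by (rule complex_pair.linear_span_image[OF linear_inv_U, symmetric])
  finally show ?thesis
    using assms S(1) by (auto simp: finite_rank_def bounded_clinear_pull)
qed

lemma finite_rank_pull_iff: "finite_rank (pull F) \<longleftrightarrow> finite_rank F"
proof
  assume F: "finite_rank (pull F)"
  \<comment> \<open>Pulling back along \<open>V\<close> undoes \<open>pull\<close>, so the converse
    is the same implication for the inverse isomorphism.\<close>
  interpret inv: banach_isomorphism V
    by unfold_locales (auto simp: bij_imp_bij_inv[OF bij] inv_add inv_scaleC inv_norm)
  have "inv.pull (pull F) = F"
    using bij by (auto simp: inv.pull_def pull_def inv_inv_eq)
  then show "finite_rank F" using inv.finite_rank_pull[OF F] by simp
qed (rule finite_rank_pull)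

text \<open>The form of \<open>F\<close> is transported to functionals
  \<open>\<phi> l \<circ> U\<close> and vectors \<open>V (u l)\<close>. Their pairings are
  unchanged, and the determinant depends on these alone.\<close>

lemma det_one_plus_pull:
  assumes F: "finite_rank F"
  shows "det_one_plus (pull F) = det_one_plus F"
proof -
  obtain r and \<phi> :: "nat \<Rightarrow> 'b \<Rightarrow> complex" and u
    where \<phi>: "\<And>l. l < r \<Longrightarrow> Vector_Spaces.linear (*\<^sub>C) (*) (\<phi> l)"
      and u: "\<And>l. l < r \<Longrightarrow> u l \<in> range F" and rep: "\<And>x. F x = (\<Sum>l<r. \<phi> l x *\<^sub>C u l)"
    by (rule finite_rank_form[OF F]) (rule that)
  have "det_one_plus (pull F) = id_plus_det r (\<lambda>k l. \<phi> k (U (V (u l))))"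
  proof (rule det_one_plus_eq[OF finite_rank_pull[OF F]])
    show "Vector_Spaces.linear (*\<^sub>C) (*) (\<lambda>x. \<phi> l (U x))" if "l < r" for l
      using \<phi>[OF that] by (simp add: Vector_Spaces.linear_iff add scaleC complex_vector.vector_space_axioms)
    show "V (u l) \<in> range (pull F)" if l: "l < r" for l
    proof -
      obtain y where "u l = F y" using u[OF l] by auto
      then have "V (u l) = pull F (V y)" by (simp add: pull_apply)
      then show ?thesis by simp
    qed
    show "pull F x = (\<Sum>l<r. \<phi> l (U x) *\<^sub>C V (u l))" for x
      unfolding pull_apply
      by (subst rep) (simp add: complex_pair.linear_sum[OF linear_inv_U] inv_scaleC)
  qed
  also have "\<dots> = det_one_plus F"
    using det_one_plus_eq[OF F \<phi> u rep] by simp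
  finally show ?thesis .
qed

text \<open>Written with \<open>the_inv_into D\<close>, in the shape of \<open>Gamma_norm\<close>,
  so that the two are identified by unfolding.\<close>

definition pull_norm :: "('b \<Rightarrow> 'b) set \<Rightarrow> (('b \<Rightarrow> 'b) \<Rightarrow> real) \<Rightarrow> ('a \<Rightarrow> 'a) \<Rightarrow> real" where
  "pull_norm D nrm T = nrm (the_inv_into D pull T)"

lemma pull_norm_pull: "A \<in> D \<Longrightarrow> pull_norm D nrm (pull A) = nrm A"
  by (simp add: pull_norm_def the_inv_into_f_f inj_on_subset[OF inj_pull])

lemma embedded_subalgebra_pull:
  assumes "embedded_subalgebra D nrm"
  shows "embedded_subalgebra (pull ` D) (pull_norm D nrm)"
proof -
  from assms have sub: "subalgebra D" and nrm: "norm_on D nrm"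
    and C: "\<exists>C>0. \<forall>A\<in>D. onorm A \<le> C * nrm A"
    and mult: "\<forall>A\<in>D. \<forall>B\<in>D. nrm (A \<circ> B) \<le> nrm A * nrm B"
    by (auto simp: embedded_subalgebra_def)
  have D: "\<And>A. A \<in> D \<Longrightarrow> bounded_clinear A" "(\<lambda>x. 0) \<in> D"
    "\<And>A B. A \<in> D \<Longrightarrow> B \<in> D \<Longrightarrow> (\<lambda>x. A x + B x) \<in> D"
    "\<And>c A. A \<in> D \<Longrightarrow> (\<lambda>x. c *\<^sub>C A x) \<in> D" "\<And>A B. A \<in> D \<Longrightarrow> B \<in> D \<Longrightarrow> A \<circ> B \<in> D"
    using sub by (auto simp: subalgebra_def)
  have onorm_pull: "onorm (pull A) \<le> onorm A" if "A \<in> D" for A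
  proof -
    have A: "bounded_linear A" using D(1)[OF that] by (simp add: bounded_clinear_def)
    have "norm (pull A x) \<le> onorm A * norm x" for x
      using onorm[OF A, of "U x"] by (simp add: pull_apply inv_norm norm)
    then show ?thesis by (intro onorm_bound onorm_pos_le[OF A])
  qed
  have "subalgebra (pull ` D)"
    unfolding subalgebra_def
    using D bounded_clinear_pull
    by (auto simp: pull_zero[symmetric] pull_add[symmetric] pull_scaleC[symmetric] pull_comp[symmetric])
  moreover have "norm_on (pull ` D) (pull_norm D nrm)"
  proof -
    have "pull A = (\<lambda>x. 0) \<longleftrightarrow> A = (\<lambda>x. 0)" for A
      by (subst pull_zero[symmetric]) (rule inj_eq[OF inj_pull])
    then show ?thesis
      using nrm D unfolding norm_on_def
      by (auto simp: pull_add[symmetric] pull_scaleC[symmetric] pull_norm_pull)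
  qed
  moreover have "\<exists>C>0. \<forall>T\<in>pull ` D. onorm T \<le> C * pull_norm D nrm T"
    using C onorm_pull by (auto simp: pull_norm_pull) (meson order_trans)
  moreover have "\<forall>S\<in>pull ` D. \<forall>T\<in>pull ` D. pull_norm D nrm (S \<circ> T) \<le> pull_norm D nrm S * pull_norm D nrm T"
    using mult D by (auto simp: pull_comp[symmetric] pull_norm_pull)
  ultimately show ?thesis by (simp add: embedded_subalgebra_def)
qed

lemma pull_norm_diff:
  assumes "subalgebra D" "A \<in> D" "B \<in> D"
  shows "pull_norm D nrm (\<lambda>x. pull A x - pull B x) = nrm (\<lambda>x. A x - B x)"
  using pull_norm_pull[OF subalgebra_diff[OF assms]] by (simp add: pull_diff)

lemma approximable_pull:
  assumes "subalgebra D" "approximable D nrm"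
  shows "approximable (pull ` D) (pull_norm D nrm)"
  using assms(2) unfolding approximable_def
  by (auto simp: pull_norm_diff[OF assms(1)] finite_rank_pull_iff)

lemma is_det_extension_pull_iff:
  assumes "subalgebra D"
  shows "is_det_extension (pull ` D) (pull_norm D nrm) g \<longleftrightarrow> is_det_extension D nrm (g \<circ> pull)"
  unfolding is_det_extension_def
  by (auto simp: pull_norm_diff[OF assms] finite_rank_pull_iff det_one_plus_pull)

text \<open>The candidate values in the two definite descriptions coincide, so uniqueness of the continuous
  extension plays no role.\<close>

lemma extended_det_pull:
  assumes "subalgebra D"
  shows "extended_det (pull ` D) (pull_norm D nrm) (pull A) = extended_det D nrm A"
proof -
  have "(\<exists>g. is_det_extension (pull ` D) (pull_norm D nrm) g \<and> z = g (pull A)) \<longleftrightarrow>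
      (\<exists>g. is_det_extension D nrm g \<and> z = g A)" for z
  proof
    assume "\<exists>g. is_det_extension D nrm g \<and> z = g A"
    then obtain g where g: "is_det_extension D nrm g" "z = g A" by blast
    \<comment> \<open>As \<open>push\<close> undoes \<open>pull\<close>, composing with it carries
      an extension on \<open>D\<close> over to the pulled-back algebra.\<close>
    have "(g \<circ> push) \<circ> pull = g" by auto
    then show "\<exists>g. is_det_extension (pull ` D) (pull_norm D nrm) g \<and> z = g (pull A)"
      using g by (intro exI[of _ "g \<circ> push"]) (simp add: is_det_extension_pull_iff[OF assms])
  qed (auto simp: is_det_extension_pull_iff[OF assms])
  then show ?thesis by (simp add: extended_det_def)
qed

end

interpretation fourier: banach_isomorphism fourier
  by unfold_locales (auto simp: bij_fourier fourier_add fourier_scaleC norm_fourier)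

lemma Gamma_op_eq_pull: "Gamma_op = fourier.pull"
  by (rule ext) (simp add: Gamma_op_def fourier.pull_def)

lemma Gamma_norm_eq_pull_norm: "Gamma_norm = fourier.pull_norm poincare_algebra poincare_norm"
  by (rule ext) (simp add: Gamma_norm_def fourier.pull_norm_def Gamma_op_eq_pull)

lemma subalgebra_poincare:
  "subalgebra (poincare_algebra :: ((int^'n) ell2 \<Rightarrow> (int^'n) ell2) set)"
  using embedded_subalgebra_poincare by (auto simp: embedded_subalgebra_def)

theorem theorem3p3:
  shows "embedded_subalgebra (Gamma_algebra :: (('n::finite) l2_torus \<Rightarrow> 'n l2_torus) set) Gamma_norm
    \<and> approximable (Gamma_algebra :: ('n l2_torus \<Rightarrow> 'n l2_torus) set) Gamma_norm
    \<and> (\<exists>g. is_det_extension (Gamma_algebra :: ('n l2_torus \<Rightarrow> 'n l2_torus) set) Gamma_norm g)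
    \<and> (\<forall>A \<in> (poincare_algebra :: ((int^'n) ell2 \<Rightarrow> (int^'n) ell2) set).
         extended_det Gamma_algebra Gamma_norm (Gamma_op A) = extended_det poincare_algebra poincare_norm A)"
  unfolding Gamma_algebra_def Gamma_norm_eq_pull_norm Gamma_op_eq_pull
proof (intro conjI ballI)
  let ?D = "poincare_algebra :: ((int^'n) ell2 \<Rightarrow> (int^'n) ell2) set"
  let ?nrm = "fourier.pull_norm ?D poincare_norm"
  show "embedded_subalgebra (fourier.pull ` ?D) ?nrm"
    by (rule fourier.embedded_subalgebra_pull[OF embedded_subalgebra_poincare])
  show "approximable (fourier.pull ` ?D) ?nrm"
    by (rule fourier.approximable_pull[OF subalgebra_poincare approximable_poincare])
  obtain g where g: "is_det_extension ?D poincare_norm g" using poincare_det_extension by blast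
  have "(g \<circ> fourier.push) \<circ> fourier.pull = g" by auto
  then have "is_det_extension (fourier.pull ` ?D) ?nrm (g \<circ> fourier.push)"
    using g by (simp add: fourier.is_det_extension_pull_iff[OF subalgebra_poincare])
  then show "\<exists>g. is_det_extension (fourier.pull ` ?D) ?nrm g" by blast
  show "extended_det (fourier.pull ` ?D) ?nrm (fourier.pull A) = extended_det ?D poincare_norm A"
    if "A \<in> ?D" for A
    by (rule fourier.extended_det_pull[OF subalgebra_poincare])
qed

end
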